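(* For every integer $n\ge 0$ and every $t\in\mathbb{F}_2^{n+1}$, the Castelnuovo–Mumford regularity of the toric ring $R(n,t)=S(n)/I_{G_n^t}$ is $$\operatorname{reg}R(n,t)=\lfloor n/2\rfloor+1.$$
   Context: Throughout, $k$ is a field. Ladder-like structures. For $n\ge 0$ and $t=(t_1,\dots,t_{n+1})\in\mathbb{F}_2^{n+1}$, $L_n^t$ is a partially filled array with $\lfloor n/2\rfloor+2$ rows (numbered top to bottom) and $\lceil n/2\rceil+2$ columns (numbered left to right); its nonzero entries are the variables $x_0,x_2,x_3,\dots,x_{2n+4}$ (there is no $x_1$), each occurring exactly once, all other positions being empty. It is defined recursively, with $\widehat t=(t_1,\dots,t_n)$: - $L_0^t$ has first row $x_0,x_2$ and second row $x_3,x_4$ (for both values of $t$). - $L_1^t$ has first row $x_0,x_2,x_5$ and second row $x_3,x_4,x_6$ (for all $t$). - For $n\ge 2$ even, $L_n^t$ is $L_{n-1}^{\widehat t}$ with a new bottom row added whose only nonzero entries are $x_{2n+4}$, in the last column, and $x_{2n+3}$, in the column containing the first (if $t_{n+1}=0$) or the second (if $t_{n+1}=1$) nonzero entry, from left to right, of the row immediately above the new row. - For $n\ge 3$ odd, $L_n^t$ is $L_{n-1}^{\widehat t}$ with a new rightmost column added whose only nonzero entries are $x_{2n+4}$, in the last row, and $x_{2n+3}$, in the row containing the first (if $t_{n+1}=0$) or the second (if $t_{n+1}=1$) nonzero entry, from top to bottom, of the column immediately to the left of the new column. Graphs and toric rings. $G_n^t$ is the bipartite graph with one vertex for each row and one vertex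 for each column of $L_n^t$, and, for each nonzero entry $x_j$ of $L_n^t$, one edge (called $x_j$) joining the vertex of its row to the vertex of its column. Let $V$ be its vertex set, $S(n)=k[x_0,x_2,x_3,\dots,x_{2n+4}]$ the polynomial ring on the edges, and $I_{G_n^t}$ (the toric ideal) the kernel of the $k$-algebra homomorphism $S(n)\to k[V]$ sending each edge to the product of its two endpoints. The toric ring is $R(n,t)=S(n)/I_{G_n^t}$, graded with all variables in degree 1; its regularity is taken as a graded $S(n)$-module. *)

theory Defs
  imports
    "HOL-Library.Poly_Mapping"
    "HOL-Library.Z2"
    "HOL-Library.Extended_Real"
    "HOL-Algebra.QuotRing"
    "HOL-Algebra.Module"
    "Jordan_Normal_Form.Matrix"
begin

section \<open>Polynomial rings in a set of variables\<close>

text \<open>A polynomial is a finitely supported function from monomials to coefficients, a monomial a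
  finitely supported exponent function; multiplication is the convolution product of
  \<^theory>\<open>HOL-Library.Poly_Mapping\<close>.\<close>

type_synonym ('x, 'k) mpoly = "('x \<Rightarrow>\<^sub>0 nat) \<Rightarrow>\<^sub>0 'k"

definition var :: "'x \<Rightarrow> ('x, 'k::field) mpoly" where
  "var x = Poly_Mapping.single (Poly_Mapping.single x 1) 1"

definition monomial_degree :: "('x \<Rightarrow>\<^sub>0 nat) \<Rightarrow> nat" where
  "monomial_degree m = (\<Sum>x\<in>Poly_Mapping.keys m. Poly_Mapping.lookup m x)"

text \<open>With degrees in \<^typ>\<open>int\<close>, the homogeneous component in each negative degree is zero.\<close>

definition homogeneous :: "int \<Rightarrow> ('x, 'k::field) mpoly \<Rightarrow> bool" where
  "homogeneous j p \<longleftrightarrow> (\<forall>m\<in>Poly_Mapping.keys p. int (monomial_degree m) = j)"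

definition poly_ring :: "'x set \<Rightarrow> ('x, 'k::field) mpoly ring" where
  "poly_ring X =
     \<lparr>carrier = {p. \<forall>m\<in>Poly_Mapping.keys p. Poly_Mapping.keys m \<subseteq> X},
      monoid.mult = (*), one = 1, zero = 0, add = (+)\<rparr>"

text \<open>The \<open>'k\<close>-algebra homomorphism that sends each variable \<open>x\<close> to \<open>f x\<close>.\<close>

definition poly_subst :: "('x \<Rightarrow> ('y, 'k) mpoly) \<Rightarrow> ('x, 'k::field) mpoly \<Rightarrow> ('y, 'k) mpoly" where
  "poly_subst f p =
     (\<Sum>m\<in>Poly_Mapping.keys p.
        Poly_Mapping.single 0 (Poly_Mapping.lookup p m) *
        (\<Prod>x\<in>Poly_Mapping.keys m. f x ^ Poly_Mapping.lookup m x))"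


section \<open>Graded modules, minimal graded free resolutions, regularity\<close>

record ('a, 'm) graded_module = "('a, 'm) module" +
  component :: "int \<Rightarrow> 'm set"

definition free_module :: "'x set \<Rightarrow> nat \<Rightarrow> ('x, 'k::field) mpoly vec set" where
  "free_module X r = {v \<in> carrier_vec r. \<forall>a<r. v $ a \<in> carrier (poly_ring X)}"

text \<open>
  For \<open>S = poly_ring X\<close> and a graded \<open>S\<close>-module \<open>M\<close>, the data \<open>d, A, g\<close> describe the complex
  \<open>\<dots> \<rightarrow> F 2 \<rightarrow> F 1 \<rightarrow> F 0 \<rightarrow> M \<rightarrow> 0\<close> where \<open>F i\<close> is the direct sum of the \<open>S(- d i ! a)\<close> over
  \<open>a < length (d i)\<close>, the map \<open>F (i + 1) \<rightarrow> F i\<close> is given by the matrix \<open>A i\<close>, and \<open>F 0 \<rightarrow> M\<close>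
  sends the \<open>a\<close>-th basis vector to \<open>g ! a\<close>. All maps are homogeneous of degree \<open>0\<close>.
  The resolution is minimal when each \<open>F (i + 1) \<rightarrow> F i\<close> has its image in \<open>\<mm> F i\<close>, \<open>\<mm>\<close> being the
  ideal generated by the variables, that is, when no matrix entry has a constant term.
  A resolution of finite length is one in which \<open>d i = []\<close> for all large \<open>i\<close>.
\<close>

definition augmentation ::
  "(('x, 'k::field) mpoly, 'm) graded_module \<Rightarrow> 'm list \<Rightarrow> ('x, 'k) mpoly vec \<Rightarrow> 'm" where
  "augmentation M g v = (\<Oplus>\<^bsub>M\<^esub>a\<in>{..<length g}. (v $ a) \<odot>\<^bsub>M\<^esub> (g ! a))"

definition graded_free_resolution ::
  "'x set \<Rightarrow> (('x, 'k::field) mpoly, 'm) graded_module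
    \<Rightarrow> (nat \<Rightarrow> int list) \<Rightarrow> (nat \<Rightarrow> ('x, 'k) mpoly mat) \<Rightarrow> 'm list \<Rightarrow> bool" where
  "graded_free_resolution X M d A g \<longleftrightarrow>
     (\<forall>i. A i \<in> carrier_mat (length (d i)) (length (d (Suc i)))) \<and>
     (\<forall>i. \<forall>a<length (d i). \<forall>b<length (d (Suc i)).
        A i $$ (a, b) \<in> carrier (poly_ring X) \<and>
        homogeneous (d (Suc i) ! b - d i ! a) (A i $$ (a, b))) \<and>
     length g = length (d 0) \<and>
     (\<forall>a<length g. g ! a \<in> component M (d 0 ! a)) \<and>
     augmentation M g ` free_module X (length (d 0)) = carrier M \<and>
     {v \<in> free_module X (length (d 0)). augmentation M g v = \<zero>\<^bsub>M\<^esub>}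
       = (\<lambda>w. A 0 *\<^sub>v w) ` free_module X (length (d 1)) \<and>
     (\<forall>i. {v \<in> free_module X (length (d (Suc i))). A i *\<^sub>v v = 0\<^sub>v (length (d i))}
       = (\<lambda>w. A (Suc i) *\<^sub>v w) ` free_module X (length (d (Suc (Suc i)))))"

definition minimal_graded_free_resolution ::
  "'x set \<Rightarrow> (('x, 'k::field) mpoly, 'm) graded_module
    \<Rightarrow> (nat \<Rightarrow> int list) \<Rightarrow> (nat \<Rightarrow> ('x, 'k) mpoly mat) \<Rightarrow> 'm list \<Rightarrow> bool" where
  "minimal_graded_free_resolution X M d A g \<longleftrightarrow>
     graded_free_resolution X M d A g \<and>
     (\<forall>i. \<forall>a<length (d i). \<forall>b<length (d (Suc i)).
        Poly_Mapping.lookup (A i $$ (a, b)) 0 = 0)"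

text \<open>The number of copies of \<open>S(-j)\<close> in step \<open>i\<close> of the minimal graded free resolution, which exists
  for finitely generated \<open>M\<close> and is unique up to isomorphism.\<close>

definition graded_betti ::
  "'x set \<Rightarrow> (('x, 'k::field) mpoly, 'm) graded_module \<Rightarrow> nat \<Rightarrow> int \<Rightarrow> nat" where
  "graded_betti X M i j =
     count_list ((SOME d. \<exists>A g. minimal_graded_free_resolution X M d A g) i) j"

text \<open>Castelnuovo--Mumford regularity over \<open>poly_ring X\<close>. The supremum is taken in the extended
  reals, so that a finite value is a genuine maximum and the zero module has regularity \<open>-\<infinity>\<close>.\<close>

definition regularity :: "'x set \<Rightarrow> (('x, 'k::field) mpoly, 'm) graded_module \<Rightarrow> ereal" where
  "regularity X M =
     (SUP (i, j)\<in>{(i, j). graded_betti X M i j \<noteq> 0}. ereal (real_of_int (j - int i)))"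


section \<open>Toric rings of graphs\<close>

record ('v, 'e) graph =
  verts :: "'v set"
  edges :: "'e set"
  ends :: "'e \<Rightarrow> 'v set"

definition edge_map :: "('v, 'e) graph \<Rightarrow> ('e, 'k::field) mpoly \<Rightarrow> ('v, 'k) mpoly" where
  "edge_map G = poly_subst (\<lambda>e. \<Prod>v\<in>ends G e. var v)"

definition toric_ideal :: "('v, 'e) graph \<Rightarrow> ('e, 'k::field) mpoly set" where
  "toric_ideal G = a_kernel (poly_ring (edges G)) (poly_ring (verts G)) (edge_map G)"

text \<open>The quotient ring, as a module over the polynomial ring on the edges; its component of degree
  \<open>j\<close> consists of the residue classes of the homogeneous polynomials of degree \<open>j\<close>.\<close>

definition toric_ring ::
  "('v, 'e) graph \<Rightarrow> (('e, 'k::field) mpoly, ('e, 'k) mpoly set) graded_module" where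
  "toric_ring G =
     (let S = poly_ring (edges G); I = toric_ideal G; Q = S Quot I in
       \<lparr>carrier = carrier Q, monoid.mult = monoid.mult Q, one = one Q, zero = zero Q, add = add Q,
        smult = (\<lambda>s c. monoid.mult Q (I +>\<^bsub>S\<^esub> s) c),
        component = (\<lambda>j. {I +>\<^bsub>S\<^esub> p | p. p \<in> carrier S \<and> homogeneous j p})\<rparr>)"


section \<open>Ladder-like structures and their graphs\<close>

text \<open>An array maps a position (row, column), both counted from \<open>1\<close>, to the index of the variable
  there. The parameter \<open>(t\<^sub>1, \<dots>, t\<^sub>n\<^sub>+\<^sub>1)\<close> is a list of length \<open>n + 1\<close>, so \<open>t\<^sub>n\<^sub>+\<^sub>1\<close> is \<open>t ! n\<close>.\<close>

type_synonym array = "nat \<times> nat \<rightharpoonup> nat"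

definition row_entries :: "array \<Rightarrow> nat \<Rightarrow> nat set" where
  "row_entries L r = {c. L (r, c) \<noteq> None}"

definition col_entries :: "array \<Rightarrow> nat \<Rightarrow> nat set" where
  "col_entries L c = {r. L (r, c) \<noteq> None}"

text \<open>The first (for \<open>0\<close>) or second (for \<open>1\<close>) element of a set of positions.\<close>

definition choose_entry :: "bit \<Rightarrow> nat set \<Rightarrow> nat" where
  "choose_entry b P = sorted_list_of_set P ! (if b = 0 then 0 else 1)"

definition ladder_rows :: "nat \<Rightarrow> nat" where
  "ladder_rows n = n div 2 + 2"

definition ladder_cols :: "nat \<Rightarrow> nat" where
  "ladder_cols n = (n + 1) div 2 + 2"

fun ladder :: "nat \<Rightarrow> bit list \<Rightarrow> array" where
  "ladder 0 t = [(1, 1) \<mapsto> 0, (1, 2) \<mapsto> 2,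
                 (2, 1) \<mapsto> 3, (2, 2) \<mapsto> 4]"
| "ladder (Suc 0) t = [(1, 1) \<mapsto> 0, (1, 2) \<mapsto> 2, (1, 3) \<mapsto> 5,
                       (2, 1) \<mapsto> 3, (2, 2) \<mapsto> 4, (2, 3) \<mapsto> 6]"
| "ladder (Suc (Suc m)) t =
     (let n = Suc (Suc m); L = ladder (Suc m) (butlast t);
          R = ladder_rows n; C = ladder_cols n in
      if even n
      then L((R, C) \<mapsto> 2 * n + 4,
             (R, choose_entry (t ! n) (row_entries L (R - 1))) \<mapsto> 2 * n + 3)
      else L((R, C) \<mapsto> 2 * n + 4,
             (choose_entry (t ! n) (col_entries L (C - 1)), C) \<mapsto> 2 * n + 3))"

lemma choose_entry_mem:
  assumes "a < b" "b < c"
  shows "choose_entry s {a, b} \<in> {a, b}" "choose_entry s {a, b, c} \<in> {a, b}"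
proof -
  have "sorted_list_of_set {a, b} = [a, b]" "sorted_list_of_set {a, b, c} = [a, b, c]"
    using assms by simp_all
  then show "choose_entry s {a, b} \<in> {a, b}" "choose_entry s {a, b, c} \<in> {a, b}"
    by (simp_all add: choose_entry_def)
qed

lemma ran_upd2:
  assumes "p \<noteq> q" "L p = None" "L q = None"
  shows "ran (L(p \<mapsto> x, q \<mapsto> y)) = insert y (insert x (ran L))"
  using assms by (simp add: ran_map_upd)

text \<open>Adding entries never overwrites old ones, so the edges are \<open>x\<^sub>0, x\<^sub>2, x\<^sub>3, \<dots>, x\<^sub>2\<^sub>n\<^sub>+\<^sub>4\<close>.
  The invariant records the positions that the next step of the recursion refers to.\<close>

lemma ladder_invariant:
  "dom (ladder n t) \<subseteq> {1..ladder_rows n} \<times> {1..ladder_cols n} \<and>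
   ran (ladder n t) = insert 0 {2..2 * n + 4} \<and>
   (if n = 0 then True
    else if even n
    then (\<exists>c<ladder_cols n. row_entries (ladder n t) (ladder_rows n) = {c, ladder_cols n}) \<and>
         (\<exists>r<ladder_rows n - 1. col_entries (ladder n t) (ladder_cols n)
            = {r, ladder_rows n - 1, ladder_rows n})
    else (\<exists>r<ladder_rows n. col_entries (ladder n t) (ladder_cols n) = {r, ladder_rows n}) \<and>
         (\<exists>c<ladder_cols n - 1. row_entries (ladder n t) (ladder_rows n)
            = {c, ladder_cols n - 1, ladder_cols n}))"
proof (induction n t rule: ladder.induct)
  case (1 t)
  have "insert 0 {2..2 * 0 + 4} = {0, 2, 3, 4::nat}" by auto
  moreover have "ran (ladder 0 t) = {0, 2, 3, 4}"
    by (auto simp: ran_map_upd)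
  moreover have "dom (ladder 0 t) \<subseteq> {1..2} \<times> {1..2}" by auto
  ultimately show ?case
    by (simp add: ladder_rows_def ladder_cols_def numeral_2_eq_2 del: ladder.simps)
next
  case (2 t)
  have vars: "insert 0 {2..2 * Suc 0 + 4} = {0, 2, 3, 4, 5, 6::nat}" by auto
  have dim: "ladder_rows (Suc 0) = 2" "ladder_cols (Suc 0) = 3"
    by (simp_all add: ladder_rows_def ladder_cols_def)
  have "col_entries (ladder (Suc 0) t) 3 = {1, 2}" "row_entries (ladder (Suc 0) t) 2 = {1, 2, 3}"
    by (auto simp: col_entries_def row_entries_def)
  moreover have "ran (ladder (Suc 0) t) = {0, 2, 3, 4, 5, 6}"
    by (auto simp: ran_map_upd)
  moreover have "dom (ladder (Suc 0) t) \<subseteq> {1..2} \<times> {1..3}" by auto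
  ultimately show ?case unfolding vars dim
    by (auto intro!: exI[of _ 1] simp del: ladder.simps)
next
  case (3 m t)
  define n L where "n = Suc (Suc m)" and "L = ladder (Suc m) (butlast t)"
  define R C where "R = ladder_rows n" and "C = ladder_cols n"
  have vars: "insert (2 * n + 3) (insert (2 * n + 4) (insert 0 {2..2 * Suc m + 4}))
      = insert 0 {2..2 * n + 4}"
    by (auto simp: n_def)
  show ?case
  proof (cases "even n")
    case True
    then have odd: "odd (Suc m)" by (simp add: n_def)
    have R: "ladder_rows (Suc m) = R - 1" "R \<ge> 3" and C: "ladder_cols (Suc m) = C"
      using True unfolding n_def R_def C_def ladder_rows_def ladder_cols_def by presburger+
    have dom: "dom L \<subseteq> {1..R - 1} \<times> {1..C}"
      and ran: "ran L = insert 0 {2..2 * Suc m + 4}"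
      using 3 True unfolding L_def n_def[symmetric] by (simp_all add: n_def R C)
    obtain r where r: "r < R - 1" "col_entries L C = {r, R - 1}"
      using 3 True odd unfolding L_def by (auto simp: n_def R C)
    obtain c where c: "c < C - 1" "row_entries L (R - 1) = {c, C - 1, C}"
      using 3 True odd unfolding L_def by (auto simp: n_def R C)
    define e where "e = choose_entry (t ! n) (row_entries L (R - 1))"
    have "e \<in> {c, C - 1}"
      unfolding e_def c(2) using c(1) by (intro choose_entry_mem) auto
    then have e: "e < C" "e \<in> row_entries L (R - 1)" using c by auto
    have e1: "1 \<le> e" using e(2) dom by (auto simp: row_entries_def)
    have L': "ladder n t = L((R, C) \<mapsto> 2 * n + 4, (R, e) \<mapsto> 2 * n + 3)"
      using True by (simp add: n_def L_def R_def C_def e_def Let_def)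
    have new: "L (R, x) = None" for x using dom R by (force simp: domIff)
    have "ran (ladder n t) = insert (2 * n + 3) (insert (2 * n + 4) (ran L))"
      unfolding L' using e by (intro ran_upd2) (auto simp: new)
    then have "ran (ladder n t) = insert 0 {2..2 * n + 4}"
      unfolding ran vars .
    moreover have "dom (ladder n t) \<subseteq> {1..R} \<times> {1..C}"
    proof -
      have "dom L \<subseteq> {1..R} \<times> {1..C}"
        using dom by (rule order_trans) auto
      then show ?thesis
        unfolding L' using e e1 R by simp
    qed
    moreover have "row_entries (ladder n t) R = {e, C}"
      unfolding L' by (auto simp: row_entries_def new)
    moreover have "col_entries (ladder n t) C = {r, R - 1, R}"
      using r e unfolding L' by (auto simp: col_entries_def)
    ultimately show ?thesis
      using True e r unfolding n_def[symmetric] R_def[symmetric] C_def[symmetric]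
      by (auto simp: n_def)
  next
    case False
    then have ev: "even (Suc m)" by (simp add: n_def)
    have C: "ladder_cols (Suc m) = C - 1" "C \<ge> 3" and R: "ladder_rows (Suc m) = R"
      using ev unfolding n_def R_def C_def ladder_rows_def ladder_cols_def by presburger+
    have dom: "dom L \<subseteq> {1..R} \<times> {1..C - 1}"
      and ran: "ran L = insert 0 {2..2 * Suc m + 4}"
      using 3 False unfolding L_def n_def[symmetric] by (simp_all add: n_def R C)
    obtain c where c: "c < C - 1" "row_entries L R = {c, C - 1}"
      using 3 False ev unfolding L_def by (auto simp: n_def R C)
    obtain r where r: "r < R - 1" "col_entries L (C - 1) = {r, R - 1, R}"
      using 3 False ev unfolding L_def by (auto simp: n_def R C)
    define e where "e = choose_entry (t ! n) (col_entries L (C - 1))"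
    have "e \<in> {r, R - 1}"
      unfolding e_def r(2) using r(1) by (intro choose_entry_mem) auto
    then have e: "e < R" "e \<in> col_entries L (C - 1)" using r by auto
    have e1: "1 \<le> e" using e(2) dom by (auto simp: col_entries_def)
    have L': "ladder n t = L((R, C) \<mapsto> 2 * n + 4, (e, C) \<mapsto> 2 * n + 3)"
      using False by (simp add: n_def L_def R_def C_def e_def Let_def)
    have new: "L (x, C) = None" for x using dom C by (force simp: domIff)
    have "ran (ladder n t) = insert (2 * n + 3) (insert (2 * n + 4) (ran L))"
      unfolding L' using e by (intro ran_upd2) (auto simp: new)
    then have "ran (ladder n t) = insert 0 {2..2 * n + 4}"
      unfolding ran vars .
    moreover have "dom (ladder n t) \<subseteq> {1..R} \<times> {1..C}"
    proof -
      have "dom L \<subseteq> {1..R} \<times> {1..C}"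
        using dom by (rule order_trans) auto
      then show ?thesis
        unfolding L' using e e1 C by simp
    qed
    moreover have "col_entries (ladder n t) C = {e, R}"
      unfolding L' by (auto simp: col_entries_def new)
    moreover have "row_entries (ladder n t) R = {c, C - 1, C}"
      using c e unfolding L' by (auto simp: row_entries_def)
    ultimately show ?thesis
      using False e c unfolding n_def[symmetric] R_def[symmetric] C_def[symmetric]
      by (auto simp: n_def)
  qed
qed

datatype vertex = Row nat | Col nat

definition graph_of_ladder :: "nat \<Rightarrow> bit list \<Rightarrow> (vertex, nat) graph" where
  "graph_of_ladder n t =
     \<lparr>verts = Row ` {1..ladder_rows n} \<union> Col ` {1..ladder_cols n},
      edges = ran (ladder n t),
      ends = (\<lambda>x. \<Union>(r, c)\<in>{p. ladder n t p = Some x}. {Row r, Col c})\<rparr>"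

corollary edges_graph_of_ladder: "edges (graph_of_ladder n t) = insert 0 {2..2 * n + 4}"
  using ladder_invariant by (simp add: graph_of_ladder_def)

end

theory Submission
  imports Defs
begin

text \<open>
  Write \<open>R\<^sub>n\<close> for the toric ring of the \<open>n\<close>-th ladder, and \<open>R\<^sub>-\<^sub>1\<close> for the polynomial ring that
  belongs to a single row with the entries \<open>x\<^sub>0\<close> and \<open>x\<^sub>2\<close>. The graph of each ladder arises from that
  of its predecessor by one new vertex \<open>v\<close> with two edges \<open>y\<close> and \<open>z\<close>, to vertices \<open>c\<close> and \<open>C\<close>,
  where \<open>C\<close> is the vertex that was added in the step before. So \<open>C\<close> has exactly two older edges
  \<open>b\<^sub>1\<close> and \<open>b\<^sub>2\<close> (only one in the first step), and it turns out that their other ends are both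
  joined to \<open>c\<close>, by edges \<open>a\<^sub>1\<close> and \<open>a\<^sub>2\<close>, whatever the parameters \<open>t\<close> are. Put
  \<open>q\<^sub>i = a\<^sub>i z - b\<^sub>i y\<close>. Two facts about these squares carry the proof.

  First, the toric ideal of the new graph is generated by the old one together with \<open>q\<^sub>1\<close> and
  \<open>q\<^sub>2\<close> (\<open>toric_new_vertex\<close>): modulo the \<open>q\<^sub>i\<close> a monomial can be brought into a form in which \<open>y\<close>
  does not meet \<open>b\<^sub>1\<close> or \<open>b\<^sub>2\<close>, and such a form is determined by its image up to the old ideal.
  The same fact one step earlier, where \<open>b\<^sub>1\<close> and \<open>b\<^sub>2\<close> were the new edges, shows that
  \<open>R\<^sub>n\<^sub>-\<^sub>1 / (b\<^sub>1, b\<^sub>2) = R\<^sub>n\<^sub>-\<^sub>2\<close>.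

  Second, in the polynomial ring on the vertices \<open>C q\<^sub>i\<close> maps to \<open>(c z - C y)\<close> times the image of
  \<open>b\<^sub>i\<close>, so that \<open>b\<^sub>i \<mapsto> q\<^sub>i\<close> is an isomorphism of the ideal \<open>(b\<^sub>1, b\<^sub>2)\<close> of \<open>R\<^sub>n\<^sub>-\<^sub>1[y, z]\<close> onto
  \<open>(q\<^sub>1, q\<^sub>2)\<close>, of degree one (\<open>pair_iso\<close>). This gives exact sequences
  \<open>0 \<rightarrow> B \<rightarrow> R\<^sub>n\<^sub>-\<^sub>1 \<rightarrow> R\<^sub>n\<^sub>-\<^sub>2 \<rightarrow> 0\<close> and \<open>0 \<rightarrow> B[y, z](-1) \<rightarrow> R\<^sub>n\<^sub>-\<^sub>1[y, z] \<rightarrow> R\<^sub>n \<rightarrow> 0\<close> with \<open>B = (b\<^sub>1, b\<^sub>2)\<close>.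
  Mapping cones turn resolutions of \<open>R\<^sub>n\<^sub>-\<^sub>1\<close> and \<open>R\<^sub>n\<^sub>-\<^sub>2\<close> into a resolution of \<open>R\<^sub>n\<close>. By induction,
  starting from the polynomial ring \<open>R\<^sub>-\<^sub>1\<close> and the hypersurface \<open>R\<^sub>0\<close>, it has length \<open>n + 1\<close>, its
  shifts in step \<open>i\<close> are at most \<open>i + r\<^sub>n\<close> with \<open>r\<^sub>n = max r\<^sub>n\<^sub>-\<^sub>1 (r\<^sub>n\<^sub>-\<^sub>2 + 1) = \<lfloor>n / 2\<rfloor> + 1\<close>, and the
  last step attains this bound (\<open>good_resolution_step\<close>).

  Such a resolution determines the regularity although it need not be minimal
  (\<open>regularity_from_resolution\<close>). A basis vector of a resolution whose row and column contain no
  constants cannot cancel, so that every other resolution has one of the same degree in the same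
  step (\<open>generator_persists\<close>). This applies to all basis vectors of a minimal resolution, whose
  shifts therefore obey the bound, and to the extremal one in the last step of the constructed
  resolution, which therefore occurs in each minimal one. The same comparison maps show that a
  module with a resolution by finitely generated free modules, in which no relation between the
  first generators contains a constant, has a minimal one (\<open>minimal_resolution_exists\<close>).
\<close>

abbreviation lookup :: "('a \<Rightarrow>\<^sub>0 'b::zero) \<Rightarrow> 'a \<Rightarrow> 'b" where
  "lookup \<equiv> Poly_Mapping.lookup"

abbreviation keys :: "('a \<Rightarrow>\<^sub>0 'b::zero) \<Rightarrow> 'a set" where
  "keys \<equiv> Poly_Mapping.keys"

abbreviation single :: "'a \<Rightarrow> 'b \<Rightarrow> 'a \<Rightarrow>\<^sub>0 'b::zero" where
  "single \<equiv> Poly_Mapping.single"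


section \<open>Parts of polynomials\<close>

lemma poly_mapping_decompose: "p = (\<Sum>m\<in>keys p. single m (lookup p m))"
  by (rule poly_mapping_eqI) (simp add: lookup_sum lookup_single when_def in_keys_iff)

text \<open>Instances are the homogeneous components of a polynomial, its terms that avoid a variable, and the
  projection of a direct sum of free modules to its first summand.\<close>

lift_definition part :: "('a \<Rightarrow> bool) \<Rightarrow> ('a \<Rightarrow>\<^sub>0 'b) \<Rightarrow> 'a \<Rightarrow>\<^sub>0 'b::zero"
  is "\<lambda>Q p a. p a when Q a"
  by (rule finite_subset) (auto simp: when_def)

lemma lookup_part: "lookup (part Q p) m = (lookup p m when Q m)"
  by transfer simp

lemma keys_part: "keys (part Q p) = {m \<in> keys p. Q m}"
  by (auto simp: in_keys_iff lookup_part when_def split: if_splits)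

lemma part_zero [simp]: "part Q 0 = 0"
  by (rule poly_mapping_eqI) (simp add: lookup_part)

lemma part_single: "part Q (single m c) = (single m c when Q m)"
  by (rule poly_mapping_eqI) (auto simp: lookup_part lookup_single when_def)

lemma part_add: "part Q (p + q) = part Q p + part Q q"
  by (rule poly_mapping_eqI) (simp add: lookup_part lookup_add when_def)

lemma part_sum: "part Q (sum f A) = (\<Sum>a\<in>A. part Q (f a))"
  by (induction A rule: infinite_finite_induct) (simp_all add: part_add)

lemma part_eq_self: "(\<And>m. m \<in> keys p \<Longrightarrow> Q m) \<Longrightarrow> part Q p = p"
  by (rule poly_mapping_eqI) (auto simp: lookup_part when_def in_keys_iff)

lemma part_eq_zero: "(\<And>m. m \<in> keys p \<Longrightarrow> \<not> Q m) \<Longrightarrow> part Q p = 0"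
  by (rule poly_mapping_eqI) (auto simp: lookup_part when_def in_keys_iff)

lemma part_compl: "part Q p + part (\<lambda>m. \<not> Q m) p = p"
  by (rule poly_mapping_eqI) (simp add: lookup_part lookup_add when_def)

text \<open>The instance in mind: if all terms of \<open>q\<close> have the same degree, then the component of \<open>p q\<close> in
  some degree is \<open>q\<close> times a component of \<open>p\<close>.\<close>

lemma part_mult:
  fixes p q :: "'m::monoid_add \<Rightarrow>\<^sub>0 'k::semiring_0"
  assumes "\<And>a b. a \<in> keys p \<Longrightarrow> b \<in> keys q \<Longrightarrow> Q (a + b) \<longleftrightarrow> R a"
  shows "part Q (p * q) = part R p * q"
proof -
  let ?s = single and ?l = lookup
  have "p * q = (\<Sum>a\<in>keys p. \<Sum>b\<in>keys q. ?s (a + b) (?l p a * ?l q b))"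
    by (subst poly_mapping_decompose[of p], subst poly_mapping_decompose[of q])
       (simp add: sum_product mult_single)
  then have "part Q (p * q) =
      (\<Sum>a\<in>keys p. \<Sum>b\<in>keys q. ?s (a + b) (?l p a * ?l q b) when Q (a + b))"
    by (simp add: part_sum part_single)
  also have "\<dots> = (\<Sum>a\<in>keys p. \<Sum>b\<in>keys q. part R (?s a (?l p a)) * ?s b (?l q b))"
    by (intro sum.cong refl) (auto simp: assms part_single mult_single when_def)
  also have "\<dots> = part R (\<Sum>a\<in>keys p. ?s a (?l p a)) * (\<Sum>b\<in>keys q. ?s b (?l q b))"
    by (simp only: part_sum sum_product)
  also have "\<dots> = part R p * q"
    by (simp only: poly_mapping_decompose[symmetric])
  finally show ?thesis .
qed

section \<open>Homogeneous polynomials in a set of variables\<close>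

abbreviation polys :: "'x set \<Rightarrow> ('x, 'k::field) mpoly set" where
  "polys X \<equiv> carrier (poly_ring X)"

lemma polys_def: "polys X = {p. \<forall>m\<in>keys p. keys m \<subseteq> X}"
  by (simp add: poly_ring_def)

lemma keys_add_nat: "keys (m + m') = keys m \<union> keys (m' :: 'x \<Rightarrow>\<^sub>0 nat)"
  by (auto simp: in_keys_iff lookup_add)

lemma polys_zero [simp, intro]: "0 \<in> polys X"
  by (simp add: polys_def)

lemma polys_one [simp, intro]: "1 \<in> polys X"
  by (simp add: polys_def)

lemma polys_single [intro]: "keys m \<subseteq> X \<Longrightarrow> single m c \<in> polys X"
  by (auto simp: polys_def)

lemma polys_add [intro]: "p \<in> polys X \<Longrightarrow> q \<in> polys X \<Longrightarrow> p + q \<in> polys X"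
  using keys_add[of p q] by (fastforce simp: polys_def)

lemma polys_uminus [intro]: "p \<in> polys X \<Longrightarrow> - p \<in> polys X"
  by (simp add: polys_def in_keys_iff)

lemma polys_diff [intro]: "p \<in> polys X \<Longrightarrow> q \<in> polys X \<Longrightarrow> p - q \<in> polys X"
  using polys_add[of p X "- q"] polys_uminus[of q X] by simp

lemma polys_mult [intro]: "p \<in> polys X \<Longrightarrow> q \<in> polys X \<Longrightarrow> p * q \<in> polys X"
  using keys_mult[of p q] by (fastforce simp: polys_def keys_add_nat)

lemma polys_sum [intro]: "(\<And>a. a \<in> A \<Longrightarrow> f a \<in> polys X) \<Longrightarrow> sum f A \<in> polys X"
  by (induction A rule: infinite_finite_induct) auto

lemma polys_part [intro]: "p \<in> polys X \<Longrightarrow> part Q p \<in> polys X"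
  by (auto simp: polys_def keys_part)

lemma monomial_degree_superset:
  assumes "finite A" "keys m \<subseteq> A"
  shows "monomial_degree m = (\<Sum>x\<in>A. lookup m x)"
  unfolding monomial_degree_def using assms by (intro sum.mono_neutral_left) (auto simp: in_keys_iff)

lemma monomial_degree_add: "monomial_degree (m + m') = monomial_degree m + monomial_degree m'"
proof -
  let ?A = "keys m \<union> keys m'"
  have "monomial_degree (m + m') = (\<Sum>x\<in>?A. lookup (m + m') x)"
    by (rule monomial_degree_superset) (auto simp: keys_add_nat)
  also have "\<dots> = monomial_degree m + monomial_degree m'"
    by (simp add: lookup_add sum.distrib monomial_degree_superset[of ?A])
  finally show ?thesis .
qed

lemma monomial_degree_zero [simp]: "monomial_degree 0 = 0"
  by (simp add: monomial_degree_def)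

lemma monomial_degree_single [simp]: "monomial_degree (single x n) = n"
  by (simp add: monomial_degree_def)

lemma monomial_degree_eq_0_iff: "monomial_degree m = 0 \<longleftrightarrow> m = 0"
  by (auto simp: monomial_degree_def in_keys_iff intro: poly_mapping_eqI)

lemma homogeneous_zero [simp, intro]: "homogeneous j 0"
  by (simp add: homogeneous_def)

lemma homogeneous_one [simp, intro]: "homogeneous 0 1"
  by (simp add: homogeneous_def)

lemma homogeneous_add [intro]: "homogeneous j p \<Longrightarrow> homogeneous j q \<Longrightarrow> homogeneous j (p + q)"
  using keys_add[of p q] by (auto simp: homogeneous_def)

lemma homogeneous_uminus [intro]: "homogeneous j p \<Longrightarrow> homogeneous j (- p)"
  by (simp add: homogeneous_def in_keys_iff)

lemma homogeneous_diff [intro]: "homogeneous j p \<Longrightarrow> homogeneous j q \<Longrightarrow> homogeneous j (p - q)"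
  using homogeneous_add[of j p "- q"] homogeneous_uminus[of j q] by simp

lemma homogeneous_mult: "homogeneous i p \<Longrightarrow> homogeneous j q \<Longrightarrow> homogeneous (i + j) (p * q)"
  using keys_mult[of p q] by (fastforce simp: homogeneous_def monomial_degree_add)

abbreviation hcomp :: "int \<Rightarrow> ('x, 'k::field) mpoly \<Rightarrow> ('x, 'k) mpoly" where
  "hcomp j \<equiv> part (\<lambda>m. int (monomial_degree m) = j)"

lemma homogeneous_hcomp [simp, intro]: "homogeneous j (hcomp j p)"
  by (auto simp: homogeneous_def keys_part)

lemma hcomp_homogeneous: "homogeneous j p \<Longrightarrow> hcomp j p = p"
  by (rule part_eq_self) (simp add: homogeneous_def)

lemma hcomp_mult: "homogeneous i q \<Longrightarrow> hcomp j (p * q) = hcomp (j - i) p * q"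
  by (rule part_mult) (auto simp: homogeneous_def monomial_degree_add)

lemma homogeneous_const:
  assumes "homogeneous j p" "lookup p 0 \<noteq> 0"
  shows "j = 0"
  using assms by (force simp: homogeneous_def in_keys_iff)

lemma homogeneous_0_eq_single:
  assumes "homogeneous 0 p"
  shows "p = single 0 (lookup p 0)"
proof (rule poly_mapping_eqI)
  fix m show "lookup p m = lookup (single 0 (lookup p 0)) m"
    using assms by (cases "m = 0") (auto simp: homogeneous_def lookup_single monomial_degree_eq_0_iff in_keys_iff)
qed

text \<open>Taking constant terms is a ring homomorphism, because a sum of exponents vanishes only if both
  summands do.\<close>

lemma lookup_mult_0:
  fixes p q :: "('x, 'k::field) mpoly"
  shows "lookup (p * q) 0 = lookup p 0 * lookup q 0"
proof -
  have z: "0 = a + b \<longleftrightarrow> a = 0 \<and> b = 0" for a b :: "'x \<Rightarrow>\<^sub>0 nat"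
    by (auto simp: poly_mapping_eq_iff fun_eq_iff lookup_add)
  let ?l = lookup
  have "p * q = (\<Sum>a\<in>keys p. \<Sum>b\<in>keys q. single (a + b) (?l p a * ?l q b))"
    by (subst poly_mapping_decompose[of p], subst poly_mapping_decompose[of q])
       (simp add: sum_product mult_single)
  then have "?l (p * q) 0 = (\<Sum>a\<in>keys p. \<Sum>b\<in>keys q. (if a = 0 \<and> b = 0 then ?l p a * ?l q b else 0))"
    by (simp only: lookup_sum lookup_single when_def) (simp only: eq_commute[of _ 0] z)
  also have "\<dots> = (\<Sum>a\<in>keys p. if a = 0 then ?l p a * ?l q 0 else 0)"
    by (intro sum.cong refl) (auto simp: in_keys_iff)
  also have "\<dots> = ?l p 0 * ?l q 0"
    by (auto simp: in_keys_iff)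
  finally show ?thesis .
qed

section \<open>Graded free modules and homogeneous maps\<close>

text \<open>Elements of all free modules live in one type, that of finitely supported families of
  polynomials, which is an abelian group; so equations between maps need no side conditions about
  carriers. The free module with basis vectors in the degrees \<open>d\<close> is the subset \<open>FM X d\<close>.\<close>

type_synonym ('x, 'k) fvec = "nat \<Rightarrow>\<^sub>0 ('x, 'k) mpoly"

definition smul :: "('x, 'k::field) mpoly \<Rightarrow> ('x, 'k) fvec \<Rightarrow> ('x, 'k) fvec" (infixr "\<star>" 75) where
  "p \<star> v = Poly_Mapping.map ((*) p) v"

lemma lookup_smul: "lookup (p \<star> v) a = p * lookup v a"
  unfolding smul_def by transfer (simp add: when_def)

lemma smul_add: "p \<star> (u + v) = p \<star> u + p \<star> v"
  and smul_add_left: "(p + q) \<star> v = p \<star> v + q \<star> v"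
  and smul_smul: "p \<star> (q \<star> v) = (p * q) \<star> v"
  and smul_zero [simp]: "p \<star> 0 = 0"
  and zero_smul [simp]: "0 \<star> v = 0"
  and one_smul [simp]: "1 \<star> v = v"
  and smul_uminus: "p \<star> (- v) = - (p \<star> v)"
  and smul_single [simp]: "p \<star> single a q = single a (p * q)"
  by (rule poly_mapping_eqI;
      simp add: lookup_smul lookup_add algebra_simps lookup_single when_def)+

lemma smul_sum: "p \<star> sum f A = (\<Sum>a\<in>A. p \<star> f a)"
  by (induction A rule: infinite_finite_induct) (simp_all add: smul_add)

definition lin :: "(('x, 'k::field) fvec \<Rightarrow> ('x, 'k) fvec) \<Rightarrow> bool" where
  "lin f \<longleftrightarrow> (\<forall>u v. f (u + v) = f u + f v) \<and> (\<forall>p v. f (p \<star> v) = p \<star> f v)"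

lemma lin_add: "lin f \<Longrightarrow> f (u + v) = f u + f v"
  and lin_smul: "lin f \<Longrightarrow> f (p \<star> v) = p \<star> f v"
  by (simp_all add: lin_def)

lemma lin_zero: "lin f \<Longrightarrow> f 0 = 0"
  using lin_smul[of f 0 0] by simp

lemma lin_uminus: "lin f \<Longrightarrow> f (- v) = - f v"
  using lin_add[of f v "- v"] by (simp add: lin_zero eq_neg_iff_add_eq_0 add.commute)

lemma lin_diff: "lin f \<Longrightarrow> f (u - v) = f u - f v"
  using lin_add[of f u "- v"] by (simp add: lin_uminus)

lemma lin_sum: "lin f \<Longrightarrow> f (sum g A) = (\<Sum>a\<in>A. f (g a))"
  by (induction A rule: infinite_finite_induct) (simp_all add: lin_zero lin_add)

lemma lin_expand:
  assumes "lin f" "finite A" "keys v \<subseteq> A"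
  shows "f v = (\<Sum>a\<in>A. lookup v a \<star> f (single a 1))"
proof -
  have "v = (\<Sum>a\<in>A. lookup v a \<star> single a 1)"
  proof (rule poly_mapping_eqI)
    fix a show "lookup v a = lookup (\<Sum>a\<in>A. lookup v a \<star> single a 1) a"
      using assms(2,3) by (cases "a \<in> A") (auto simp: lookup_sum lookup_single when_def in_keys_iff subset_iff)
  qed
  then have "f v = f (\<Sum>a\<in>A. lookup v a \<star> single a 1)"
    by (rule arg_cong)
  then show ?thesis
    by (simp only: lin_sum[OF assms(1)] lin_smul[OF assms(1)])
qed

definition linear_ext :: "(nat \<Rightarrow> ('x, 'k::field) fvec) \<Rightarrow> ('x, 'k) fvec \<Rightarrow> ('x, 'k) fvec" where
  "linear_ext w v = (\<Sum>a\<in>keys v. lookup v a \<star> w a)"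

lemma ext_superset:
  assumes "finite A" "keys v \<subseteq> A"
  shows "linear_ext w v = (\<Sum>a\<in>A. lookup v a \<star> w a)"
  unfolding linear_ext_def using assms by (intro sum.mono_neutral_left) (auto simp: in_keys_iff)

lemma lin_ext: "lin (linear_ext w)"
proof -
  have "linear_ext w (u + v) = linear_ext w u + linear_ext w v" for u v
  proof -
    let ?A = "keys u \<union> keys v"
    have "keys (u + v) \<subseteq> ?A" by (rule keys_add)
    then show ?thesis
      by (simp add: ext_superset[of ?A] lookup_add smul_add_left sum.distrib)
  qed
  moreover have "linear_ext w (p \<star> v) = p \<star> linear_ext w v" for p v
  proof -
    have "keys (p \<star> v) \<subseteq> keys v"
      by (auto simp: in_keys_iff lookup_smul)
    then show ?thesis
      by (simp add: ext_superset[of "keys v"] smul_sum smul_smul lookup_smul)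
  qed
  ultimately show ?thesis by (simp add: lin_def)
qed

lemma ext_single [simp]: "linear_ext w (single a p) = p \<star> w a"
  by (simp add: linear_ext_def)

definition FM :: "'x set \<Rightarrow> int list \<Rightarrow> ('x, 'k::field) fvec set" where
  "FM X d = {v. keys v \<subseteq> {..<length d} \<and> (\<forall>a. lookup v a \<in> polys X)}"

definition hvec :: "int list \<Rightarrow> int \<Rightarrow> ('x, 'k::field) fvec \<Rightarrow> bool" where
  "hvec d j v \<longleftrightarrow> (\<forall>a<length d. homogeneous (j - d ! a) (lookup v a))"

lemma FM_iff: "v \<in> FM X d \<longleftrightarrow> (\<forall>a\<ge>length d. lookup v a = 0) \<and> (\<forall>a. lookup v a \<in> polys X)"
  unfolding FM_def in_keys_iff subset_iff by (auto simp: not_less[symmetric])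

lemma FM_zero [simp, intro]: "0 \<in> FM X d"
  by (simp add: FM_def)

lemma FM_add [intro]: "u \<in> FM X d \<Longrightarrow> v \<in> FM X d \<Longrightarrow> u + v \<in> FM X d"
  using keys_add[of u v] by (auto simp: FM_def lookup_add)

lemma FM_uminus [intro]: "v \<in> FM X d \<Longrightarrow> - v \<in> FM X d"
  by (auto simp: FM_def in_keys_iff)

lemma FM_diff [intro]: "u \<in> FM X d \<Longrightarrow> v \<in> FM X d \<Longrightarrow> u - v \<in> FM X d"
  using FM_add[of u X d "- v"] FM_uminus[of v X d] by simp

lemma FM_smul [intro]: "p \<in> polys X \<Longrightarrow> v \<in> FM X d \<Longrightarrow> p \<star> v \<in> FM X d"
  by (auto simp: FM_iff lookup_smul)

lemma FM_sum [intro]: "(\<And>a. a \<in> A \<Longrightarrow> f a \<in> FM X d) \<Longrightarrow> sum f A \<in> FM X d"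
  by (induction A rule: infinite_finite_induct) auto

lemma FM_single [intro]: "a < length d \<Longrightarrow> p \<in> polys X \<Longrightarrow> single a p \<in> FM X d"
  by (auto simp: FM_def lookup_single when_def)

lemma FM_length_cong: "length d = length e \<Longrightarrow> FM X d = FM X e"
  by (simp add: FM_def)

lemma FM_lookup: "v \<in> FM X d \<Longrightarrow> lookup v a \<in> polys X"
  by (simp add: FM_def)

lemma FM_eqI:
  assumes "u \<in> FM X d" "v \<in> FM X d" "\<And>a. a < length d \<Longrightarrow> lookup u a = lookup v a"
  shows "u = v"
proof (rule poly_mapping_eqI)
  fix a show "lookup u a = lookup v a"
    using assms by (cases "a < length d") (auto simp: FM_iff)
qed

lemma FM_Nil [simp]: "FM X [] = {0}"
  by (auto simp: FM_def)

lemma hvec_zero [simp]: "hvec d j 0"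
  by (simp add: hvec_def)

lemma hvec_add: "hvec d j u \<Longrightarrow> hvec d j v \<Longrightarrow> hvec d j (u + v)"
  by (auto simp: hvec_def lookup_add)

lemma hvec_uminus: "hvec d j v \<Longrightarrow> hvec d j (- v)"
  by (auto simp: hvec_def)

lemma hvec_sum: "(\<And>a. a \<in> A \<Longrightarrow> hvec d j (f a)) \<Longrightarrow> hvec d j (sum f A)"
  by (induction A rule: infinite_finite_induct) (auto simp: hvec_add)

lemma hvec_smul: "homogeneous i p \<Longrightarrow> hvec d j v \<Longrightarrow> hvec d (i + j) (p \<star> v)"
  by (auto simp: hvec_def lookup_smul add_diff_eq[symmetric] intro!: homogeneous_mult)

lemma hvec_single: "a < length d \<Longrightarrow> homogeneous (j - d ! a) p \<Longrightarrow> hvec d j (single a p)"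
  by (auto simp: hvec_def lookup_single when_def)

text \<open>A map of degree \<open>0\<close> between free modules is a linear map of the whole type that restricts to it.
  Maps are compared on \<open>FM X d\<close> only.\<close>

definition gmap ::
  "'x set \<Rightarrow> int list \<Rightarrow> int list \<Rightarrow> (('x, 'k::field) fvec \<Rightarrow> ('x, 'k) fvec) \<Rightarrow> bool" where
  "gmap X d e f \<longleftrightarrow> lin f \<and>
     (\<forall>b<length d. f (single b 1) \<in> FM X e \<and> hvec e (d ! b) (f (single b 1)))"

lemma gmap_lin: "gmap X d e f \<Longrightarrow> lin f"
  by (simp add: gmap_def)

lemma gmap_expand:
  assumes "gmap X d e f" "v \<in> FM X d"
  shows "f v = (\<Sum>a<length d. lookup v a \<star> f (single a 1))"
  using assms by (intro lin_expand) (auto simp: gmap_def FM_def)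

lemma gmap_FM: "gmap X d e f \<Longrightarrow> v \<in> FM X d \<Longrightarrow> f v \<in> FM X e"
  by (subst gmap_expand, assumption, assumption) (auto simp: gmap_def intro: FM_lookup)

lemma gmap_hvec:
  assumes "gmap X d e f" "v \<in> FM X d" "hvec d j v"
  shows "hvec e j (f v)"
proof -
  have "hvec e ((j - d ! a) + d ! a) (lookup v a \<star> f (single a 1))" if "a < length d" for a
    using assms that by (intro hvec_smul) (auto simp: gmap_def hvec_def)
  then show ?thesis
    by (subst gmap_expand[OF assms(1,2)]) (auto intro!: hvec_sum)
qed

lemma gmap_ext:
  assumes "\<And>b. b < length d \<Longrightarrow> w b \<in> FM X e" "\<And>b. b < length d \<Longrightarrow> hvec e (d ! b) (w b)"
  shows "gmap X d e (linear_ext w)"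
  using assms by (simp add: gmap_def lin_ext)

lemma basis_FM: "b < length d \<Longrightarrow> single b 1 \<in> FM X d"
  by (rule FM_single) auto

lemma basis_hvec: "b < length d \<Longrightarrow> hvec d (d ! b) (single b 1)"
  by (rule hvec_single) auto

lemma gmap_id: "gmap X d d (\<lambda>v. v)"
  by (simp add: gmap_def lin_def basis_FM basis_hvec)

lemma gmap_comp:
  assumes "gmap X d e f" "gmap X c d g"
  shows "gmap X c e (\<lambda>v. f (g v))"
  using assms gmap_FM[OF assms(1)] gmap_hvec[OF assms(1)] by (auto simp: gmap_def lin_def)

lemma gmap_zero: "gmap X d e (\<lambda>v. 0)"
  by (simp add: gmap_def lin_def)

lemma gmap_add:
  assumes "gmap X d e f" "gmap X d e g"
  shows "gmap X d e (\<lambda>v. f v + g v)"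
  using assms by (auto simp: gmap_def lin_def smul_add hvec_add)

lemma gmap_uminus: "gmap X d e f \<Longrightarrow> gmap X d e (\<lambda>v. - f v)"
  by (auto simp: gmap_def lin_def smul_uminus hvec_uminus)

lemma gmap_diff:
  assumes "gmap X d e f" "gmap X d e g"
  shows "gmap X d e (\<lambda>v. f v - g v)"
  using gmap_add[OF assms(1) gmap_uminus[OF assms(2)]] by simp

definition hpart :: "int list \<Rightarrow> int \<Rightarrow> ('x, 'k::field) fvec \<Rightarrow> ('x, 'k) fvec" where
  "hpart d j v = Poly_Mapping.mapp (\<lambda>a. hcomp (j - d ! a)) v"

lemma lookup_hpart: "lookup (hpart d j v) a = hcomp (j - d ! a) (lookup v a)"
  by (cases "a \<in> keys v") (simp_all add: hpart_def lookup_mapp when_def in_keys_iff)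

lemma hpart_FM [intro]: "v \<in> FM X d \<Longrightarrow> hpart d j v \<in> FM X d"
  by (auto simp: FM_iff lookup_hpart)

lemma hpart_hvec: "hvec d j (hpart d j v)"
  by (simp add: hvec_def lookup_hpart)

text \<open>This serves to replace a preimage of a homogeneous vector by a homogeneous one.\<close>

lemma gmap_hpart:
  assumes f: "gmap X d e f" and v: "v \<in> FM X d"
  shows "f (hpart d j v) = hpart e j (f v)"
proof (rule FM_eqI[where d = e])
  show "f (hpart d j v) \<in> FM X e" "hpart e j (f v) \<in> FM X e"
    using gmap_FM[OF f] v by auto
next
  fix c assume c: "c < length e"
  let ?u = "\<lambda>a. lookup (f (single a 1)) c"
  have "lookup (f (hpart d j v)) c = (\<Sum>a<length d. hcomp (j - d ! a) (lookup v a) * ?u a)"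
    by (subst gmap_expand[OF f]) (auto simp: v lookup_sum lookup_smul lookup_hpart)
  also have "\<dots> = (\<Sum>a<length d. hcomp (j - e ! c) (lookup v a * ?u a))"
  proof (intro sum.cong refl)
    fix a assume "a \<in> {..<length d}"
    then have "homogeneous (d ! a - e ! c) (?u a)"
      using f c by (auto simp: gmap_def hvec_def)
    then show "hcomp (j - d ! a) (lookup v a) * ?u a = hcomp (j - e ! c) (lookup v a * ?u a)"
      by (subst hcomp_mult) (auto simp: algebra_simps)
  qed
  also have "\<dots> = lookup (hpart e j (f v)) c"
    unfolding lookup_hpart gmap_expand[OF f v] by (simp add: lookup_sum lookup_smul part_sum)
  finally show "lookup (f (hpart d j v)) c = lookup (hpart e j (f v)) c" .
qed

lemma hpart_hvec_self: "v \<in> FM X d \<Longrightarrow> hvec d j v \<Longrightarrow> hpart d j v = v"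
  by (rule FM_eqI[where X = X and d = d]) (auto simp: lookup_hpart hvec_def hcomp_homogeneous)

lemma homogeneous_preimage:
  assumes f: "gmap X d e f" and v: "v \<in> f ` FM X d" "hvec e j v"
  shows "\<exists>w\<in>FM X d. hvec d j w \<and> f w = v"
proof -
  obtain w where w: "w \<in> FM X d" "v = f w" using v by auto
  have "f (hpart d j w) = v"
    using gmap_hpart[OF f w(1)] hpart_hvec_self[OF gmap_FM[OF f w(1)]] w v by simp
  then show ?thesis
    using hpart_FM[OF w(1)] hpart_hvec by blast
qed

text \<open>Free modules are projective, also in the graded sense.\<close>

lemma gmap_lift:
  assumes f: "gmap X d e f" and g: "gmap X c e g" and im: "\<And>v. v \<in> FM X c \<Longrightarrow> g v \<in> f ` FM X d"
  shows "\<exists>h. gmap X c d h \<and> (\<forall>v\<in>FM X c. f (h v) = g v)"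
proof -
  have "\<exists>w\<in>FM X d. hvec d (c ! b) w \<and> f w = g (single b 1)" if "b < length c" for b
    using that g im[OF basis_FM[OF that]] by (intro homogeneous_preimage[OF f]) (auto simp: gmap_def)
  then obtain w where w: "\<And>b. b < length c \<Longrightarrow> w b \<in> FM X d \<and> hvec d (c ! b) (w b) \<and> f (w b) = g (single b 1)"
    by metis
  have h: "gmap X c d (linear_ext w)"
    by (rule gmap_ext) (auto simp: w)
  have "f (linear_ext w v) = g v" if "v \<in> FM X c" for v
  proof -
    have "f (linear_ext w v) = (\<Sum>b<length c. lookup v b \<star> f (w b))"
      using gmap_expand[OF h that] by (simp add: lin_sum[OF gmap_lin[OF f]] lin_smul[OF gmap_lin[OF f]])
    also have "\<dots> = g v"
      using gmap_expand[OF g that] by (simp add: w)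
    finally show ?thesis .
  qed
  then show ?thesis using h by blast
qed

text \<open>Degrees of basis vectors in different resolutions are compared through nonzero constants in the
  matrices of comparison maps.\<close>

lemma basis_const:
  assumes "v \<in> FM X d" "hvec d j v" "a < length d" "lookup (lookup v a) 0 \<noteq> 0"
  shows "d ! a = j"
  using assms homogeneous_const[of "j - d ! a"] by (force simp: hvec_def)

section \<open>Direct sums\<close>

text \<open>The direct sum of \<open>FM X d\<close> and \<open>FM X e\<close> is \<open>FM X (d @ e)\<close>, with the identity and \<open>shift\<close> as
  inclusions, and truncation and \<open>unshift\<close> as projections.\<close>

lift_definition shift :: "nat \<Rightarrow> (nat \<Rightarrow>\<^sub>0 'a::zero) \<Rightarrow> nat \<Rightarrow>\<^sub>0 'a"
  is "\<lambda>n v a. if n \<le> a then v (a - n) else 0"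
proof -
  fix n :: nat and v :: "nat \<Rightarrow> 'a" assume "finite {a. v a \<noteq> 0}"
  moreover have "{a. (if n \<le> a then v (a - n) else 0) \<noteq> 0} \<subseteq> (\<lambda>a. a + n) ` {a. v a \<noteq> 0}"
    by (auto simp: image_iff split: if_splits intro!: exI[of _ "_ - n"])
  ultimately show "finite {a. (if n \<le> a then v (a - n) else 0) \<noteq> 0}"
    by (meson finite_imageI finite_subset)
qed

lift_definition unshift :: "nat \<Rightarrow> (nat \<Rightarrow>\<^sub>0 'a::zero) \<Rightarrow> nat \<Rightarrow>\<^sub>0 'a"
  is "\<lambda>n v a. v (a + n)"
proof -
  fix n :: nat and v :: "nat \<Rightarrow> 'a" assume "finite {a. v a \<noteq> 0}"
  then have "finite ((\<lambda>a. a + n) -` {a. v a \<noteq> 0})"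
    by (rule finite_vimageI) (simp add: inj_def)
  then show "finite {a. v (a + n) \<noteq> 0}"
    by (simp add: vimage_def)
qed

abbreviation trunc :: "nat \<Rightarrow> (nat \<Rightarrow>\<^sub>0 'a::zero) \<Rightarrow> nat \<Rightarrow>\<^sub>0 'a" where
  "trunc n \<equiv> part (\<lambda>a. a < n)"

lemma lookup_shift: "lookup (shift n v) a = (if n \<le> a then lookup v (a - n) else 0)"
  by transfer simp

lemma lookup_unshift: "lookup (unshift n v) a = lookup v (a + n)"
  by transfer simp

lemma lin_shift: "lin (shift n)" and lin_unshift: "lin (unshift n)" and lin_trunc: "lin (trunc n)"
  by (auto simp: lin_def lookup_shift lookup_unshift lookup_part lookup_add lookup_smul when_def intro!: poly_mapping_eqI)

lemma shift_zero [simp]: "shift n 0 = 0" and unshift_zero [simp]: "unshift n 0 = 0"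
  by (rule poly_mapping_eqI, simp add: lookup_shift lookup_unshift)+

lemma trunc_unshift: "trunc n v + shift n (unshift n v) = v"
  by (rule poly_mapping_eqI) (simp add: lookup_shift lookup_unshift lookup_part lookup_add)

lemma unshift_shift [simp]: "unshift n (shift n v) = v" and trunc_shift [simp]: "trunc n (shift n v) = 0"
  by (rule poly_mapping_eqI, simp add: lookup_shift lookup_unshift lookup_part when_def)+

lemma trunc_FM: "u \<in> FM X d \<Longrightarrow> trunc (length d) u = u" and unshift_FM: "u \<in> FM X d \<Longrightarrow> unshift (length d) u = 0"
  by (rule poly_mapping_eqI, auto simp: FM_iff lookup_unshift lookup_part when_def)+

lemma gmap_inl: "gmap X d (d @ e) (\<lambda>v. v)"
  by (auto simp: gmap_def lin_def hvec_def lookup_single when_def nth_append intro!: FM_single)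

lemma shift_single: "shift n (single b p) = single (b + n) p"
  by (rule poly_mapping_eqI) (auto simp: lookup_shift lookup_single when_def)

lemma unshift_single: "unshift n (single b p) = (single (b - n) p when n \<le> b)"
  by (rule poly_mapping_eqI) (auto simp: lookup_unshift lookup_single when_def)

lemma gmap_inr: "gmap X e (d @ e) (shift (length d))"
  by (auto simp: gmap_def lin_shift shift_single nth_append intro!: FM_single hvec_single)

lemma gmap_trunc: "gmap X (d @ e) d (trunc (length d))"
  by (auto simp: gmap_def lin_trunc part_single nth_append when_def intro!: FM_single hvec_single)

lemma gmap_unshift: "gmap X (d @ e) e (unshift (length d))"
  by (auto simp: gmap_def lin_unshift unshift_single nth_append when_def intro!: FM_single hvec_single)

lemma FM_append_E:
  assumes "v \<in> FM X (d @ e)"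
  obtains u w where "u \<in> FM X d" "w \<in> FM X e" "v = u + shift (length d) w"
  using that[of "trunc (length d) v" "unshift (length d) v"] gmap_FM[OF gmap_trunc assms] gmap_FM[OF gmap_unshift assms]
    trunc_unshift[of "length d" v] by metis

lemma FM_append_I:
  assumes "u \<in> FM X d" "w \<in> FM X e"
  shows "u + shift (length d) w \<in> FM X (d @ e)"
  using gmap_FM[OF gmap_inl assms(1), of e] gmap_FM[OF gmap_inr assms(2), of d] by auto

lemma trunc_sum: "u \<in> FM X d \<Longrightarrow> trunc (length d) (u + shift (length d) w) = u"
  by (simp add: part_add trunc_FM)

lemma unshift_sum: "u \<in> FM X d \<Longrightarrow> unshift (length d) (u + shift (length d) w) = w"
  by (simp add: lin_add[OF lin_unshift] unshift_FM)

section \<open>Free resolutions and mapping cones\<close>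

text \<open>The complex given by \<open>d\<close> and \<open>f\<close> resolves the quotient of \<open>FM X (d 0)\<close> by \<open>N\<close>. So modules are
  represented by submodules of free modules.\<close>

definition resolves ::
  "'x set \<Rightarrow> (nat \<Rightarrow> int list) \<Rightarrow> (nat \<Rightarrow> ('x, 'k::field) fvec \<Rightarrow> ('x, 'k) fvec) \<Rightarrow> ('x, 'k) fvec set \<Rightarrow> bool" where
  "resolves X d f N \<longleftrightarrow> (\<forall>i. gmap X (d (Suc i)) (d i) (f i)) \<and>
     (\<forall>i. {v \<in> FM X (d (Suc i)). f i v = 0} = f (Suc i) ` FM X (d (Suc (Suc i)))) \<and>
     f 0 ` FM X (d 1) = N"

lemma resolves_gmap: "resolves X d f N \<Longrightarrow> gmap X (d (Suc i)) (d i) (f i)"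
  and resolves_ker: "resolves X d f N \<Longrightarrow> {v \<in> FM X (d (Suc i)). f i v = 0} = f (Suc i) ` FM X (d (Suc (Suc i)))"
  and resolves_im: "resolves X d f N \<Longrightarrow> f 0 ` FM X (d (Suc 0)) = N"
  by (simp_all add: resolves_def)

lemma resolves_exactD:
  "resolves X d f N \<Longrightarrow> v \<in> FM X (d (Suc i)) \<Longrightarrow> f i v = 0 \<Longrightarrow> v \<in> f (Suc i) ` FM X (d (Suc (Suc i)))"
  using resolves_ker by blast

lemma resolves_comp:
  "resolves X d f N \<Longrightarrow> v \<in> FM X (d (Suc (Suc i))) \<Longrightarrow> f i (f (Suc i) v) = 0"
  using resolves_ker[of X d f N i] by blast

lemma resolves_tail:
  assumes "resolves X d f N"
  shows "resolves X (\<lambda>i. d (Suc i)) (\<lambda>i. f (Suc i)) {v \<in> FM X (d (Suc 0)). f 0 v = 0}"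
  using assms by (simp add: resolves_def)

lemma resolves_twist:
  assumes "resolves X d f N"
  shows "resolves X (\<lambda>i. map ((+) s) (d i)) f N"
proof -
  have FM: "FM X (map ((+) s) e) = FM X e" for e by (rule FM_length_cong) simp
  have "gmap X (map ((+) s) e) (map ((+) s) e') g \<longleftrightarrow> gmap X e e' g" for e e' and g :: "('a, 'b) fvec \<Rightarrow> ('a, 'b) fvec"
    by (auto simp: gmap_def FM hvec_def)
  with assms show ?thesis by (simp add: resolves_def FM)
qed

text \<open>Here \<open>\<phi>\<close> presents a map from the module resolved by \<open>dF\<close> to the one resolved by \<open>dG\<close>. By the
  condition on \<open>\<phi>\<close> it is well defined and injective, so that the cone resolves its cokernel: lift
  \<open>\<phi>\<close> to a map of complexes and chase the diagram.\<close>

lemma mapping_cone: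
  assumes F: "resolves X dF f NF" and G: "resolves X dG g NG"
    and phi: "gmap X (dF 0) (dG 0) \<phi>"
    and inj: "\<And>v. v \<in> FM X (dF 0) \<Longrightarrow> \<phi> v \<in> NG \<longleftrightarrow> v \<in> NF"
  shows "\<exists>h. resolves X (\<lambda>i. dG i @ (case i of 0 \<Rightarrow> [] | Suc k \<Rightarrow> dF k)) h
           {u + \<phi> v | u v. u \<in> NG \<and> v \<in> FM X (dF 0)}"
proof -
  have lift0: "\<exists>p'. gmap X (dF (Suc 0)) (dG (Suc 0)) p' \<and> (\<forall>v\<in>FM X (dF (Suc 0)). g 0 (p' v) = \<phi> (f 0 v))"
  proof (rule gmap_lift[OF resolves_gmap[OF G] gmap_comp[OF phi resolves_gmap[OF F]]])
    fix v :: "('a, 'b) fvec" assume "v \<in> FM X (dF (Suc 0))"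
    then have "f 0 v \<in> NF" "f 0 v \<in> FM X (dF 0)"
      using resolves_im[OF F] gmap_FM[OF resolves_gmap[OF F]] by auto
    then show "\<phi> (f 0 v) \<in> g 0 ` FM X (dG (Suc 0))"
      using inj resolves_im[OF G] by simp
  qed
  let ?P = "\<lambda>i p. gmap X (dF i) (dG i) p \<and> (i = 0 \<longrightarrow> p = \<phi>)"
  let ?Q = "\<lambda>i p p'. \<forall>v\<in>FM X (dF (Suc i)). g i (p' v) = p (f i v)"
  have "\<exists>P. \<forall>i. ?P i (P i) \<and> ?Q i (P i) (P (Suc i))"
  proof -
    \<comment> \<open>The choice is made for pairs of consecutive maps, because lifting past step \<open>i\<close> uses that the
      square below it commutes.\<close>
    let ?R = "\<lambda>i pp. ?P i (fst pp) \<and> gmap X (dF (Suc i)) (dG (Suc i)) (snd pp) \<and> ?Q i (fst pp) (snd pp)"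
    have "\<exists>P. \<forall>i. ?R i (P i) \<and> fst (P (Suc i)) = snd (P i)"
    proof (rule dependent_nat_choice)
      show "\<exists>pp. ?R 0 pp" using lift0 phi by auto
    next
      fix i pp assume R: "?R i pp"
      have "\<exists>q. gmap X (dF (Suc (Suc i))) (dG (Suc (Suc i))) q
          \<and> (\<forall>v\<in>FM X (dF (Suc (Suc i))). g (Suc i) (q v) = snd pp (f (Suc i) v))"
      proof (rule gmap_lift[OF resolves_gmap[OF G] gmap_comp[OF _ resolves_gmap[OF F]]])
        show "gmap X (dF (Suc i)) (dG (Suc i)) (snd pp)" using R by simp
        fix v :: "('a, 'b) fvec" assume v: "v \<in> FM X (dF (Suc (Suc i)))"
        have w: "f (Suc i) v \<in> FM X (dF (Suc i))"
          using v gmap_FM[OF resolves_gmap[OF F]] by blast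
        have "g i (snd pp (f (Suc i) v)) = fst pp (f i (f (Suc i) v))"
          using R w by blast
        also have "\<dots> = 0"
          using resolves_comp[OF F v] R lin_zero[OF gmap_lin] by auto
        finally show "snd pp (f (Suc i) v) \<in> g (Suc i) ` FM X (dG (Suc (Suc i)))"
          using R w gmap_FM by (intro resolves_exactD[OF G]) blast+
      qed
      then obtain q where "gmap X (dF (Suc (Suc i))) (dG (Suc (Suc i))) q"
          "\<forall>v\<in>FM X (dF (Suc (Suc i))). g (Suc i) (q v) = snd pp (f (Suc i) v)" by blast
      then show "\<exists>pp'. ?R (Suc i) pp' \<and> fst pp' = snd pp"
        using R by (intro exI[of _ "(snd pp, q)"]) simp
    qed
    then obtain P where P: "\<And>i. ?R i (P i)" "\<And>i. fst (P (Suc i)) = snd (P i)" by blast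
    have "?P i (fst (P i)) \<and> ?Q i (fst (P i)) (fst (P (Suc i)))" for i
      using P(1)[of i] P(2)[of i] by simp
    then show ?thesis by (intro exI[of _ "\<lambda>i. fst (P i)"]) blast
  qed
  then obtain P where P: "\<And>i. gmap X (dF i) (dG i) (P i)" "P 0 = \<phi>"
    and PQ: "\<And>i v. v \<in> FM X (dF (Suc i)) \<Longrightarrow> g i (P (Suc i) v) = P i (f i v)"
    by blast
  \<comment> \<open>The shifted complex, continued by zero, treats the first step of the cone like the others.\<close>
  define dm where "dm i = (case i of 0 \<Rightarrow> [] | Suc k \<Rightarrow> dF k)" for i
  define fm where "fm i = (case i of 0 \<Rightarrow> (\<lambda>v. 0) | Suc k \<Rightarrow> f k)" for i
  have dm [simp]: "dm 0 = []" "dm (Suc i) = dF i" for i by (simp_all add: dm_def)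
  have fm [simp]: "fm 0 = (\<lambda>v. 0)" "fm (Suc i) = f i" for i by (simp_all add: fm_def)
  have gfm: "gmap X (dm (Suc i)) (dm i) (fm i)" for i
    by (cases i) (simp_all add: gmap_zero resolves_gmap[OF F])
  define D where "D i = dG i @ dm i" for i
  define h where "h i v = (g i (trunc (length (dG (Suc i))) v) + P i (unshift (length (dG (Suc i))) v))
     + shift (length (dG i)) (- fm i (unshift (length (dG (Suc i))) v))" for i v
  have gh: "gmap X (D (Suc i)) (D i) (h i)" for i
  proof -
    have t: "gmap X (D (Suc i)) (dG (Suc i)) (trunc (length (dG (Suc i))))"
      "gmap X (D (Suc i)) (dF i) (unshift (length (dG (Suc i))))"
      using gmap_trunc gmap_unshift by (auto simp: D_def)
    have "gmap X (D (Suc i)) (D i) (\<lambda>v. g i (trunc (length (dG (Suc i))) v) + P i (unshift (length (dG (Suc i))) v))"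
      unfolding D_def
      by (rule gmap_comp[OF gmap_inl gmap_add[OF gmap_comp[OF resolves_gmap[OF G] t(1)[unfolded D_def]]
              gmap_comp[OF P(1) t(2)[unfolded D_def]]]])
    moreover have "gmap X (D (Suc i)) (D i) (\<lambda>v. shift (length (dG i)) (- fm i (unshift (length (dG (Suc i))) v)))"
      unfolding D_def
      by (rule gmap_comp[OF gmap_inr gmap_comp[OF gmap_uminus[OF gfm]]])
         (use t(2) in \<open>simp add: D_def\<close>)
    ultimately show ?thesis
      unfolding h_def by (rule gmap_add)
  qed
  have h: "h i (u + shift (length (dG (Suc i))) w) = (g i u + P i w) + shift (length (dG i)) (- fm i w)"
    if "u \<in> FM X (dG (Suc i))" for u w i
    using that by (simp add: h_def trunc_sum unshift_sum)
  have "{v \<in> FM X (D (Suc i)). h i v = 0} = h (Suc i) ` FM X (D (Suc (Suc i)))" for i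
  proof (intro equalityI subsetI; (elim CollectE conjE | elim imageE))
    fix v assume "v \<in> FM X (D (Suc i))" and v0: "h i v = 0"
    then obtain u w where u: "u \<in> FM X (dG (Suc i))" and w: "w \<in> FM X (dF i)"
      and v: "v = u + shift (length (dG (Suc i))) w"
      unfolding D_def by (auto elim: FM_append_E)
    have x: "g i u + P i w \<in> FM X (dG i)"
      using u w gmap_FM[OF resolves_gmap[OF G]] gmap_FM[OF P(1)] by blast
    have "g i u + P i w + shift (length (dG i)) (- fm i w) = 0"
      using v0 h[OF u] v by simp
    then have e1: "g i u + P i w = 0" and "- fm i w = 0"
      using trunc_sum[OF x, of "- fm i w"] unshift_sum[OF x, of "- fm i w"] by (simp_all only: part_zero unshift_zero)
    then have e2: "fm i w = 0" by simp
    have "\<exists>w'\<in>FM X (dF (Suc i)). f i w' = - w"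
    proof (cases i)
      case 0
      have "\<phi> w = - g 0 u"
        using e1 0 P(2) by (simp add: eq_neg_iff_add_eq_0 add.commute)
      also have "\<dots> = g 0 (- u)"
        using lin_uminus[OF gmap_lin[OF resolves_gmap[OF G]], of 0 u] by simp
      finally have "\<phi> w = g 0 (- u)" .
      then have "\<phi> w \<in> NG"
        using resolves_im[OF G] u 0 by (metis FM_uminus imageI)
      then have "w \<in> NF" using inj w 0 by simp
      then obtain w' where "w' \<in> FM X (dF (Suc 0))" "f 0 w' = w" using resolves_im[OF F] by auto
      then show ?thesis
        using 0 lin_uminus[OF gmap_lin[OF resolves_gmap[OF F]], of 0 w'] by (intro bexI[of _ "- w'"]) auto
    next
      case (Suc k)
      then obtain w' where "w' \<in> FM X (dF (Suc i))" "f i w' = w"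
        using resolves_exactD[OF F, of w k] e2 w by auto
      then show ?thesis
        using lin_uminus[OF gmap_lin[OF resolves_gmap[OF F]], of i w'] by (intro bexI[of _ "- w'"]) auto
    qed
    then obtain w' where w': "w' \<in> FM X (dF (Suc i))" "f i w' = - w" by blast
    have Pw': "P (Suc i) w' \<in> FM X (dG (Suc i))" using gmap_FM[OF P(1)] w' by blast
    have "g i (u - P (Suc i) w') = g i u + P i w"
      using w' PQ[OF w'(1)] lin_uminus[OF gmap_lin[OF P(1)]] lin_diff[OF gmap_lin[OF resolves_gmap[OF G]]] by simp
    then have "g i (u - P (Suc i) w') = 0" using e1 by simp
    then obtain u' where u': "u' \<in> FM X (dG (Suc (Suc i)))" "g (Suc i) u' = u - P (Suc i) w'"
      using resolves_exactD[OF G, of "u - P (Suc i) w'" i] u Pw' by (metis FM_diff imageE)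
    have "h (Suc i) (u' + shift (length (dG (Suc (Suc i)))) w') = v"
      using h[OF u'(1)] u' w' v by simp
    then show "v \<in> h (Suc i) ` FM X (D (Suc (Suc i)))"
      using FM_append_I[OF u'(1) w'(1)] unfolding D_def by force
  next
    fix v x assume v: "v = h (Suc i) x" and x: "x \<in> FM X (D (Suc (Suc i)))"
    then obtain u w where u: "u \<in> FM X (dG (Suc (Suc i)))" and w: "w \<in> FM X (dF (Suc i))"
      and xx: "x = u + shift (length (dG (Suc (Suc i)))) w"
      unfolding D_def by (auto elim: FM_append_E)
    have m: "g (Suc i) u + P (Suc i) w \<in> FM X (dG (Suc i))"
      using u w gmap_FM[OF resolves_gmap[OF G]] gmap_FM[OF P(1)] by blast
    have c: "fm i (f i w) = 0"
      using resolves_comp[OF F] w by (cases i) auto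
    have "h i v = (g i (g (Suc i) u) + g i (P (Suc i) w) + P i (- f i w)) + shift (length (dG i)) (- fm i (- f i w))"
      unfolding v xx h[OF u] using h[OF m] lin_add[OF gmap_lin[OF resolves_gmap[OF G]]] by simp
    also have "\<dots> = 0"
      using resolves_comp[OF G u] PQ[OF w] c lin_uminus[OF gmap_lin[OF P(1)]] lin_uminus[OF gmap_lin[OF gfm]]
      by simp
    finally show "v \<in> {v \<in> FM X (D (Suc i)). h i v = 0}"
      using gmap_FM[OF gh x] v by simp
  qed
  moreover have "h 0 ` FM X (D (Suc 0)) = {u + \<phi> v | u v. u \<in> NG \<and> v \<in> FM X (dF 0)}"
  proof (intro equalityI subsetI; (elim CollectE exE conjE | elim imageE))
    fix v x assume v: "v = h 0 x" and x: "x \<in> FM X (D (Suc 0))"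
    then obtain u w where u: "u \<in> FM X (dG (Suc 0))" and w: "w \<in> FM X (dF 0)"
      and xx: "x = u + shift (length (dG (Suc 0))) w"
      unfolding D_def by (auto elim: FM_append_E)
    then show "v \<in> {u + \<phi> v | u v. u \<in> NG \<and> v \<in> FM X (dF 0)}"
      using v h[OF u] P(2) resolves_im[OF G] by auto
  next
    fix x u v assume "x = u + \<phi> v" "u \<in> NG" "v \<in> FM X (dF 0)"
    moreover then obtain u' where "u' \<in> FM X (dG (Suc 0))" "u = g 0 u'"
      using resolves_im[OF G] by auto
    ultimately have "x = h 0 (u' + shift (length (dG (Suc 0))) v)" "u' + shift (length (dG (Suc 0))) v \<in> FM X (D (Suc 0))"
      using h[of u' 0 v] P(2) FM_append_I[of u' X "dG (Suc 0)" v "dF 0"] by (simp_all add: D_def)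
    then show "x \<in> h 0 ` FM X (D (Suc 0))" by blast
  qed
  ultimately have "resolves X D h {u + \<phi> v | u v. u \<in> NG \<and> v \<in> FM X (dF 0)}"
    using gh by (simp add: resolves_def)
  then show ?thesis unfolding D_def dm_def by blast
qed

section \<open>Comparison of resolutions\<close>

text \<open>One step of a homotopy equivalence between two complexes, with the homotopy on one side only.
  The submodules \<open>NT\<close> and \<open>NO\<close> are the images of the next differentials, so that the condition on
  \<open>v - \<phi> (\<psi> v) - U v\<close> provides the next part of the homotopy, while \<open>U\<close> is the part of the
  homotopy that factors through the preceding differential.\<close>

definition link where
  "link X dT NT dO NO \<phi> \<psi> U \<longleftrightarrow>
     gmap X dO dT \<phi> \<and> gmap X dT dO \<psi> \<and> gmap X dT dT U \<and>
     (\<forall>v\<in>NO. \<phi> v \<in> NT) \<and> (\<forall>v\<in>NT. \<psi> v \<in> NO) \<and>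
     (\<forall>v\<in>FM X dT. v - \<phi> (\<psi> v) - U v \<in> NT) \<and> (\<forall>v\<in>NT. U v = 0)"

text \<open>The next \<open>U\<close> is \<open>h B\<close>, and \<open>B (v - \<phi>' (\<psi>' v) - h (B v)) = U (B v) = 0\<close>. The resolutions enter
  only through one differential each, which allows one to construct the next differential on one
  side when a link is given.\<close>

lemma link_step:
  assumes L: "link X dT NT dO NO \<phi> \<psi> U"
    and B: "gmap X dT' dT B" "B ` FM X dT' = NT"
    and C: "gmap X dO' dO C" "C ` FM X dO' = NO"
  shows "\<exists>\<phi>' \<psi>' h. link X dT' {v\<in>FM X dT'. B v = 0} dO' {v\<in>FM X dO'. C v = 0} \<phi>' \<psi>' (\<lambda>v. h (B v)) \<and>
     gmap X dT dT' h \<and> (\<forall>v\<in>FM X dT. B (h v) = v - \<phi> (\<psi> v) - U v)"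
proof -
  have g: "gmap X dO dT \<phi>" "gmap X dT dO \<psi>" "gmap X dT dT U"
    using L by (auto simp: link_def)
  obtain \<phi>' where \<phi>': "gmap X dO' dT' \<phi>'" "\<And>v. v \<in> FM X dO' \<Longrightarrow> B (\<phi>' v) = \<phi> (C v)"
    using gmap_lift[OF B(1) gmap_comp[OF g(1) C(1)]] L B(2) C(2) by (auto simp: link_def)
  obtain \<psi>' where \<psi>': "gmap X dT' dO' \<psi>'" "\<And>v. v \<in> FM X dT' \<Longrightarrow> C (\<psi>' v) = \<psi> (B v)"
    using gmap_lift[OF C(1) gmap_comp[OF g(2) B(1)]] L B(2) C(2) by (auto simp: link_def)
  obtain h where h: "gmap X dT dT' h" "\<And>v. v \<in> FM X dT \<Longrightarrow> B (h v) = v - \<phi> (\<psi> v) - U v"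
    using gmap_lift[OF B(1) gmap_diff[OF gmap_diff[OF gmap_id gmap_comp[OF g(1,2)]] g(3)]] L B(2)
    by (auto simp: link_def)
  have lin: "lin B" "lin \<phi>" "lin \<psi>" "lin h" "lin C" "lin U"
    using B C g h gmap_lin by blast+
  have "link X dT' {v\<in>FM X dT'. B v = 0} dO' {v\<in>FM X dO'. C v = 0} \<phi>' \<psi>' (\<lambda>v. h (B v))"
    unfolding link_def
  proof (intro conjI ballI)
    show "gmap X dT' dT' (\<lambda>v. h (B v))" using gmap_comp[OF h(1) B(1)] .
  next
    fix v assume "v \<in> {v\<in>FM X dO'. C v = 0}"
    then show "\<phi>' v \<in> {v\<in>FM X dT'. B v = 0}"
      using \<phi>' gmap_FM[OF \<phi>'(1)] lin_zero[OF lin(2)] by simp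
  next
    fix v assume "v \<in> {v\<in>FM X dT'. B v = 0}"
    then show "\<psi>' v \<in> {v\<in>FM X dO'. C v = 0}" "h (B v) = 0"
      using \<psi>' gmap_FM[OF \<psi>'(1)] lin_zero[OF lin(3)] lin_zero[OF lin(4)] by simp_all
  next
    fix v :: "('a, 'b) fvec" assume v: "v \<in> FM X dT'"
    have m: "B v \<in> FM X dT" "\<psi>' v \<in> FM X dO'" "h (B v) \<in> FM X dT'" "\<phi>' (\<psi>' v) \<in> FM X dT'"
      using gmap_FM[OF B(1) v] gmap_FM[OF \<psi>'(1) v] gmap_FM[OF h(1)] gmap_FM[OF \<phi>'(1)] by auto
    have "U (B v) = 0" using L B(2) v by (auto simp: link_def)
    then have "B (v - \<phi>' (\<psi>' v) - h (B v)) = 0"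
      using m v by (simp add: lin_diff[OF lin(1)] \<phi>' \<psi>' h)
    then show "v - \<phi>' (\<psi>' v) - h (B v) \<in> {v\<in>FM X dT'. B v = 0}"
      using m v by auto
  qed (use \<phi>' \<psi>' in auto)
  then show ?thesis using h by blast
qed

abbreviation const_coeff :: "('x, 'k::field) fvec \<Rightarrow> nat \<Rightarrow> 'k" where
  "const_coeff v a \<equiv> lookup (lookup v a) 0"

lemma const_gmap_expand:
  assumes "gmap X d e f" "v \<in> FM X d"
  shows "const_coeff (f v) c = (\<Sum>a<length d. const_coeff v a * const_coeff (f (single a 1)) c)"
  by (subst gmap_expand[OF assms]) (simp add: lookup_sum lookup_smul lookup_mult_0)

text \<open>Let \<open>e\<close> be the basis vector \<open>a\<close>. Modulo the variables, the assumptions on the row and on the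
  column say that the two parts of the homotopy do not contribute to the entry \<open>(a, a)\<close>. So \<open>\<phi> \<psi>\<close> has
  the entry \<open>1\<close> there, and some basis vector of the other resolution maps to \<open>e\<close> with a nonzero
  constant.\<close>

lemma generator_persists:
  assumes T: "resolves X dT f NT" and O: "resolves X dO g NO"
    and L: "link X (dT 0) NT (dO 0) NO \<phi> \<psi> (\<lambda>v. 0)"
    and a: "a < length (dT i)"
    and row: "\<And>b. b < length (dT (Suc i)) \<Longrightarrow> const_coeff (f i (single b 1)) a = 0"
    and col: "\<And>k b. i = Suc k \<Longrightarrow> const_coeff (f k (single a 1)) b = 0"
  shows "dT i ! a \<in> set (dO i)"
proof -
  let ?NT = "\<lambda>i. f i ` FM X (dT (Suc i))" and ?NO = "\<lambda>i. g i ` FM X (dO (Suc i))"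
  have "\<exists>\<phi> \<psi> U. link X (dT i) (?NT i) (dO i) (?NO i) \<phi> \<psi> U \<and>
    (\<forall>a<length (dT i). (\<forall>k b. i = Suc k \<longrightarrow> const_coeff (f k (single a 1)) b = 0) \<longrightarrow> (\<forall>c. const_coeff (U (single a 1)) c = 0))"
    for i
  proof (induction i)
    case 0
    show ?case using L resolves_im[OF T] resolves_im[OF O] by (intro exI[of _ \<phi>] exI[of _ \<psi>] exI[of _ "\<lambda>v. 0"]) simp
  next
    case (Suc i)
    then obtain \<phi> \<psi> U where "link X (dT i) (?NT i) (dO i) (?NO i) \<phi> \<psi> U" by blast
    from link_step[OF this resolves_gmap[OF T] refl resolves_gmap[OF O] refl]
    obtain \<phi>' \<psi>' h where h: "link X (dT (Suc i)) (?NT (Suc i)) (dO (Suc i)) (?NO (Suc i)) \<phi>' \<psi>' (\<lambda>v. h (f i v))"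
      "gmap X (dT i) (dT (Suc i)) h"
      unfolding resolves_ker[OF T] resolves_ker[OF O] by blast
    have "const_coeff (h (f i (single a 1))) c = 0"
      if a: "a < length (dT (Suc i))" and z: "\<forall>b. const_coeff (f i (single a 1)) b = 0" for a c
      using z by (subst const_gmap_expand[OF h(2) gmap_FM[OF resolves_gmap[OF T] basis_FM[OF a]]]) simp
    then show ?case
      using h(1) by (intro exI[of _ \<phi>'] exI[of _ \<psi>'] exI[of _ "\<lambda>v. h (f i v)"]) blast
  qed
  then obtain \<phi> \<psi> U where L: "link X (dT i) (?NT i) (dO i) (?NO i) \<phi> \<psi> U"
    and U: "const_coeff (U (single a 1)) a = 0"
    using a col by metis
  let ?e = "single a 1 :: ('a, 'b) fvec"
  have e: "?e \<in> FM X (dT i)" using a by (rule basis_FM)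
  have g: "gmap X (dO i) (dT i) \<phi>" "gmap X (dT i) (dO i) \<psi>" using L by (auto simp: link_def)
  obtain w where w: "w \<in> FM X (dT (Suc i))" "?e - \<phi> (\<psi> ?e) - U ?e = f i w"
    using L e by (auto simp: link_def)
  have "const_coeff (f i w) a = 0"
    by (subst const_gmap_expand[OF resolves_gmap[OF T] w(1)]) (simp add: row)
  then have "const_coeff (\<phi> (\<psi> ?e)) a = 1"
    using U unfolding w(2)[symmetric] by (simp add: lookup_minus)
  then have "(\<Sum>b<length (dO i). const_coeff (\<psi> ?e) b * const_coeff (\<phi> (single b 1)) a) \<noteq> 0"
    by (subst (asm) const_gmap_expand[OF g(1) gmap_FM[OF g(2) e]]) simp
  then obtain b where b: "b < length (dO i)" "const_coeff (\<psi> ?e) b \<noteq> 0"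
    by (metis (no_types, lifting) lessThan_iff mult_zero_left sum.neutral)
  have "dO i ! b = dT i ! a"
    using basis_const[OF gmap_FM[OF g(2) e] _ b] g(2) a by (auto simp: gmap_def)
  then show ?thesis using b(1) by (metis nth_mem)
qed

section \<open>Minimal free resolutions\<close>

lemma hpart_zero: "hpart d j 0 = 0"
  by (rule poly_mapping_eqI) (simp add: lookup_hpart)

text \<open>Take a shortest list of homogeneous generators.\<close>

lemma minimal_generators:
  assumes C: "gmap X c e g"
  shows "\<exists>d f. gmap X d e f \<and> f ` FM X d = g ` FM X c \<and> (\<forall>v\<in>FM X d. f v = 0 \<longrightarrow> (\<forall>a. const_coeff v a = 0))"
proof -
  let ?P = "\<lambda>n. \<exists>d f. gmap X d e f \<and> f ` FM X d = g ` FM X c \<and> length d = n"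
  have "\<exists>n. ?P n" using C by blast
  then obtain n where n: "?P n" "\<And>m. m < n \<Longrightarrow> \<not> ?P m" using exists_least_iff[of ?P] by auto
  then obtain d f where f: "gmap X d e f" "f ` FM X d = g ` FM X c" "length d = n" by blast
  have "const_coeff v a = 0" if v: "v \<in> FM X d" "f v = 0" for v a
  proof (rule ccontr)
    assume nz: "const_coeff v a \<noteq> 0"
    then have a: "a < length d" using v(1) by (cases "a < length d") (auto simp: FM_iff)
    \<comment> \<open>The homogeneous part \<open>w\<close> of the relation \<open>v\<close> has a unit at \<open>a\<close> and expresses the generator
      \<open>a\<close> through the others.\<close>
    define w where "w = hpart d (d ! a) v"
    have w: "w \<in> FM X d" "f w = 0"
      using v gmap_hpart[OF f(1) v(1)] by (auto simp: w_def hpart_zero)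
    define u where "u = const_coeff v a"
    have wa: "lookup w a = single 0 u"
      using homogeneous_0_eq_single[OF homogeneous_hcomp[of 0 "lookup v a"]]
      by (simp add: w_def lookup_hpart lookup_part u_def)
    define ix where "ix b = (if b < a then b else Suc b)" for b
    define d' where "d' = map (\<lambda>b. d ! ix b) [0..<n - 1]"
    define E where "E = (linear_ext (\<lambda>b. single (ix b) 1) :: ('a, 'b) fvec \<Rightarrow> ('a, 'b) fvec)"
    have len: "length d' = n - 1" by (simp add: d'_def)
    have ixb: "ix b < n" if "b < n - 1" for b using that a f(3) by (auto simp: ix_def)
    have gE: "gmap X d' d E"
      unfolding E_def using ixb f(3) by (intro gmap_ext) (auto simp: d'_def intro!: basis_FM basis_hvec hvec_single)
    have gfE: "gmap X d' e (\<lambda>v. f (E v))" by (rule gmap_comp[OF f(1) gE])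
    have "f ` FM X d \<subseteq> (\<lambda>v. f (E v)) ` FM X d'"
    proof
      fix x assume "x \<in> f ` FM X d"
      then obtain y where y: "y \<in> FM X d" "x = f y" by auto
      define s where "s = lookup y a * single 0 (inverse u)"
      define y' where "y' = y - s \<star> w"
      have "s \<in> polys X" using FM_lookup[OF y(1)] by (auto simp: s_def intro!: polys_mult polys_single)
      then have y': "y' \<in> FM X d" using y(1) w(1) by (auto simp: y'_def)
      have fy': "f y' = x"
        by (simp add: y'_def lin_diff[OF gmap_lin[OF f(1)]] lin_smul[OF gmap_lin[OF f(1)]] w y)
      have y'a: "lookup y' a = 0"
        using nz by (simp add: y'_def lookup_minus lookup_smul wa s_def mult.assoc mult_single u_def)
      define z where "z = (\<Sum>b<n - 1. single b (lookup y' (ix b)))"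
      have z: "z \<in> FM X d'"
        unfolding z_def by (auto intro!: FM_sum FM_single FM_lookup[OF y'] simp: len)
      have "E z = (\<Sum>b<n - 1. single (ix b) (lookup y' (ix b)))"
        unfolding z_def E_def by (simp add: lin_sum[OF lin_ext])
      also have "\<dots> = (\<Sum>c\<in>ix ` {..<n - 1}. single c (lookup y' c))"
        by (rule sum.reindex[symmetric, unfolded o_def]) (auto simp: inj_on_def ix_def split: if_splits)
      also have "ix ` {..<n - 1} = {..<n} - {a}"
      proof (intro equalityI subsetI)
        fix c assume c: "c \<in> {..<n} - {a}"
        show "c \<in> ix ` {..<n - 1}"
          using c a f(3) by (intro image_eqI[of _ _ "if c < a then c else c - 1"]) (auto simp: ix_def)
      qed (use ixb in \<open>auto simp: ix_def split: if_splits\<close>)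
      also have "(\<Sum>c\<in>{..<n} - {a}. single c (lookup y' c)) = y'"
      proof (rule poly_mapping_eqI)
        fix c
        have "lookup (\<Sum>c\<in>{..<n} - {a}. single c (lookup y' c)) c
            = (if c \<in> {..<n} - {a} then lookup y' c else 0)"
          by (simp add: lookup_sum lookup_single when_def)
        also have "\<dots> = lookup y' c"
          using y' y'a f(3) by (auto simp: FM_iff)
        finally show "lookup (\<Sum>c\<in>{..<n} - {a}. single c (lookup y' c)) c = lookup y' c" .
      qed
      finally have "x = f (E z)" using fy' by simp
      then show "x \<in> (\<lambda>v. f (E v)) ` FM X d'" using z by blast
    qed
    moreover have "(\<lambda>v. f (E v)) ` FM X d' \<subseteq> f ` FM X d"
      using gmap_FM[OF gE] by blast
    ultimately have "?P (n - 1)" using gfE f(2) len by (metis subset_antisym)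
    moreover have "n - 1 < n" using a f(3) by simp
    ultimately show False using n(2) by blast
  qed
  then show ?thesis using f by blast
qed

definition minimal where
  "minimal X d f \<longleftrightarrow> (\<forall>i. \<forall>v\<in>FM X (d (Suc i)). \<forall>a. const_coeff (f i v) a = 0)"

text \<open>Minimal generators are chosen step by step. Each new syzygy module \<open>M\<close> is finitely generated,
  because the link to the given resolution writes \<open>v \<in> M\<close> as \<open>\<phi> (\<psi> v)\<close>, where \<open>\<psi> v\<close> is a
  combination of the columns of the given differential, plus \<open>v - \<phi> (\<psi> v) - U v\<close>.\<close>

lemma minimal_resolution_exists:
  assumes O: "resolves X dO g N" and N: "\<And>v a. v \<in> N \<Longrightarrow> const_coeff v a = 0"
  shows "\<exists>d f. d 0 = dO 0 \<and> resolves X d f N \<and> minimal X d f"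
proof -
  let ?NO = "\<lambda>i. g i ` FM X (dO (Suc i))"
  define good where "good i d M \<longleftrightarrow> (\<exists>\<phi> \<psi> U. link X d M (dO i) (?NO i) \<phi> \<psi> U) \<and> M \<subseteq> FM X d \<and>
      (\<forall>v\<in>M. \<forall>a. const_coeff v a = 0) \<and> (\<forall>x\<in>M. \<forall>y\<in>M. x + y \<in> M)"
    for i d and M :: "('a, 'b) fvec set"
  \<comment> \<open>A state consists of the degrees of two consecutive free modules and the map between them.\<close>
  define P where "P i s \<longleftrightarrow> (case s of (d, d', f) \<Rightarrow> (i = 0 \<longrightarrow> d = dO 0 \<and> f ` FM X d' = N) \<and> gmap X d' d f
    \<and> good i d (f ` FM X d') \<and> good (Suc i) d' {v \<in> FM X d'. f v = 0})" for i s
  define Q where "Q s t \<longleftrightarrow> (case s of (d, d', f) \<Rightarrow> case t of (e, e', h) \<Rightarrow> e = d' \<and> h ` FM X e' = {v \<in> FM X d'. f v = 0})"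
    for s t :: "int list \<times> int list \<times> (('a, 'b) fvec \<Rightarrow> ('a, 'b) fvec)"
  have step: "\<exists>d' f. gmap X d' d f \<and> f ` FM X d' = M \<and> good (Suc i) d' {v \<in> FM X d'. f v = 0}" if M: "good i d M" for i d M
  proof -
    obtain \<phi> \<psi> U where L: "link X d M (dO i) (?NO i) \<phi> \<psi> U" and sub: "M \<subseteq> FM X d" using M by (auto simp: good_def)
    then have gg: "gmap X (dO i) d \<phi>" "gmap X d (dO i) \<psi>" "gmap X d d U" by (auto simp: link_def)
    let ?c = "dO (Suc i) @ d"
    let ?r = "\<lambda>v. v - \<phi> (\<psi> v) - U v"
    let ?h = "\<lambda>v. \<phi> (g i (trunc (length (dO (Suc i))) v)) + ?r (unshift (length (dO (Suc i))) v)"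
    have gr: "gmap X d d ?r" by (rule gmap_diff[OF gmap_diff[OF gmap_id gmap_comp[OF gg(1,2)]] gg(3)])
    have gh: "gmap X ?c d ?h"
      by (rule gmap_add[OF gmap_comp[OF gmap_comp[OF gg(1) resolves_gmap[OF O]] gmap_trunc] gmap_comp[OF gr gmap_unshift]])
    have hs: "?h (u + shift (length (dO (Suc i))) w) = \<phi> (g i u) + ?r w" if "u \<in> FM X (dO (Suc i))" for u w
      using that by (simp add: trunc_sum unshift_sum)
    have "?h ` FM X ?c = M"
    proof (intro equalityI subsetI)
      fix v assume v: "v \<in> M"
      then obtain u where u: "u \<in> FM X (dO (Suc i))" "\<psi> v = g i u" using L by (auto simp: link_def)
      have "U v = 0" using L v by (auto simp: link_def)
      then have "v = ?h (u + shift (length (dO (Suc i))) v)"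
        unfolding hs[OF u(1)] using u(2) by simp
      moreover have "u + shift (length (dO (Suc i))) v \<in> FM X ?c"
        using sub v by (intro FM_append_I[OF u(1)]) blast
      ultimately show "v \<in> ?h ` FM X ?c" by (rule image_eqI)
    next
      fix x assume "x \<in> ?h ` FM X ?c"
      then obtain v where v: "v \<in> FM X ?c" "x = ?h v" by blast
      obtain u w where u: "u \<in> FM X (dO (Suc i))" "w \<in> FM X d" "v = u + shift (length (dO (Suc i))) w"
        using v(1) by (rule FM_append_E)
      have "x = \<phi> (g i u) + ?r w" unfolding v(2) u(3) hs[OF u(1)] ..
      moreover have "\<phi> (g i u) \<in> M" "?r w \<in> M" using L u by (auto simp: link_def)
      ultimately show "x \<in> M" using M by (auto simp: good_def)
    qed
    with minimal_generators[OF gh] obtain d' f where f: "gmap X d' d f" "f ` FM X d' = M"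
      "\<forall>v\<in>FM X d'. f v = 0 \<longrightarrow> (\<forall>a. const_coeff v a = 0)" by metis
    have "good (Suc i) d' {v \<in> FM X d'. f v = 0}"
      using link_step[OF L f(1,2) resolves_gmap[OF O] refl] f(3)
      unfolding good_def resolves_ker[OF O] by (auto simp: lin_add[OF gmap_lin[OF f(1)]])
    with f show ?thesis by blast
  qed
  have N0: "good 0 (dO 0) N"
  proof -
    have "N \<subseteq> FM X (dO 0)" "\<forall>x\<in>N. \<forall>y\<in>N. x + y \<in> N"
    proof -
      show "N \<subseteq> FM X (dO 0)" using resolves_im[OF O] gmap_FM[OF resolves_gmap[OF O]] by blast
      show "\<forall>x\<in>N. \<forall>y\<in>N. x + y \<in> N"
      proof (intro ballI)
        fix x y assume "x \<in> N" "y \<in> N"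
        then obtain x' y' where "x' \<in> FM X (dO (Suc 0))" "y' \<in> FM X (dO (Suc 0))" "x = g 0 x'" "y = g 0 y'"
          using resolves_im[OF O] by blast
        then have "x + y = g 0 (x' + y')" "x' + y' \<in> FM X (dO (Suc 0))"
          using lin_add[OF gmap_lin[OF resolves_gmap[OF O]]] by auto
        then show "x + y \<in> N" using resolves_im[OF O] by blast
      qed
    qed
    moreover have "0 \<in> N"
      using resolves_im[OF O] lin_zero[OF gmap_lin[OF resolves_gmap[OF O]]] by (metis FM_zero imageI)
    then have "link X (dO 0) N (dO 0) (?NO 0) (\<lambda>v. v) (\<lambda>v. v) (\<lambda>v. 0)"
      using resolves_im[OF O] by (simp add: link_def gmap_id gmap_zero)
    ultimately show ?thesis using N by (auto simp: good_def)
  qed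
  have "\<exists>s. \<forall>i. P i (s i) \<and> Q (s i) (s (Suc i))"
  proof (rule dependent_nat_choice)
    obtain d' f where "gmap X d' (dO 0) f" "f ` FM X d' = N" "good (Suc 0) d' {v \<in> FM X d'. f v = 0}"
      using step[OF N0] by blast
    then show "\<exists>s. P 0 s" using N0 by (intro exI[of _ "(dO 0, d', f)"]) (simp add: P_def)
  next
    fix s i assume s: "P i s"
    obtain d d' f where sd: "s = (d, d', f)" by (cases s)
    have M: "good (Suc i) d' {v \<in> FM X d'. f v = 0}" using s by (simp add: P_def sd)
    obtain e' h where "gmap X e' d' h" "h ` FM X e' = {v \<in> FM X d'. f v = 0}" "good (Suc (Suc i)) e' {v \<in> FM X e'. h v = 0}"
      using step[OF M] by blast
    then show "\<exists>t. P (Suc i) t \<and> Q s t"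
      using M by (intro exI[of _ "(d', e', h)"]) (simp add: P_def Q_def sd)
  qed
  then obtain s where s: "\<And>i. P i (s i)" "\<And>i. Q (s i) (s (Suc i))" by blast
  define d where "d i = fst (s i)" for i
  define f where "f i = snd (snd (s i))" for i
  have d': "fst (snd (s i)) = d (Suc i)" and im: "f (Suc i) ` FM X (fst (snd (s (Suc i)))) = {v \<in> FM X (fst (snd (s i))). f i v = 0}" for i
    using s(2)[of i] by (simp_all add: Q_def d_def f_def split: prod.splits)
  have sP: "i = 0 \<longrightarrow> d i = dO 0 \<and> f i ` FM X (d (Suc i)) = N" "gmap X (d (Suc i)) (d i) (f i)" "good i (d i) (f i ` FM X (d (Suc i)))" for i
    using s(1)[of i] unfolding d'[symmetric] by (auto simp: P_def d_def f_def split: prod.splits)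
  have "resolves X d f N"
    unfolding resolves_def using sP im[unfolded d'] by auto
  moreover have "minimal X d f"
    using sP(3) by (auto simp: minimal_def good_def)
  ultimately show ?thesis using sP(1)[of 0] by blast
qed

section \<open>Resolutions of cyclic modules by matrices\<close>

lemma poly_ring_simps [simp]:
  "monoid.mult (poly_ring X) = (*)" "one (poly_ring X) = 1" "zero (poly_ring X) = 0" "add (poly_ring X) = (+)"
  by (simp_all add: poly_ring_def)

lemma cring_poly_ring: "cring (poly_ring X :: ('x, 'k::field) mpoly ring)"
proof (rule cringI)
  show "abelian_group (poly_ring X :: ('x, 'k) mpoly ring)"
    by (rule abelian_groupI) (auto simp: add.assoc add.commute intro!: bexI[of _ "- _"])
  show "comm_monoid (poly_ring X :: ('x, 'k) mpoly ring)"
    by (rule comm_monoidI) (auto simp: mult.assoc mult.commute)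
qed (simp add: distrib_right)

text \<open>The toric ring of a graph is the instance in which \<open>I\<close> is its toric ideal.\<close>

definition quotient_module where
  "quotient_module X I =
     (let S = poly_ring X; Q = S Quot I in
       \<lparr>carrier = carrier Q, monoid.mult = monoid.mult Q, one = one Q, zero = zero Q, add = add Q,
        smult = (\<lambda>s c. monoid.mult Q (I +>\<^bsub>S\<^esub> s) c),
        component = (\<lambda>j. {I +>\<^bsub>S\<^esub> p | p. p \<in> carrier S \<and> homogeneous j p})\<rparr>)"

abbreviation coset :: "'x set \<Rightarrow> ('x, 'k::field) mpoly set \<Rightarrow> ('x, 'k) mpoly \<Rightarrow> ('x, 'k) mpoly set" where
  "coset X I p \<equiv> I +>\<^bsub>poly_ring X\<^esub> p"

lemma coset_alt: "coset X I p = {i + p | i. i \<in> I}"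
  by (auto simp: a_r_coset_def')

lemma coset_eq_iff:
  assumes "ideal I (poly_ring X)"
  shows "coset X I p = coset X I q \<longleftrightarrow> p - q \<in> I"
proof -
  interpret ideal I "poly_ring X" by fact
  have m: "- x \<in> I" if "x \<in> I" for x
  proof -
    have "- 1 \<in> polys X" by (rule polys_uminus[OF polys_one])
    then show ?thesis using I_l_closed[OF that, of "- 1"] by simp
  qed
  have "0 \<in> I" using additive_subgroup.zero_closed[OF ideal.axioms(1)[OF assms]] by simp
  moreover have "x + y \<in> I" if "x \<in> I" "y \<in> I" for x y
    using additive_subgroup.a_closed[OF ideal.axioms(1)[OF assms] that] by simp
  ultimately show ?thesis
    unfolding coset_alt set_eq_iff
    by (auto intro: exI[of _ 0]) (metis (no_types, lifting) add.commute add_diff_cancel_right' diff_add_cancel diff_diff_eq2 m uminus_add_conv_diff)+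
qed

definition fvec_of :: "('x, 'k::field) mpoly vec \<Rightarrow> ('x, 'k) fvec" where
  "fvec_of v = (\<Sum>a<dim_vec v. single a (v $ a))"

definition vec_of :: "nat \<Rightarrow> ('x, 'k::field) fvec \<Rightarrow> ('x, 'k) mpoly vec" where
  "vec_of r u = vec r (lookup u)"

lemma lookup_fvec_of: "lookup (fvec_of v) a = (if a < dim_vec v then v $ a else 0)"
  by (simp add: fvec_of_def lookup_sum lookup_single when_def)

lemma fvec_of_FM: "v \<in> free_module X (length d) \<Longrightarrow> fvec_of v \<in> FM X d"
  by (auto simp: free_module_def FM_iff lookup_fvec_of)

lemma vec_of_free: "u \<in> FM X d \<Longrightarrow> vec_of (length d) u \<in> free_module X (length d)"
  by (auto simp: free_module_def FM_iff vec_of_def)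

lemma fvec_of_vec_of: "u \<in> FM X d \<Longrightarrow> fvec_of (vec_of (length d) u) = u"
  by (rule poly_mapping_eqI) (auto simp: lookup_fvec_of vec_of_def FM_iff)

lemma vec_of_fvec_of: "v \<in> carrier_vec r \<Longrightarrow> vec_of r (fvec_of v) = v"
  by (rule eq_vecI) (auto simp: lookup_fvec_of vec_of_def)

lemma FM_eq_fvec_of_image: "FM X d = fvec_of ` free_module X (length d)"
proof (intro equalityI subsetI)
  fix x :: "('a, 'b) fvec" assume "x \<in> FM X d"
  then show "x \<in> fvec_of ` free_module X (length d)"
    using vec_of_free fvec_of_vec_of by (metis imageI)
qed (auto intro: fvec_of_FM)

lemma free_module_carrier: "v \<in> free_module X r \<Longrightarrow> v \<in> carrier_vec r"
  by (simp add: free_module_def)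

lemma inj_fvec_of: "inj_on fvec_of (carrier_vec r)"
  by (rule inj_on_inverseI[of _ "vec_of r"]) (rule vec_of_fvec_of)

lemma fvec_of_mult_mat_vec:
  assumes A: "A \<in> carrier_mat r c" and v: "v \<in> carrier_vec c" and f: "lin f"
    and cols: "\<And>b. b < c \<Longrightarrow> f (single b 1) = fvec_of (col A b)"
  shows "fvec_of (A *\<^sub>v v) = f (fvec_of v)"
proof (rule poly_mapping_eqI)
  fix a
  have "keys (fvec_of v) \<subseteq> {..<c}"
    using v by (auto simp: in_keys_iff lookup_fvec_of split: if_splits)
  then have "lookup (f (fvec_of v)) a = (\<Sum>b<c. lookup (fvec_of v) b * lookup (f (single b 1)) a)"
    by (subst lin_expand[OF f, of "{..<c}"]) (auto simp: lookup_sum lookup_smul)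
  also have "\<dots> = (\<Sum>b<c. v $ b * lookup (fvec_of (col A b)) a)"
    using v by (intro sum.cong) (auto simp: lookup_fvec_of cols)
  also have "\<dots> = lookup (fvec_of (A *\<^sub>v v)) a"
    using A v by (auto simp: lookup_fvec_of scalar_prod_def lessThan_atLeast0 mult.commute intro!: sum.cong)
  finally show "lookup (fvec_of (A *\<^sub>v v)) a = lookup (f (fvec_of v)) a" ..
qed

lemma mult_mat_vec_free:
  assumes A: "A \<in> carrier_mat r c" and v: "v \<in> free_module X c"
    and S: "\<And>a b. a < r \<Longrightarrow> b < c \<Longrightarrow> A $$ (a, b) \<in> polys X"
  shows "A *\<^sub>v v \<in> free_module X r"
  using assms by (auto simp: free_module_def scalar_prod_def intro!: polys_sum polys_mult)

lemma exact_transfer: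
  assumes A: "A \<in> carrier_mat (length d) (length e)" and f: "gmap X e d f"
    and Af: "\<And>b. b < length e \<Longrightarrow> f (single b 1) = fvec_of (col A b)"
    and B: "B \<in> carrier_mat (length e) (length c)" and g: "gmap X c e g"
    and Bg: "\<And>b. b < length c \<Longrightarrow> g (single b 1) = fvec_of (col B b)"
  shows "{v \<in> free_module X (length e). A *\<^sub>v v = 0\<^sub>v (length d)} = (\<lambda>w. B *\<^sub>v w) ` free_module X (length c)
    \<longleftrightarrow> {v \<in> FM X e. f v = 0} = g ` FM X c" (is "?L = ?R \<longleftrightarrow> ?L' = ?R'")
proof -
  have fz: "A *\<^sub>v v = 0\<^sub>v (length d) \<longleftrightarrow> f (fvec_of v) = 0" if "v \<in> free_module X (length e)" for v
  proof -
    have "fvec_of (A *\<^sub>v v) = f (fvec_of v)"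
      by (rule fvec_of_mult_mat_vec[OF A _ gmap_lin[OF f] Af]) (use that in \<open>auto simp: free_module_def\<close>)
    moreover have "fvec_of (0\<^sub>v (length d)) = 0"
      by (rule poly_mapping_eqI) (simp add: lookup_fvec_of)
    moreover have "A *\<^sub>v v \<in> carrier_vec (length d)" using A by (intro carrier_vecI) simp
    ultimately show ?thesis
      using inj_onD[OF inj_fvec_of] by (metis zero_carrier_vec)
  qed
  have L: "fvec_of ` ?L = ?L'"
    unfolding FM_eq_fvec_of_image using fz by auto
  have "fvec_of (B *\<^sub>v w) = g (fvec_of w)" if "w \<in> free_module X (length c)" for w
    by (rule fvec_of_mult_mat_vec[OF B _ gmap_lin[OF g] Bg]) (use that in \<open>auto simp: free_module_def\<close>)
  then have R: "fvec_of ` ?R = ?R'"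
    unfolding FM_eq_fvec_of_image image_image by (intro image_cong) auto
  have "?L \<subseteq> carrier_vec (length e)" "?R \<subseteq> carrier_vec (length e)"
    using B by (auto simp: free_module_def)
  from inj_on_image_eq_iff[OF inj_fvec_of this] show ?thesis
    unfolding L R by simp
qed

text \<open>A cyclic module is presented by vectors of length one.\<close>

abbreviation cyc :: "('x, 'k::field) mpoly \<Rightarrow> ('x, 'k) fvec" where
  "cyc \<equiv> single 0"

lemma cyc_mem_image: "cyc p \<in> cyc ` I \<longleftrightarrow> p \<in> I"
  by (auto dest: arg_cong[where f = "\<lambda>v. lookup v 0"])

lemma FM_cyclic: "FM X [j] = cyc ` polys X"
proof (intro equalityI subsetI)
  fix v :: "('a, 'b) fvec" assume v: "v \<in> FM X [j]"
  have "v = cyc (lookup v 0)"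
    by (rule poly_mapping_eqI) (use v in \<open>auto simp: FM_iff lookup_single when_def\<close>)
  then show "v \<in> cyc ` polys X" using FM_lookup[OF v] by blast
qed auto

context
  fixes X :: "'x set" and I :: "('x, 'k::field) mpoly set"
  assumes I: "ideal I (poly_ring X)"
begin

lemma augmentation_coset:
  assumes p: "\<And>a. a < length g \<Longrightarrow> p a \<in> polys X \<and> g ! a = coset X I (p a)"
    and v: "v \<in> free_module X (length g)"
  shows "augmentation (quotient_module X I) g v = coset X I (\<Sum>a<length g. v $ a * p a)"
proof -
  let ?S = "poly_ring X :: ('x, 'k) mpoly ring" and ?M = "quotient_module X I"
  interpret ideal I ?S by (fact I)
  interpret Q: ring "?S Quot I" by (rule quotient_is_ring)
  have h: "ring_hom_ring ?S (?S Quot I) (coset X I)" by (rule rcos_ring_hom_ring)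
  then interpret h: ring_hom_ring ?S "?S Quot I" "coset X I" .
  have M: "add ?M = add (?S Quot I)" "carrier ?M = carrier (?S Quot I)" "zero ?M = zero (?S Quot I)"
    "smult ?M = (\<lambda>s c. monoid.mult (?S Quot I) (coset X I s) c)"
    by (simp_all add: quotient_module_def Let_def)
  have am: "abelian_monoid ?M"
    by (rule abelian_monoidI) (simp_all add: M Q.a_ac)
  have t: "(v $ a) \<odot>\<^bsub>?M\<^esub> (g ! a) = coset X I (v $ a * p a)" if "a < length g" for a
    using that p[OF that] v h.hom_mult[of "v $ a" "p a"] by (simp add: M free_module_def)
  have mem: "v $ a * p a \<in> polys X" if "a < length g" for a
    using that p[OF that] v by (auto simp: free_module_def)
  have "(\<Oplus>\<^bsub>?M\<^esub>a\<in>{..<n}. (v $ a) \<odot>\<^bsub>?M\<^esub> (g ! a)) = coset X I (\<Sum>a<n. v $ a * p a)" if "n \<le> length g" for n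
    using that
  proof (induction n)
    case 0
    then show ?case using abelian_monoid.finsum_empty[OF am] h.hom_zero M by simp
  next
    case (Suc n)
    have c: "coset X I x \<in> carrier ?M" if "x \<in> polys X" for x
      using h.hom_closed[of x] that M by simp
    have "(\<Oplus>\<^bsub>?M\<^esub>a\<in>{..<Suc n}. (v $ a) \<odot>\<^bsub>?M\<^esub> (g ! a))
        = (v $ n) \<odot>\<^bsub>?M\<^esub> (g ! n) \<oplus>\<^bsub>?M\<^esub> (\<Oplus>\<^bsub>?M\<^esub>a\<in>{..<n}. (v $ a) \<odot>\<^bsub>?M\<^esub> (g ! a))"
      unfolding lessThan_Suc using Suc.prems t mem c
      by (intro abelian_monoid.finsum_insert[OF am]) auto
    also have "\<dots> = coset X I (v $ n * p n + (\<Sum>a<n. v $ a * p a))"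
    proof -
      have "(\<Sum>a<n. v $ a * p a) \<in> polys X" using Suc.prems mem by (intro polys_sum) auto
      then show ?thesis
        using Suc t[of n] mem[of n] h.hom_add[of "v $ n * p n" "\<Sum>a<n. v $ a * p a"] by (simp add: M)
    qed
    finally show ?case by (simp add: add.commute)
  qed
  then show ?thesis by (simp add: augmentation_def)
qed

lemma carrier_quotient_module: "carrier (quotient_module X I) = coset X I ` polys X"
  by (auto simp: quotient_module_def Let_def FactRing_def A_RCOSETS_def')

lemma zero_quotient_module: "zero (quotient_module X I) = coset X I 0"
proof -
  interpret ideal I "poly_ring X" by (fact I)
  show ?thesis by (auto simp: quotient_module_def Let_def FactRing_def coset_alt)
qed

lemma resolution_to_matrices:
  assumes R: "resolves X d f (cyc ` I)" and d0: "d 0 = [0]" and m: "minimal X d f"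
  shows "\<exists>A g. minimal_graded_free_resolution X (quotient_module X I) d A g"
proof -
  define A where "A i = mat (length (d i)) (length (d (Suc i))) (\<lambda>(a, b). lookup (f i (single b 1)) a)" for i
  have A: "A i \<in> carrier_mat (length (d i)) (length (d (Suc i)))" for i by (simp add: A_def)
  have Af: "f i (single b 1) = fvec_of (col (A i) b)" if "b < length (d (Suc i))" for i b
  proof (rule poly_mapping_eqI)
    fix a show "lookup (f i (single b 1)) a = lookup (fvec_of (col (A i) b)) a"
      using that gmap_FM[OF resolves_gmap[OF R] basis_FM[OF that]] by (auto simp: lookup_fvec_of A_def FM_iff)
  qed
  let ?M = "quotient_module X I" and ?g = "[coset X I 1]"
  have free1: "free_module X 1 = {v. dim_vec v = 1 \<and> v $ 0 \<in> polys X}"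
    unfolding free_module_def carrier_vec_def mem_Collect_eq less_one by blast
  have aug: "augmentation ?M ?g v = coset X I (v $ 0)" if "v \<in> free_module X 1" for v
  proof -
    have "?g ! a = coset X I 1" if "a < length ?g" for a using that by simp
    then have "augmentation ?M ?g v = coset X I (\<Sum>a<length ?g. v $ a * 1)"
      by (intro augmentation_coset conjI polys_one) (simp_all only: list.size that One_nat_def[symmetric] add_0)
    then show ?thesis by (simp only: list.size add_0 One_nat_def[symmetric]) simp
  qed
  have "graded_free_resolution X ?M d A ?g"
    unfolding graded_free_resolution_def
  proof (intro conjI allI impI)
    fix i a b assume ab: "a < length (d i)" "b < length (d (Suc i))"
    have "f i (single b 1) \<in> FM X (d i)" "hvec (d i) (d (Suc i) ! b) (f i (single b 1))"
      using resolves_gmap[OF R] ab by (auto simp: gmap_def)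
    then show "A i $$ (a, b) \<in> carrier (poly_ring X)" "homogeneous (d (Suc i) ! b - d i ! a) (A i $$ (a, b))"
      using ab by (auto simp: A_def FM_iff hvec_def)
  next
    fix a assume "a < length ?g"
    then show "?g ! a \<in> component ?M (d 0 ! a)"
      by (auto simp: d0 quotient_module_def Let_def)
  next
    have "augmentation ?M ?g ` free_module X 1 = (\<lambda>v. coset X I (v $ 0)) ` free_module X 1"
      by (intro image_cong refl aug)
    also have "\<dots> = coset X I ` polys X"
    proof (intro equalityI subsetI; elim imageE)
      fix x p assume "x = coset X I p" "p \<in> polys X"
      then show "x \<in> (\<lambda>v. coset X I (v $ 0)) ` free_module X 1"
        by (intro image_eqI[where x = "vec 1 (\<lambda>_. p)"]) (simp_all add: free1[simplified])
    qed (auto simp: free1[simplified])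
    finally show "augmentation ?M ?g ` free_module X (length (d 0)) = carrier ?M"
      by (simp add: d0 carrier_quotient_module)
  next
    have L: "{v \<in> free_module X 1. augmentation ?M ?g v = \<zero>\<^bsub>?M\<^esub>} = {v \<in> free_module X 1. v $ 0 \<in> I}"
      by (intro Collect_cong conj_cong refl) (simp only: aug zero_quotient_module coset_eq_iff[OF I] diff_zero)
    have "fvec_of v = cyc (v $ 0)" if "v \<in> free_module X 1" for v :: "('x, 'k) mpoly vec"
      using that unfolding free1 by (simp add: fvec_of_def)
    then have l: "v $ 0 \<in> I \<longleftrightarrow> fvec_of v \<in> cyc ` I" if "v \<in> free_module X 1" for v
      using that by (simp add: cyc_mem_image)
    have eq: "fvec_of (A 0 *\<^sub>v w) = f 0 (fvec_of w)" if "w \<in> free_module X (length (d 1))" for w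
      by (rule fvec_of_mult_mat_vec[OF A[of 0] _ gmap_lin[OF resolves_gmap[OF R]] Af]) (use that in \<open>auto simp: free_module_def\<close>)
    show "{v \<in> free_module X (length (d 0)). augmentation ?M ?g v = \<zero>\<^bsub>?M\<^esub>} = (\<lambda>w. A 0 *\<^sub>v w) ` free_module X (length (d 1))"
    proof (intro equalityI subsetI)
      fix v assume "v \<in> {v \<in> free_module X (length (d 0)). augmentation ?M ?g v = \<zero>\<^bsub>?M\<^esub>}"
      then have v: "v \<in> free_module X 1" "fvec_of v \<in> cyc ` I" using L l by (auto simp: d0)
      then obtain u where u: "u \<in> FM X (d (Suc 0))" "fvec_of v = f 0 u" using resolves_im[OF R] by blast
      then obtain w where w: "w \<in> free_module X (length (d 1))" "u = fvec_of w"
        unfolding FM_eq_fvec_of_image by auto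
      have "fvec_of v = fvec_of (A 0 *\<^sub>v w)" using eq[OF w(1)] u w by simp
      moreover have "A 0 *\<^sub>v w \<in> carrier_vec 1" using A[of 0] by (intro carrier_vecI) (simp add: d0)
      ultimately have "v = A 0 *\<^sub>v w"
        by (rule inj_onD[OF inj_fvec_of _ free_module_carrier[OF v(1)]])
      then show "v \<in> (\<lambda>w. A 0 *\<^sub>v w) ` free_module X (length (d 1))" using w by blast
    next
      fix v assume "v \<in> (\<lambda>w. A 0 *\<^sub>v w) ` free_module X (length (d 1))"
      then obtain w where w: "w \<in> free_module X (length (d 1))" "v = A 0 *\<^sub>v w" by blast
      have fw: "fvec_of w \<in> FM X (d (Suc 0))" using w by (simp add: fvec_of_FM)
      have "fvec_of v \<in> cyc ` I"
        unfolding w(2) eq[OF w(1)] resolves_im[OF R, symmetric] using fw by blast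
      moreover have "v \<in> free_module X 1"
      proof -
        have "A 0 $$ (a, b) \<in> polys X" if "a < 1" "b < length (d 1)" for a b
          using that gmap_FM[OF resolves_gmap[OF R, of 0] basis_FM, of b] by (auto simp: A_def d0 FM_iff)
        then show ?thesis
          unfolding w(2) using A[of 0] w(1) by (intro mult_mat_vec_free[of _ 1 "length (d 1)"]) (simp_all add: d0)
      qed
      ultimately show "v \<in> {v \<in> free_module X (length (d 0)). augmentation ?M ?g v = \<zero>\<^bsub>?M\<^esub>}"
        using L l by (auto simp: d0)
    qed
  next
    fix i show "{v \<in> free_module X (length (d (Suc i))). A i *\<^sub>v v = 0\<^sub>v (length (d i))} = (\<lambda>w. A (Suc i) *\<^sub>v w) ` free_module X (length (d (Suc (Suc i))))"
      by (rule iffD2[OF exact_transfer[OF A resolves_gmap[OF R] _ A resolves_gmap[OF R]]],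
          erule Af, erule Af, rule resolves_ker[OF R])
  qed (auto simp: A d0)
  moreover have "lookup (A i $$ (a, b)) 0 = 0" if "a < length (d i)" "b < length (d (Suc i))" for i a b
    using m that basis_FM[OF that(2), of X] by (auto simp: A_def minimal_def)
  ultimately show ?thesis unfolding minimal_graded_free_resolution_def by blast
qed

text \<open>Generators of the quotient are classes of homogeneous polynomials, and these polynomials are the
  entries of a row \<open>p\<close>. The ideal \<open>I\<close> and the row determine the resolved submodule.\<close>

lemma matrices_to_resolution:
  assumes R: "graded_free_resolution X (quotient_module X I) d A g"
  shows "\<exists>p f. gmap X (d 0) [0] p \<and> resolves X d f {v \<in> FM X (d 0). p v \<in> cyc ` I} \<and>
     (\<exists>w\<in>FM X (d 0). cyc 1 - p w \<in> cyc ` I) \<and>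
     (\<forall>i. \<forall>b<length (d (Suc i)). f i (single b 1) = fvec_of (col (A i) b))"
proof -
  let ?M = "quotient_module X I"
  have A: "A i \<in> carrier_mat (length (d i)) (length (d (Suc i)))" for i
    using R by (simp add: graded_free_resolution_def)
  have Ae: "A i $$ (a, b) \<in> carrier (poly_ring X)" "homogeneous (d (Suc i) ! b - d i ! a) (A i $$ (a, b))"
    if "a < length (d i)" "b < length (d (Suc i))" for i a b
    using R that by (auto simp: graded_free_resolution_def)
  have lg: "length g = length (d 0)" using R by (simp add: graded_free_resolution_def)
  have "\<exists>p. p \<in> polys X \<and> homogeneous (d 0 ! a) p \<and> g ! a = coset X I p" if "a < length (d 0)" for a
    using R that lg by (auto simp: graded_free_resolution_def quotient_module_def Let_def)
  then obtain p where p: "\<And>a. a < length (d 0) \<Longrightarrow> p a \<in> polys X \<and> homogeneous (d 0 ! a) (p a) \<and> g ! a = coset X I (p a)"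
    by metis
  define f where "f i = linear_ext (\<lambda>b. fvec_of (col (A i) b))" for i
  define P where "P = linear_ext (\<lambda>a. cyc (p a))"
  have gP: "gmap X (d 0) [0] P"
    unfolding P_def using p by (intro gmap_ext) (auto intro!: FM_single hvec_single)
  have fb: "f i (single b 1) = fvec_of (col (A i) b)" for i b by (simp add: f_def)
  have colf: "col (A i) b \<in> free_module X (length (d i))" if "b < length (d (Suc i))" for i b
    using A[of i] Ae that by (auto simp: free_module_def)
  have gf: "gmap X (d (Suc i)) (d i) (f i)" for i
    unfolding f_def using A[of i] Ae
    by (intro gmap_ext) (auto simp: hvec_def lookup_fvec_of intro!: fvec_of_FM colf)
  have aug: "augmentation ?M g v = coset X I (lookup (P (fvec_of v)) 0)" if "v \<in> free_module X (length (d 0))" for v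
  proof -
    have "lookup (P (fvec_of v)) 0 = (\<Sum>a<length (d 0). v $ a * p a)"
      using that by (subst gmap_expand[OF gP fvec_of_FM[OF that]])
        (auto simp: lookup_sum P_def lookup_smul lookup_fvec_of free_module_def intro!: sum.cong)
    then show ?thesis
      using augmentation_coset[of g p v] p lg that by simp
  qed
  have Pcyc: "P v = cyc (lookup (P v) 0)" if "v \<in> FM X (d 0)" for v
    using gmap_FM[OF gP that] unfolding FM_cyclic by auto
  have Pmem: "P v \<in> cyc ` I \<longleftrightarrow> lookup (P v) 0 \<in> I" if "v \<in> FM X (d 0)" for v
    by (subst Pcyc[OF that]) (rule cyc_mem_image)
  have eq: "fvec_of (A i *\<^sub>v w) = f i (fvec_of w)" if "w \<in> free_module X (length (d (Suc i)))" for w i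
    by (rule fvec_of_mult_mat_vec[OF A _ gmap_lin[OF gf] fb]) (use that in \<open>auto simp: free_module_def\<close>)
  have "f 0 ` FM X (d (Suc 0)) = fvec_of ` (\<lambda>w. A 0 *\<^sub>v w) ` free_module X (length (d (Suc 0)))"
    unfolding FM_eq_fvec_of_image image_image by (intro image_cong refl eq[symmetric])
  also have "(\<lambda>w. A 0 *\<^sub>v w) ` free_module X (length (d (Suc 0))) = {v \<in> free_module X (length (d 0)). augmentation ?M g v = \<zero>\<^bsub>?M\<^esub>}"
    using R by (simp add: graded_free_resolution_def)
  also have "\<dots> = {v \<in> free_module X (length (d 0)). P (fvec_of v) \<in> cyc ` I}"
    by (intro Collect_cong conj_cong refl) (simp add: aug zero_quotient_module coset_eq_iff[OF I] Pmem[OF fvec_of_FM])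
  also have "fvec_of ` \<dots> = {v \<in> FM X (d 0). P v \<in> cyc ` I}"
    unfolding FM_eq_fvec_of_image by auto
  finally have im: "f 0 ` FM X (d (Suc 0)) = {v \<in> FM X (d 0). P v \<in> cyc ` I}" .
  have ker: "{v \<in> FM X (d (Suc i)). f i v = 0} = f (Suc i) ` FM X (d (Suc (Suc i)))" for i
    by (rule iffD1[OF exact_transfer[OF A gf fb A gf fb]])
      (use R in \<open>simp add: graded_free_resolution_def\<close>)
  have "coset X I 1 \<in> carrier ?M" by (auto simp: carrier_quotient_module)
  then have "coset X I 1 \<in> augmentation ?M g ` free_module X (length (d 0))"
    using R by (simp add: graded_free_resolution_def)
  then obtain v where v: "v \<in> free_module X (length (d 0))" "coset X I 1 = augmentation ?M g v" by blast
  have "1 - lookup (P (fvec_of v)) 0 \<in> I"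
    using v(2) unfolding aug[OF v(1)] coset_eq_iff[OF I] .
  then have "cyc 1 - P (fvec_of v) \<in> cyc ` I"
    by (subst Pcyc[OF fvec_of_FM[OF v(1)]]) (auto simp: single_diff[symmetric] cyc_mem_image simp del: single_one)
  moreover have "resolves X d f {v \<in> FM X (d 0). P v \<in> cyc ` I}"
    unfolding resolves_def using gf im ker by simp
  ultimately show ?thesis
    using gP fb fvec_of_FM[OF v(1)] by (intro exI[of _ P] exI[of _ f] conjI bexI[of _ "fvec_of v"] allI impI)
qed

text \<open>In the top step of the given resolution, a basis vector that attains the bound meets no constants:
  its row is empty, and its degree exceeds those in the step below.\<close>

theorem regularity_from_resolution:
  assumes R: "resolves X d f (cyc ` I)" and d0: "d 0 = [0]"
    and I0: "\<And>p. p \<in> I \<Longrightarrow> lookup p 0 = 0"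
    and bound: "\<And>i j. j \<in> set (d i) \<Longrightarrow> j \<le> int i + int m"
    and top: "d (Suc q) = []" "int q + int m \<in> set (d q)"
  shows "regularity X (quotient_module X I) = ereal (real m)"
proof -
  let ?M = "quotient_module X I"
  have zI: "0 \<in> I" using additive_subgroup.zero_closed[OF ideal.axioms(1)[OF I]] by simp
  obtain e h where e: "e 0 = [0]" "resolves X e h (cyc ` I)" "minimal X e h"
  proof -
    have "const_coeff v a = 0" if "v \<in> cyc ` I" for v a
      using that I0 by (auto simp: lookup_single when_def)
    then show ?thesis using minimal_resolution_exists[OF R] that by (auto simp: d0)
  qed
  \<comment> \<open>The Betti numbers come from an arbitrary choice, of which only minimality is known.\<close>
  define D where "D = (SOME d. \<exists>A g. minimal_graded_free_resolution X ?M d A g)"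
  have "\<exists>A g. minimal_graded_free_resolution X ?M D A g"
    unfolding D_def
    using resolution_to_matrices[OF e(2,1,3)]
    by (intro someI_ex[where P = "\<lambda>d. \<exists>A g. minimal_graded_free_resolution X ?M d A g"]) blast
  then obtain A g where A: "minimal_graded_free_resolution X ?M D A g" by blast
  then obtain p F where p: "gmap X (D 0) [0] p" and F: "resolves X D F {v \<in> FM X (D 0). p v \<in> cyc ` I}"
    and w: "\<exists>w\<in>FM X (D 0). cyc 1 - p w \<in> cyc ` I"
    and FA: "\<And>i b. b < length (D (Suc i)) \<Longrightarrow> F i (single b 1) = fvec_of (col (A i) b)"
    using matrices_to_resolution[of D A g] unfolding minimal_graded_free_resolution_def by blast
  \<comment> \<open>A homogeneous \<open>u\<close> with \<open>p u \<equiv> 1\<close> modulo \<open>I\<close> yields an inverse \<open>U\<close> of \<open>p\<close> on the quotients.\<close>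
  let ?N = "{v \<in> FM X (D 0). p v \<in> cyc ` I}"
  let ?c = "D 0 @ d (Suc 0)"
  let ?h = "\<lambda>v. p (trunc (length (D 0)) v) + f 0 (unshift (length (D 0)) v)"
  have f0: "gmap X (d (Suc 0)) [0] (f 0)" using resolves_gmap[OF R, of 0] d0 by simp
  have gh: "gmap X ?c [0] ?h"
    by (rule gmap_add[OF gmap_comp[OF p gmap_trunc] gmap_comp[OF f0 gmap_unshift]])
  obtain w0 where w0: "w0 \<in> FM X (D 0)" "cyc 1 - p w0 \<in> cyc ` I" using w by blast
  then obtain y where y: "y \<in> FM X (d (Suc 0))" "cyc 1 - p w0 = f 0 y" using resolves_im[OF R] by blast
  have "cyc 1 = ?h (w0 + shift (length (D 0)) y)"
    using y by (simp add: trunc_sum[OF w0(1)] unshift_sum[OF w0(1)] algebra_simps)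
  then have "cyc 1 \<in> ?h ` FM X ?c" using FM_append_I[OF w0(1) y(1)] by blast
  moreover have "hvec [0] 0 (cyc 1)" by (simp add: hvec_def)
  ultimately obtain x where x: "x \<in> FM X ?c" "hvec ?c 0 x" "?h x = cyc 1"
    using homogeneous_preimage[OF gh] by blast
  define u where "u = trunc (length (D 0)) x"
  have u: "u \<in> FM X (D 0)" "hvec (D 0) 0 u"
    unfolding u_def using gmap_FM[OF gmap_trunc x(1)] gmap_hvec[OF gmap_trunc x(1,2)] by auto
  have "cyc 1 - p u = f 0 (unshift (length (D 0)) x)" unfolding x(3)[symmetric] u_def by simp
  then have pu: "cyc 1 - p u \<in> cyc ` I"
    using gmap_FM[OF gmap_unshift x(1)] resolves_im[OF R] by auto
  define U where "U = linear_ext (\<lambda>_. u)"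
  have gU: "gmap X [0] (D 0) U" unfolding U_def using u by (intro gmap_ext) auto
  have Uc: "U (cyc q) = q \<star> u" for q by (simp add: U_def)
  interpret ideal I "poly_ring X" by (fact I)
  have Imult: "a * i \<in> I" if "i \<in> I" "a \<in> polys X" for a i using I_l_closed[OF that] by simp
  obtain i0 where i0: "i0 \<in> I" "cyc 1 - p u = cyc i0" using pu by blast
  have IX: "i \<in> polys X" if "i \<in> I" for i using that a_subset by auto
  have pU: "cyc q - p (U (cyc q)) = cyc (q * i0)" for q
  proof -
    have "cyc q - p (U (cyc q)) = q \<star> (cyc 1 - p u)"
    proof -
      have "p (U (cyc q)) = q \<star> p u" by (simp only: Uc lin_smul[OF gmap_lin[OF p]])
      moreover have "cyc q = q \<star> (cyc 1 - p u) + q \<star> p u"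
        by (simp add: smul_add[symmetric] del: single_one)
      ultimately show ?thesis by (metis add_diff_cancel_right')
    qed
    then show ?thesis using i0 by simp
  qed
  have FN: "v \<in> cyc ` I \<Longrightarrow> U v \<in> ?N" for v
  proof -
    assume "v \<in> cyc ` I"
    then obtain i where i: "i \<in> I" "v = cyc i" by blast
    have "p (U v) = cyc (i - i * i0)"
      using pU[of i] i by (simp add: single_diff algebra_simps)
    moreover have "i - i * i0 = (1 - i0) * i" by (simp add: algebra_simps)
    moreover have "(1 - i0) * i \<in> I" using IX[OF i0(1)] by (intro Imult[OF i(1)] polys_diff polys_one)
    moreover have "U v \<in> FM X (D 0)"
      using gmap_FM[OF gU, of v] i IX by (auto simp: FM_cyclic)
    ultimately show "U v \<in> ?N" by simp
  qed
  have l1: "link X (D 0) ?N (d 0) (cyc ` I) U p (\<lambda>v. 0)"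
    unfolding link_def d0
  proof (intro conjI ballI)
    fix v :: "('x, 'k) fvec" assume v: "v \<in> FM X (D 0)"
    obtain q where q: "q \<in> polys X" "p v = cyc q" using gmap_FM[OF p v] by (auto simp: FM_cyclic)
    have "p (v - U (p v) - 0) = cyc (q * i0)"
      using pU[of q] q by (simp add: lin_diff[OF gmap_lin[OF p]])
    moreover have "U (p v) \<in> FM X (D 0)" using gmap_FM[OF gU gmap_FM[OF p v]] .
    ultimately show "v - U (p v) - 0 \<in> ?N" using Imult[OF i0(1) q(1)] v by auto
  qed (use gU p FN gmap_zero in auto)
  have l2: "link X (d 0) (cyc ` I) (D 0) ?N p U (\<lambda>v. 0)"
    unfolding link_def d0
  proof (intro conjI ballI)
    fix v :: "('x, 'k) fvec" assume "v \<in> FM X [0]"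
    then obtain q where q: "q \<in> polys X" "v = cyc q" by (auto simp: FM_cyclic)
    then show "v - p (U v) - 0 \<in> cyc ` I" using pU[of q] Imult[OF i0(1) q(1)] by auto
  qed (use gU p FN gmap_zero in auto)
  have Fc: "const_coeff (F i (single b 1)) a = 0" if "b < length (D (Suc i))" for i a b
  proof -
    have "A i \<in> carrier_mat (length (D i)) (length (D (Suc i)))"
      and "a < length (D i) \<longrightarrow> lookup (A i $$ (a, b)) 0 = 0"
      using A that by (simp_all add: minimal_graded_free_resolution_def graded_free_resolution_def)
    then show ?thesis using that by (auto simp: FA[OF that] lookup_fvec_of)
  qed
  have up: "D i ! a \<in> set (d i)" if "a < length (D i)" for i a
    using that by (intro generator_persists[OF F R l1]) (auto intro: Fc)
  obtain a where a: "a < length (d q)" "d q ! a = int q + int m" using top(2) by (auto simp: in_set_conv_nth)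
  have "d q ! a \<in> set (D q)"
  proof (rule generator_persists[OF R F l2 a(1)])
    fix k b assume k: "q = Suc k"
    show "const_coeff (f k (single a 1)) b = 0"
    proof (rule ccontr)
      assume nz: "const_coeff (f k (single a 1)) b \<noteq> 0"
      have g: "f k (single a 1) \<in> FM X (d k)" "hvec (d k) (d q ! a) (f k (single a 1))"
        using resolves_gmap[OF R, of k] a(1) k by (auto simp: gmap_def)
      have b: "b < length (d k)" using nz g(1) by (cases "b < length (d k)") (auto simp: FM_iff)
      have "d k ! b = d q ! a" using basis_const[OF g b nz] .
      then show False using bound[OF nth_mem[OF b]] a(2) k by simp
    qed
  qed (simp add: top(1))
  then have low: "int q + int m \<in> set (D q)" using a(2) by simp
  have b: "graded_betti X ?M i j \<noteq> 0 \<longleftrightarrow> j \<in> set (D i)" for i j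
    by (simp add: graded_betti_def D_def[symmetric] count_list_0_iff)
  have "real_of_int (j - int i) \<le> real m" if "j \<in> set (D i)" for i j
  proof -
    have "j \<in> set (d i)" using that up by (auto simp: in_set_conv_nth)
    from bound[OF this] show ?thesis by linarith
  qed
  then show ?thesis
    unfolding regularity_def b
    by (intro antisym SUP_least SUP_upper2[of "(q, int q + int m)"]) (auto simp: low)
qed

end

section \<open>Mapping cones between cyclic modules\<close>

lemma
  assumes "ideal I (poly_ring X :: ('x, 'k::field) mpoly ring)"
  shows poly_ideal_zero: "0 \<in> I"
    and poly_ideal_add: "p \<in> I \<Longrightarrow> q \<in> I \<Longrightarrow> p + q \<in> I"
    and poly_ideal_mult: "p \<in> I \<Longrightarrow> q \<in> polys X \<Longrightarrow> q * p \<in> I"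
    and poly_ideal_polys: "p \<in> I \<Longrightarrow> p \<in> polys X"
    and poly_ideal_uminus: "p \<in> I \<Longrightarrow> - p \<in> I"
    and poly_ideal_diff: "p \<in> I \<Longrightarrow> q \<in> I \<Longrightarrow> p - q \<in> I"
proof -
  interpret ideal I "poly_ring X" by fact
  show "0 \<in> I" using additive_subgroup.zero_closed[OF ideal.axioms(1)[OF assms]] by simp
  show add: "p + q \<in> I" if "p \<in> I" "q \<in> I" for p q
    using additive_subgroup.a_closed[OF ideal.axioms(1)[OF assms] that] by simp
  show mult: "q * p \<in> I" if "p \<in> I" "q \<in> polys X" for p q
    using I_l_closed[OF that] by simp
  show "p \<in> I \<Longrightarrow> p \<in> polys X" using a_subset by auto
  show um: "- p \<in> I" if "p \<in> I" for p
  proof -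
    have "- 1 \<in> polys X" by (rule polys_uminus[OF polys_one])
    from mult[OF that this] show ?thesis by simp
  qed
  show "p - q \<in> I" if "p \<in> I" "q \<in> I" for p q
    using add[OF that(1) um[OF that(2)]] by simp
qed

lemma poly_idealI:
  assumes "I \<subseteq> polys X" "0 \<in> I" "\<And>p q. p \<in> I \<Longrightarrow> q \<in> I \<Longrightarrow> p + q \<in> I"
    "\<And>p q. p \<in> I \<Longrightarrow> q \<in> polys X \<Longrightarrow> q * p \<in> I"
  shows "ideal I (poly_ring X :: ('x, 'k::field) mpoly ring)"
proof (rule idealI)
  interpret cring "poly_ring X :: ('x, 'k) mpoly ring" by (rule cring_poly_ring)
  show "ring (poly_ring X :: ('x, 'k) mpoly ring)" by (rule ring_axioms)
  have um: "- p \<in> I" if "p \<in> I" for p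
  proof -
    have "- 1 \<in> polys X" by (rule polys_uminus[OF polys_one])
    from assms(4)[OF that this] show ?thesis by simp
  qed
  have "\<ominus>\<^bsub>poly_ring X\<^esub> p = - p" if "p \<in> polys X" for p :: "('x, 'k) mpoly"
    using that by (intro minus_equality) auto
  then show "subgroup I (add_monoid (poly_ring X))"
    using assms um by (intro add.subgroupI) (auto simp: a_inv_def[symmetric])
  show "x \<otimes>\<^bsub>poly_ring X\<^esub> a \<in> I" "a \<otimes>\<^bsub>poly_ring X\<^esub> x \<in> I" if "a \<in> I" "x \<in> polys X" for a x
    using assms(4)[OF that] by (simp_all add: mult.commute)
qed

definition ideal_insert :: "'x set \<Rightarrow> ('x, 'k::field) mpoly \<Rightarrow> ('x, 'k) mpoly set \<Rightarrow> ('x, 'k) mpoly set" where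
  "ideal_insert X g I = {u + g * p | u p. u \<in> I \<and> p \<in> polys X}"

lemma ideal_insertI: "u \<in> I \<Longrightarrow> p \<in> polys X \<Longrightarrow> u + g * p \<in> ideal_insert X g I"
  by (auto simp: ideal_insert_def)

lemma ideal_insertE:
  assumes "x \<in> ideal_insert X g I"
  obtains u p where "u \<in> I" "p \<in> polys X" "x = u + g * p"
  using assms by (auto simp: ideal_insert_def)

lemma ideal_insert2E:
  assumes "x \<in> ideal_insert X h (ideal_insert X g I)"
  obtains u p q where "u \<in> I" "p \<in> polys X" "q \<in> polys X" "x = u + g * p + h * q"
  using assms by (metis ideal_insertE)

lemma ideal_ideal_insert:
  assumes I: "ideal I (poly_ring X :: ('x, 'k::field) mpoly ring)" and g: "g \<in> polys X"
  shows "ideal (ideal_insert X g I) (poly_ring X)"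
proof (rule poly_idealI)
  show "ideal_insert X g I \<subseteq> polys X"
    using g poly_ideal_polys[OF I] by (auto simp: ideal_insert_def)
  show "0 \<in> ideal_insert X g I"
    using ideal_insertI[OF poly_ideal_zero[OF I] polys_zero, of g] by simp
  show "p + q \<in> ideal_insert X g I" if p: "p \<in> ideal_insert X g I" and q: "q \<in> ideal_insert X g I" for p q
  proof -
    obtain u p' where u: "p = u + g * p'" "u \<in> I" "p' \<in> polys X" using p by (auto simp: ideal_insert_def)
    obtain v q' where v: "q = v + g * q'" "v \<in> I" "q' \<in> polys X" using q by (auto simp: ideal_insert_def)
    have "p + q = (u + v) + g * (p' + q')" using u v by (simp add: algebra_simps)
    then show ?thesis using ideal_insertI[OF poly_ideal_add[OF I u(2) v(2)] polys_add[OF u(3) v(3)]] by simp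
  qed
  show "q * p \<in> ideal_insert X g I" if p: "p \<in> ideal_insert X g I" and q: "q \<in> polys X" for p q
  proof -
    obtain u p' where u: "p = u + g * p'" "u \<in> I" "p' \<in> polys X" using p by (auto simp: ideal_insert_def)
    have "q * p = q * u + g * (q * p')" using u by (simp add: algebra_simps)
    then show ?thesis using ideal_insertI[OF poly_ideal_mult[OF I u(2) q] polys_mult[OF q u(3)]] by simp
  qed
qed

lemma gmap_twist: "gmap X (map ((+) s) e) (map ((+) s) e') g \<longleftrightarrow> gmap X e e' g"
proof -
  have "FM X (map ((+) s) e) = FM X e" for e by (rule FM_length_cong) simp
  then show ?thesis by (auto simp: gmap_def hvec_def)
qed

lemma FM_twist: "FM X (map ((+) s) e) = FM X e"
  by (rule FM_length_cong) simp

text \<open>The cone of multiplication by a nonzerodivisor \<open>g\<close> of \<open>S/I\<close>.\<close>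

lemma cone_nonzerodivisor:
  assumes R: "resolves X d f (cyc ` I)" and d0: "d 0 = [0]"
    and g: "g \<in> polys X" "homogeneous s g"
    and nzd: "\<And>p. p \<in> polys X \<Longrightarrow> g * p \<in> I \<longleftrightarrow> p \<in> I"
  shows "\<exists>h. resolves X (\<lambda>i. d i @ (case i of 0 \<Rightarrow> [] | Suc k \<Rightarrow> map ((+) s) (d k))) h (cyc ` ideal_insert X g I)"
proof -
  let ?phi = "linear_ext (\<lambda>_. cyc g)"
  have "\<exists>h. resolves X (\<lambda>i. d i @ (case i of 0 \<Rightarrow> [] | Suc k \<Rightarrow> map ((+) s) (d k))) h
           {u + ?phi v | u v. u \<in> cyc ` I \<and> v \<in> FM X (map ((+) s) (d 0))}"
  proof (rule mapping_cone[OF resolves_twist[OF R] R])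
    show "gmap X (map ((+) s) (d 0)) (d 0) ?phi"
      using g by (intro gmap_ext) (auto simp: d0 intro!: FM_single hvec_single)
    show "?phi v \<in> cyc ` I \<longleftrightarrow> v \<in> cyc ` I" if vm: "v \<in> FM X (map ((+) s) (d 0))" for v
    proof -
      obtain p where p: "p \<in> polys X" "v = cyc p" using vm unfolding FM_twist d0 FM_cyclic by blast
      then have "?phi v = cyc (g * p)" by (simp add: mult.commute)
      then show ?thesis using nzd[OF p(1)] p(2) by (simp only: cyc_mem_image)
    qed
  qed
  moreover have "{u + ?phi v | u v. u \<in> cyc ` I \<and> v \<in> FM X (map ((+) s) (d 0))} = cyc ` ideal_insert X g I"
  proof (intro equalityI subsetI)
    fix x assume "x \<in> {u + ?phi v | u v. u \<in> cyc ` I \<and> v \<in> FM X (map ((+) s) (d 0))}"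
    then obtain y v where y: "y \<in> cyc ` I" "v \<in> cyc ` polys X" "x = y + ?phi v"
      unfolding FM_twist d0 FM_cyclic by blast
    then obtain u p where p: "u \<in> I" "p \<in> polys X" "x = cyc u + ?phi (cyc p)" by blast
    then have "x = cyc (u + g * p)" by (simp add: single_add mult.commute)
    then show "x \<in> cyc ` ideal_insert X g I" using ideal_insertI[OF p(1,2)] by (rule image_eqI)
  next
    fix x assume "x \<in> cyc ` ideal_insert X g I"
    then obtain z where z: "z \<in> ideal_insert X g I" "x = cyc z" by blast
    obtain u p where p: "u \<in> I" "p \<in> polys X" and zp: "z = u + g * p"
      using z(1) by (rule ideal_insertE)
    have "x = cyc u + ?phi (cyc p)" unfolding z(2) zp by (simp add: single_add mult.commute)
    then show "x \<in> {u + ?phi v | u v. u \<in> cyc ` I \<and> v \<in> FM X (map ((+) s) (d 0))}"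
      unfolding FM_twist d0 FM_cyclic using p by blast
  qed
  ultimately show ?thesis by simp
qed

definition pair_row :: "('x, 'k::field) mpoly \<Rightarrow> ('x, 'k) mpoly \<Rightarrow> ('x, 'k) fvec \<Rightarrow> ('x, 'k) fvec" where
  "pair_row p q = linear_ext (\<lambda>a. cyc (if a = 0 then p else q))"

lemma gmap_pair_row:
  "p \<in> polys X \<Longrightarrow> q \<in> polys X \<Longrightarrow> homogeneous s p \<Longrightarrow> homogeneous s q \<Longrightarrow> gmap X [s, s] [0] (pair_row p q)"
  unfolding pair_row_def by (intro gmap_ext) (auto simp: less_Suc_eq intro!: FM_single hvec_single)

lemma pair_row_FM:
  assumes "v \<in> FM X [i, j]"
  shows "pair_row p q v = cyc (p * lookup v 0 + q * lookup v 1)"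
proof -
  have "keys v \<subseteq> {0, 1}" using assms by (auto simp: FM_def less_Suc_eq)
  then have "pair_row p q v = (\<Sum>a\<in>{0, 1}. lookup v a \<star> cyc (if a = 0 then p else q))"
    unfolding pair_row_def by (intro ext_superset) auto
  then show ?thesis by (simp add: single_add[symmetric] mult.commute)
qed

lemma pair_FM:
  assumes "p \<in> polys X" "q \<in> polys X"
  shows "single 0 p + single 1 q \<in> FM X [i, j]"
  using assms by (auto intro!: FM_add FM_single)

text \<open>The ideals \<open>(q\<^sub>1, q\<^sub>2)\<close> and \<open>(b\<^sub>1, b\<^sub>2)\<close> of \<open>S/I\<close> are isomorphic by \<open>q\<^sub>i \<mapsto> b\<^sub>i\<close>. The second one is
  \<open>J/I\<close>, which the cone of a lift of \<open>I \<subseteq> J\<close> resolves; a second cone, of its embedding as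
  \<open>(q\<^sub>1, q\<^sub>2)\<close>, resolves \<open>S/(I + (q\<^sub>1, q\<^sub>2))\<close>.\<close>

lemma cone_isomorphic_pair:
  assumes G: "resolves X dG g (cyc ` I)" and dG0: "dG 0 = [0]"
    and Q: "resolves X dQ q (cyc ` J)" and dQ0: "dQ 0 = [0]"
    and I: "ideal I (poly_ring X)"
    and J: "J = ideal_insert X b2 (ideal_insert X b1 I)"
    and b: "b1 \<in> polys X" "b2 \<in> polys X" "homogeneous 1 b1" "homogeneous 1 b2"
    and q: "q1 \<in> polys X" "q2 \<in> polys X" "homogeneous 2 q1" "homogeneous 2 q2"
    and iso: "\<And>p1 p2. p1 \<in> polys X \<Longrightarrow> p2 \<in> polys X \<Longrightarrow> q1 * p1 + q2 * p2 \<in> I \<longleftrightarrow> b1 * p1 + b2 * p2 \<in> I"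
  shows "\<exists>h. resolves X (\<lambda>i. dG i @ (case i of 0 \<Rightarrow> [] | Suc k \<Rightarrow>
            map ((+) 1) (dQ (Suc k) @ (case k of 0 \<Rightarrow> [] | Suc k' \<Rightarrow> dG (Suc k'))))) h
          (cyc ` ideal_insert X q2 (ideal_insert X q1 I))"
proof -
  have g0: "gmap X (dG (Suc 0)) [0] (g 0)" using resolves_gmap[OF G, of 0] dG0 by simp
  have q0: "gmap X (dQ (Suc 0)) [0] (q 0)" using resolves_gmap[OF Q, of 0] dQ0 by simp
  have IJ: "u + b1 * p1 + b2 * p2 \<in> J" if "u \<in> I" "p1 \<in> polys X" "p2 \<in> polys X" for u p1 p2
    unfolding J using that by (intro ideal_insertI)
  have sub: "I \<subseteq> J"
  proof
    fix u assume "u \<in> I"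
    from IJ[OF this polys_zero polys_zero] show "u \<in> J" by simp
  qed
  obtain \<phi> where phi: "gmap X (dG (Suc 0)) (dQ (Suc 0)) \<phi>" "\<And>v. v \<in> FM X (dG (Suc 0)) \<Longrightarrow> q 0 (\<phi> v) = g 0 v"
  proof -
    have "g 0 v \<in> q 0 ` FM X (dQ (Suc 0))" if "v \<in> FM X (dG (Suc 0))" for v
      unfolding resolves_im[OF Q] using that resolves_im[OF G] sub by blast
    then show ?thesis using gmap_lift[OF q0 g0] that by blast
  qed
  let ?ker = "{w \<in> FM X (dQ (Suc 0)). q 0 w \<in> cyc ` I}"
  let ?dJ = "\<lambda>k. dQ (Suc k) @ (case k of 0 \<Rightarrow> [] | Suc k' \<Rightarrow> dG (Suc k'))"
  have "\<exists>j. resolves X ?dJ j {u + \<phi> v | u v. u \<in> {v \<in> FM X (dQ (Suc 0)). q 0 v = 0} \<and> v \<in> FM X (dG (Suc 0))}"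
  proof (rule mapping_cone[OF resolves_tail[OF G] resolves_tail[OF Q] phi(1)])
    show "\<phi> v \<in> {v \<in> FM X (dQ (Suc 0)). q 0 v = 0} \<longleftrightarrow> v \<in> {v \<in> FM X (dG (Suc 0)). g 0 v = 0}"
      if "v \<in> FM X (dG (Suc 0))" for v
      using that phi(2)[OF that] gmap_FM[OF phi(1) that] by simp
  qed
  moreover have "{u + \<phi> v | u v. u \<in> {v \<in> FM X (dQ (Suc 0)). q 0 v = 0} \<and> v \<in> FM X (dG (Suc 0))} = ?ker"
  proof (intro equalityI subsetI)
    fix x assume "x \<in> {u + \<phi> v | u v. u \<in> {v \<in> FM X (dQ (Suc 0)). q 0 v = 0} \<and> v \<in> FM X (dG (Suc 0))}"
    then obtain u v where x: "x = u + \<phi> v" "u \<in> FM X (dQ (Suc 0))" "q 0 u = 0" "v \<in> FM X (dG (Suc 0))" by blast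
    then have "q 0 x = g 0 v" using phi(2) by (simp add: lin_add[OF gmap_lin[OF q0]])
    then show "x \<in> ?ker"
      using x gmap_FM[OF phi(1) x(4)] resolves_im[OF G] by auto
  next
    fix x assume x: "x \<in> ?ker"
    then obtain v where v: "v \<in> FM X (dG (Suc 0))" "q 0 x = g 0 v" using resolves_im[OF G] by blast
    have "q 0 (x - \<phi> v) = 0" using phi(2)[OF v(1)] v by (simp add: lin_diff[OF gmap_lin[OF q0]])
    moreover have "x - \<phi> v \<in> FM X (dQ (Suc 0))" using x gmap_FM[OF phi(1) v(1)] by auto
    moreover have "x = (x - \<phi> v) + \<phi> v" by simp
    ultimately show "x \<in> {u + \<phi> v | u v. u \<in> {v \<in> FM X (dQ (Suc 0)). q 0 v = 0} \<and> v \<in> FM X (dG (Suc 0))}"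
      using v(1) by blast
  qed
  ultimately obtain j where j: "resolves X ?dJ j ?ker" by auto
  let ?b = "pair_row b1 b2" and ?q = "pair_row q1 q2"
  let ?c = "[1, 1] @ dG (Suc 0)"
  let ?H = "\<lambda>v. ?b (trunc (length [1, 1 :: int]) v) + g 0 (unshift (length [1, 1 :: int]) v)"
  have gb: "gmap X [1, 1] [0] ?b" and gq: "gmap X [2, 2] [0] ?q"
    using b q by (auto intro: gmap_pair_row)
  have gH: "gmap X ?c [0] ?H"
    by (rule gmap_add[OF gmap_comp[OF gb gmap_trunc] gmap_comp[OF g0 gmap_unshift]])
  have "q 0 v \<in> ?H ` FM X ?c" if v: "v \<in> FM X (dQ (Suc 0))" for v
  proof -
    have "q 0 v \<in> cyc ` J" using resolves_im[OF Q] v by blast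
    then obtain z where z: "z \<in> J" "q 0 v = cyc z" by blast
    obtain u p1 p2 where p: "u \<in> I" "p1 \<in> polys X" "p2 \<in> polys X" and zp: "z = u + b1 * p1 + b2 * p2"
      using z(1)[unfolded J] by (rule ideal_insert2E)
    have "cyc u \<in> g 0 ` FM X (dG (Suc 0))"
      unfolding resolves_im[OF G] using p(1) by (rule imageI)
    then obtain y where y: "y \<in> FM X (dG (Suc 0))" "g 0 y = cyc u" by (metis imageE)
    let ?u = "single 0 p1 + single 1 p2"
    have u: "?u \<in> FM X [1, 1]" using p by (intro pair_FM)
    have "?H (?u + shift (length [1, 1 :: int]) y) = q 0 v"
      unfolding trunc_sum[OF u] unshift_sum[OF u] pair_row_FM[OF u] y(2) z(2) zp
      by (simp add: lookup_add lookup_single single_add add_ac)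
    from this[symmetric] show ?thesis by (rule image_eqI) (rule FM_append_I[OF u y(1)])
  qed
  then obtain L where L: "gmap X (dQ (Suc 0)) ?c L" "\<And>v. v \<in> FM X (dQ (Suc 0)) \<Longrightarrow> ?H (L v) = q 0 v"
    using gmap_lift[OF gH q0] by blast
  \<comment> \<open>\<open>P\<close> writes a generator of \<open>J\<close> as a combination of \<open>b1\<close> and \<open>b2\<close> modulo \<open>I\<close>.\<close>
  define P where "P v = trunc (length [1, 1 :: int]) (L v)" for v
  have gP: "gmap X (dQ (Suc 0)) [1, 1] P"
    unfolding P_def by (rule gmap_comp[OF gmap_trunc L(1)])
  define \<iota> where "\<iota> v = ?q (P v)" for v
  have g\<iota>: "gmap X (map ((+) 1) (dQ (Suc 0))) [0] \<iota>"
    unfolding \<iota>_def using gmap_comp[OF gq, of "map ((+) 1) (dQ (Suc 0))" P] gmap_twist[of X 1 "dQ (Suc 0)" "[1, 1]" P] gP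
    by simp
  have cI: "x + y \<in> cyc ` I" "x - y \<in> cyc ` I" if "x \<in> cyc ` I" "y \<in> cyc ` I" for x y
    using that poly_ideal_add[OF I] poly_ideal_diff[OF I] by (auto simp: single_add[symmetric] single_diff[symmetric] intro!: imageI)
  have bP: "q 0 v - ?b (P v) \<in> cyc ` I" if v: "v \<in> FM X (dQ (Suc 0))" for v
  proof -
    have "q 0 v - ?b (P v) = g 0 (unshift (length [1, 1 :: int]) (L v))"
      using L(2)[OF v] unfolding P_def by (metis add_diff_cancel_left')
    moreover have "unshift (length [1, 1 :: int]) (L v) \<in> FM X (dG (Suc 0))"
      using gmap_FM[OF gmap_unshift gmap_FM[OF L(1) v]] .
    ultimately show ?thesis using resolves_im[OF G] by blast
  qed
  have bq: "?b u \<in> cyc ` I \<longleftrightarrow> ?q u \<in> cyc ` I" if u: "u \<in> FM X [1, 1]" for u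
    unfolding pair_row_FM[OF u] cyc_mem_image using iso FM_lookup[OF u] by blast
  have inj: "\<iota> v \<in> cyc ` I \<longleftrightarrow> v \<in> ?ker" if "v \<in> FM X (map ((+) 1) (dQ (Suc 0)))" for v
  proof -
    have v: "v \<in> FM X (dQ (Suc 0))" using that unfolding FM_twist .
    have "\<iota> v \<in> cyc ` I \<longleftrightarrow> ?b (P v) \<in> cyc ` I"
      unfolding \<iota>_def using bq[OF gmap_FM[OF gP v]] by simp
    also have "\<dots> \<longleftrightarrow> q 0 v \<in> cyc ` I"
      using bP[OF v] cI(1)[OF bP[OF v], of "?b (P v)"] cI(2)[OF _ bP[OF v], of "q 0 v"] by auto
    finally show ?thesis using v by simp
  qed
  have "\<exists>h. resolves X (\<lambda>i. dG i @ (case i of 0 \<Rightarrow> [] | Suc k \<Rightarrow> map ((+) 1) (?dJ k))) h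
      {u + \<iota> v | u v. u \<in> cyc ` I \<and> v \<in> FM X (map ((+) 1) (?dJ 0))}"
    using g\<iota> inj by (intro mapping_cone[OF resolves_twist[OF j] G]) (simp_all add: dG0)
  moreover have "{u + \<iota> v | u v. u \<in> cyc ` I \<and> v \<in> FM X (map ((+) 1) (?dJ 0))} = cyc ` ideal_insert X q2 (ideal_insert X q1 I)"
  proof (intro equalityI subsetI)
    fix x assume "x \<in> {u + \<iota> v | u v. u \<in> cyc ` I \<and> v \<in> FM X (map ((+) 1) (?dJ 0))}"
    then obtain u v where x: "x = cyc u + \<iota> v" "u \<in> I" "v \<in> FM X (dQ (Suc 0))" unfolding FM_twist by auto
    have Pv: "P v \<in> FM X [1, 1]" by (rule gmap_FM[OF gP x(3)])
    have "x = cyc (u + q1 * lookup (P v) 0 + q2 * lookup (P v) 1)"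
      unfolding x(1) \<iota>_def pair_row_FM[OF Pv] by (simp add: single_add add_ac)
    then show "x \<in> cyc ` ideal_insert X q2 (ideal_insert X q1 I)"
      using x(2) FM_lookup[OF Pv] by (auto intro!: imageI ideal_insertI)
  next
    fix x assume "x \<in> cyc ` ideal_insert X q2 (ideal_insert X q1 I)"
    then obtain z where z: "z \<in> ideal_insert X q2 (ideal_insert X q1 I)" "x = cyc z" by blast
    obtain u p1 p2 where p: "u \<in> I" "p1 \<in> polys X" "p2 \<in> polys X" and zp: "z = u + q1 * p1 + q2 * p2"
      using z(1) by (rule ideal_insert2E)
    let ?u = "single 0 p1 + single 1 p2"
    have u: "?u \<in> FM X [1, 1]" using p by (intro pair_FM)
    have "cyc (0 + b1 * p1 + b2 * p2) \<in> cyc ` J" using IJ[OF poly_ideal_zero[OF I] p(2,3)] by blast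
    then have "?b ?u \<in> cyc ` J" unfolding pair_row_FM[OF u] by (simp add: lookup_add lookup_single)
    then obtain v where v: "v \<in> FM X (dQ (Suc 0))" "q 0 v = ?b ?u" using resolves_im[OF Q] by (metis imageE)
    have Pv: "P v \<in> FM X [1, 1]" by (rule gmap_FM[OF gP v(1)])
    have "?b (?u - P v) \<in> cyc ` I"
      using bP[OF v(1)] v(2) by (simp add: lin_diff[OF gmap_lin[OF gb]])
    then have "?q (?u - P v) \<in> cyc ` I" using bq[of "?u - P v"] u Pv by blast
    then have "?q ?u - \<iota> v \<in> cyc ` I" by (simp add: lin_diff[OF gmap_lin[OF gq]] \<iota>_def)
    then have "cyc u + (?q ?u - \<iota> v) \<in> cyc ` I" using cI(1) p(1) by blast
    moreover have "x = (cyc u + (?q ?u - \<iota> v)) + \<iota> v"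
      unfolding z(2) zp pair_row_FM[OF u] by (simp add: lookup_add lookup_single single_add add_ac)
    ultimately have "\<exists>a v. x = a + \<iota> v \<and> a \<in> cyc ` I \<and> v \<in> FM X (dQ (Suc 0))"
      using v(1) by blast
    then show "x \<in> {u + \<iota> v | u v. u \<in> cyc ` I \<and> v \<in> FM X (map ((+) 1) (?dJ 0))}"
      unfolding FM_twist by simp
  qed
  ultimately show ?thesis by simp
qed

section \<open>Kernels of monomial maps\<close>

lemma poly_ideal_sum:
  "ideal I (poly_ring X) \<Longrightarrow> (\<And>a. a \<in> A \<Longrightarrow> f a \<in> I) \<Longrightarrow> sum f A \<in> I"
  by (induction A rule: infinite_finite_induct) (auto intro: poly_ideal_zero poly_ideal_add)

definition monomial_map :: "('a \<Rightarrow> 'b) \<Rightarrow> ('a \<Rightarrow>\<^sub>0 'k) \<Rightarrow> 'b \<Rightarrow>\<^sub>0 'k::comm_monoid_add" where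
  "monomial_map \<mu> p = (\<Sum>m\<in>keys p. single (\<mu> m) (lookup p m))"

lemma monomial_map_superset:
  "finite A \<Longrightarrow> keys p \<subseteq> A \<Longrightarrow> monomial_map \<mu> p = (\<Sum>m\<in>A. single (\<mu> m) (lookup p m))"
  unfolding monomial_map_def by (rule sum.mono_neutral_left) (auto simp: in_keys_iff)

lemma monomial_map_zero [simp]: "monomial_map \<mu> 0 = 0"
  by (simp add: monomial_map_def)

lemma monomial_map_add: "monomial_map \<mu> (p + q) = monomial_map \<mu> p + monomial_map \<mu> q"
proof -
  let ?A = "keys p \<union> keys q"
  have "keys (p + q) \<subseteq> ?A" by (rule keys_add)
  then show ?thesis
    by (simp add: monomial_map_superset[of ?A] lookup_add single_add sum.distrib)
qed

lemma monomial_map_sum: "monomial_map \<mu> (sum f A) = (\<Sum>a\<in>A. monomial_map \<mu> (f a))"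
  by (induction A rule: infinite_finite_induct) (simp_all add: monomial_map_add)

lemma monomial_map_diff: "monomial_map \<mu> (p - q) = monomial_map \<mu> p - monomial_map \<mu> (q :: 'a \<Rightarrow>\<^sub>0 'k::ab_group_add)"
  using monomial_map_add[of \<mu> "p - q" q] by (simp add: algebra_simps)

lemma monomial_map_single [simp]: "monomial_map \<mu> (single m c) = single (\<mu> m) c"
  by (simp add: monomial_map_def)

lemma monomial_map_mult:
  fixes p q :: "'a::monoid_add \<Rightarrow>\<^sub>0 'k::semiring_0" and \<mu> :: "'a \<Rightarrow> 'b::monoid_add"
  assumes \<mu>: "\<And>a b. \<mu> (a + b) = \<mu> a + \<mu> b"
  shows "monomial_map \<mu> (p * q) = monomial_map \<mu> p * monomial_map \<mu> q"
proof -
  let ?s = single and ?l = lookup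
  have "p * q = (\<Sum>a\<in>keys p. \<Sum>b\<in>keys q. ?s (a + b) (?l p a * ?l q b))"
    by (subst poly_mapping_decompose[of p], subst poly_mapping_decompose[of q])
       (simp add: sum_product mult_single)
  then show ?thesis
    by (simp add: monomial_map_sum monomial_map_def[of \<mu> p] monomial_map_def[of \<mu> q] sum_product mult_single \<mu>)
qed

definition toric :: "'e set \<Rightarrow> (('e \<Rightarrow>\<^sub>0 nat) \<Rightarrow> 'w) \<Rightarrow> ('e, 'k::field) mpoly set" where
  "toric X \<mu> = {p \<in> polys X. monomial_map \<mu> p = 0}"

lemma ideal_toric:
  fixes \<mu> :: "('e \<Rightarrow>\<^sub>0 nat) \<Rightarrow> 'w::monoid_add"
  assumes "\<And>a b. \<mu> (a + b) = \<mu> a + \<mu> b"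
  shows "ideal (toric X \<mu> :: ('e, 'k::field) mpoly set) (poly_ring X)"
  by (rule poly_idealI) (auto simp: toric_def monomial_map_add monomial_map_mult[OF assms])

lemma lookup_monomial_map:
  "lookup (monomial_map \<mu> p) w = (\<Sum>m\<in>{m \<in> keys p. \<mu> m = w}. lookup p m)"
proof -
  have "lookup (monomial_map \<mu> p) w = (\<Sum>m\<in>keys p. if \<mu> m = w then lookup p m else 0)"
    by (simp add: monomial_map_def lookup_sum lookup_single when_def)
  also have "\<dots> = (\<Sum>m\<in>{m \<in> keys p. \<mu> m = w}. lookup p m)"
    by (rule sum.inter_filter[symmetric]) simp
  finally show ?thesis .
qed

lemma toric_constant_term:
  assumes "p \<in> toric X \<mu>" "\<And>m. \<mu> m = \<mu> 0 \<Longrightarrow> m = 0"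
  shows "lookup p 0 = 0"
proof (rule ccontr)
  assume nz: "lookup p 0 \<noteq> 0"
  then have "{m \<in> keys p. \<mu> m = \<mu> 0} = {0}"
    using assms(2) by (auto simp: in_keys_iff)
  then have "lookup (monomial_map \<mu> p) (\<mu> 0) = lookup p 0"
    by (simp add: lookup_monomial_map)
  then show False using assms(1) nz by (simp add: toric_def)
qed

lemma toric_part:
  assumes p: "p \<in> toric X \<mu>" and Q: "\<And>m m'. \<mu> m = \<mu> m' \<Longrightarrow> Q m \<longleftrightarrow> Q m'"
  shows "part Q p \<in> toric X \<mu>"
proof -
  have "lookup (monomial_map \<mu> (part Q p)) w = 0" for w
  proof (cases "\<exists>m. \<mu> m = w \<and> Q m")
    case True
    then obtain m0 where m0: "\<mu> m0 = w" "Q m0" by blast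
    have Qm: "Q m" if "\<mu> m = w" for m
      using Q[of m m0] m0 that by simp
    have *: "{m \<in> keys (part Q p). \<mu> m = w} = {m \<in> keys p. \<mu> m = w}"
      by (auto simp: keys_part Qm)
    have "lookup (monomial_map \<mu> (part Q p)) w = lookup (monomial_map \<mu> p) w"
      unfolding lookup_monomial_map * by (rule sum.cong) (simp_all add: lookup_part Qm)
    then show ?thesis using p by (simp add: toric_def)
  next
    case False
    then have *: "{m \<in> keys (part Q p). \<mu> m = w} = {}"
      by (auto simp: keys_part)
    show ?thesis unfolding lookup_monomial_map * by simp
  qed
  then have "monomial_map \<mu> (part Q p) = 0" by (intro poly_mapping_eqI) simp
  then show ?thesis using p by (auto simp: toric_def)
qed

lemma single_sum: "single w (sum f A) = (\<Sum>a\<in>A. single w (f a))"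
  by (induction A rule: infinite_finite_induct) (simp_all add: single_add)

text \<open>Replacing each term of an element \<open>p\<close> of the kernel by a representative of its fibre makes \<open>p\<close>
  zero. So the kernel is spanned by binomials.\<close>

lemma toric_subset_ideal:
  fixes I :: "('e, 'k::field) mpoly set"
  assumes I: "ideal I (poly_ring X)"
    and bin: "\<And>m m'. keys m \<subseteq> X \<Longrightarrow> keys m' \<subseteq> X \<Longrightarrow> \<mu> m = \<mu> m' \<Longrightarrow>
      single m 1 - single m' 1 \<in> I"
  shows "toric X \<mu> \<subseteq> I"
proof
  fix p :: "('e, 'k) mpoly" assume p: "p \<in> toric X \<mu>"
  let ?K = "keys p" and ?s = single and ?l = "lookup p"
  define R where "R w = (SOME m. m \<in> ?K \<and> \<mu> m = w)" for w
  have R: "R (\<mu> m) \<in> ?K" "\<mu> (R (\<mu> m)) = \<mu> m" if "m \<in> ?K" for m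
    unfolding R_def by (rule someI2[of _ m]; use that in blast)+
  have KX: "keys m \<subseteq> X" if "m \<in> ?K" for m
    using p that by (auto simp: toric_def polys_def)
  have "(\<Sum>m\<in>?K. ?s (R (\<mu> m)) (?l m)) = (\<Sum>w\<in>\<mu> ` ?K. \<Sum>m\<in>{m\<in>?K. \<mu> m = w}. ?s (R (\<mu> m)) (?l m))"
    by (rule sum.image_gen) simp
  also have "\<dots> = (\<Sum>w\<in>\<mu> ` ?K. ?s (R w) (lookup (monomial_map \<mu> p) w))"
    by (intro sum.cong refl) (simp add: lookup_monomial_map single_sum)
  also have "\<dots> = 0" using p by (simp add: toric_def)
  finally have "p = (\<Sum>m\<in>?K. ?s m (?l m)) - (\<Sum>m\<in>?K. ?s (R (\<mu> m)) (?l m))"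
    using poly_mapping_decompose[of p] by simp
  also have "\<dots> = (\<Sum>m\<in>?K. ?s 0 (?l m) * (?s m 1 - ?s (R (\<mu> m)) 1))"
    by (simp add: sum_subtractf[symmetric] right_diff_distrib mult_single)
  also have "\<dots> \<in> I"
  proof -
    have "?s 0 (?l m) * (?s m 1 - ?s (R (\<mu> m)) 1) \<in> I" if "m \<in> ?K" for m
      using bin[OF KX[OF that] KX[OF R(1)[OF that]]] R(2)[OF that] by (intro poly_ideal_mult[OF I] polys_single) auto
    then show ?thesis by (rule poly_ideal_sum[OF I])
  qed
  finally show "p \<in> I" .
qed

section \<open>Toric kernels\<close>

text \<open>The exponent of the image of a monomial when each variable \<open>e\<close> is sent to the monomial with
  exponent \<open>\<omega> e\<close>.\<close>

definition weight :: "('e \<Rightarrow> 'v \<Rightarrow>\<^sub>0 nat) \<Rightarrow> ('e \<Rightarrow>\<^sub>0 nat) \<Rightarrow> 'v \<Rightarrow>\<^sub>0 nat" where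
  "weight \<omega> m = (\<Sum>e\<in>keys m. Poly_Mapping.map ((*) (lookup m e)) (\<omega> e))"

lemma lookup_map_times: "lookup (Poly_Mapping.map ((*) (n::nat)) w) v = n * lookup w v"
  by transfer (simp add: when_def)

lemma lookup_weight:
  "finite A \<Longrightarrow> keys m \<subseteq> A \<Longrightarrow>
    lookup (weight \<omega> m) v = (\<Sum>e\<in>A. lookup m e * lookup (\<omega> e) v)"
  unfolding weight_def lookup_sum lookup_map_times
  by (rule sum.mono_neutral_left) (auto simp: in_keys_iff)

lemma weight_add: "weight \<omega> (m + m') = weight \<omega> m + weight \<omega> m'"
proof (rule poly_mapping_eqI)
  fix v
  let ?A = "keys m \<union> keys m'"
  have "keys (m + m') \<subseteq> ?A" by (rule keys_add)
  then show "lookup (weight \<omega> (m + m')) v = lookup (weight \<omega> m + weight \<omega> m') v"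
    by (simp add: lookup_weight[of ?A] lookup_add add_mult_distrib sum.distrib)
qed

lemma weight_zero [simp]: "weight \<omega> 0 = 0"
  by (simp add: weight_def)

lemma weight_single [simp]: "weight \<omega> (single e (Suc 0)) = \<omega> e"
  by (rule poly_mapping_eqI) (simp add: weight_def lookup_map_times)

lemmas monomial_map_weight_mult = monomial_map_mult[of "weight \<omega>" for \<omega>, OF weight_add]
lemmas ideal_toric_weight = ideal_toric[of "weight \<omega>" for \<omega>, OF weight_add]

lemma polys_var [intro]: "x \<in> X \<Longrightarrow> var x \<in> polys X"
  by (auto simp: var_def intro!: polys_single)

lemma homogeneous_var: "homogeneous 1 (var x)"
  by (simp add: var_def homogeneous_def)

lemma homogeneous_var_mult: "homogeneous 2 (var x * var y)"
  using homogeneous_mult[OF homogeneous_var homogeneous_var, of x y] by simp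

lemma toric_var_cancel:
  fixes \<omega> :: "'e \<Rightarrow> 'v::linorder \<Rightarrow>\<^sub>0 nat" and p :: "('e, 'k::field) mpoly"
  assumes "p \<in> polys X" "x \<in> X"
  shows "var x * p \<in> toric X (weight \<omega>) \<longleftrightarrow> p \<in> toric X (weight \<omega>)"
proof -
  have "single (\<omega> x) 1 \<noteq> (0 :: ('v, 'k) mpoly)"
    by (metis lookup_single_eq lookup_zero one_neq_zero)
  moreover have "monomial_map (weight \<omega>) (var x * p) = single (\<omega> x) 1 * monomial_map (weight \<omega>) p"
    by (simp add: monomial_map_weight_mult var_def)
  ultimately have "monomial_map (weight \<omega>) (var x * p) = 0 \<longleftrightarrow> monomial_map (weight \<omega>) p = 0"
    by simp
  then show ?thesis using assms by (auto simp: toric_def)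
qed

lemma single_minus_cancel:
  assumes "lookup m x \<noteq> 0"
  shows "single x (1::nat) + (m - single x 1) = m"
  by (rule poly_mapping_eqI) (use assms in \<open>auto simp: lookup_add lookup_minus lookup_single when_def\<close>)

lemma part_multiple_of_var:
  fixes p :: "('e, 'k::field) mpoly"
  assumes "p \<in> polys X"
  shows "\<exists>q\<in>polys X. part (\<lambda>m. lookup m x \<noteq> 0) p = var x * q"
proof -
  let ?Q = "\<lambda>m. lookup m x \<noteq> 0"
  let ?K = "{m \<in> keys p. ?Q m}"
  define q where "q = (\<Sum>m\<in>?K. single (m - single x 1) (lookup p m))"
  have "keys (m - single x 1) \<subseteq> X" if "m \<in> ?K" for m
    using that assms by (auto simp: polys_def in_keys_iff lookup_minus subset_iff)
  then have "q \<in> polys X" unfolding q_def by (intro polys_sum polys_single)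
  moreover have "var x * q = (\<Sum>m\<in>?K. single m (lookup p m))"
    unfolding q_def var_def sum_distrib_left by (intro sum.cong refl) (simp add: mult_single single_minus_cancel[simplified])
  moreover have "part ?Q p = (\<Sum>m\<in>keys (part ?Q p). single m (lookup (part ?Q p) m))"
    by (rule poly_mapping_decompose)
  moreover have "\<dots> = (\<Sum>m\<in>?K. single m (lookup p m))"
    by (intro sum.cong) (auto simp: keys_part lookup_part)
  ultimately show ?thesis by metis
qed

text \<open>A variable \<open>x\<close> whose exponent can be read off from the image of a monomial is free over the
  remaining quotient, a domain, so that modulo \<open>x\<close> another variable \<open>y\<close> stays a nonzerodivisor. In
  the proof the terms that contain \<open>x\<close> are split off.\<close>

lemma toric_free_var_cancel:
  fixes \<omega> :: "'e \<Rightarrow> 'v::linorder \<Rightarrow>\<^sub>0 nat" and p :: "('e, 'k::field) mpoly"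
  assumes free: "\<And>m m'. weight \<omega> m = weight \<omega> m' \<Longrightarrow> lookup m x = lookup m' x"
    and p: "p \<in> polys X" and x: "x \<in> X" and y: "y \<in> X" "x \<noteq> y"
  shows "var y * p \<in> ideal_insert X (var x) (toric X (weight \<omega>)) \<longleftrightarrow> p \<in> ideal_insert X (var x) (toric X (weight \<omega>))"
proof
  let ?K = "toric X (weight \<omega>)"
  let ?Q = "\<lambda>m. lookup m x = 0"
  have I: "ideal (ideal_insert X (var x) ?K) (poly_ring X)"
    by (intro ideal_ideal_insert ideal_toric_weight polys_var x)
  show "p \<in> ideal_insert X (var x) ?K \<Longrightarrow> var y * p \<in> ideal_insert X (var x) ?K"
    by (rule poly_ideal_mult[OF I]) (auto intro: y)
  assume yp: "var y * p \<in> ideal_insert X (var x) ?K"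
  obtain q where q: "q \<in> polys X" "part (\<lambda>m. \<not> ?Q m) p = var x * q" using part_multiple_of_var[OF p] by blast
  have p_eq: "p = part ?Q p + var x * q" using part_compl[of ?Q p] q by simp
  have "var x * (var y * q) \<in> ideal_insert X (var x) ?K"
  proof -
    have "0 + var x * (var y * q) \<in> ideal_insert X (var x) ?K"
      using q y by (intro ideal_insertI poly_ideal_zero[OF ideal_toric_weight] polys_mult polys_var)
    then show ?thesis by simp
  qed
  then have "var y * p - var x * (var y * q) \<in> ideal_insert X (var x) ?K"
    by (rule poly_ideal_diff[OF I yp])
  moreover have "var y * p - var x * (var y * q) = var y * part ?Q p"
    by (subst p_eq) (simp add: algebra_simps)
  ultimately have "var y * part ?Q p \<in> ideal_insert X (var x) ?K" by simp
  then obtain u r where u: "u \<in> ?K" "r \<in> polys X" "part ?Q p * var y = u + r * var x"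
    by (elim ideal_insertE) (simp add: mult.commute)
  have "part ?Q (part ?Q p * var y) = part ?Q (part ?Q p) * var y"
    by (rule part_mult) (use y in \<open>auto simp: var_def lookup_add lookup_single\<close>)
  also have "\<dots> = part ?Q p * var y" by (subst part_eq_self[of "part ?Q p"]) (auto simp: keys_part)
  finally have "part ?Q p * var y = part ?Q (u + r * var x)" using u by simp
  also have "\<dots> = part ?Q u"
  proof -
    have "part ?Q (r * var x) = part (\<lambda>_. False) r * var x"
      by (rule part_mult) (simp add: var_def lookup_add)
    then show ?thesis by (simp add: part_add part_eq_zero)
  qed
  also have "\<dots> \<in> ?K" by (rule toric_part[OF u(1)]) (drule free, simp)
  finally have "var y * part ?Q p \<in> ?K" by (simp add: mult.commute)
  then have "part ?Q p \<in> ?K" using toric_var_cancel[of "part ?Q p" X y \<omega>] p y by blast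
  then show "p \<in> ideal_insert X (var x) ?K" by (subst p_eq) (rule ideal_insertI[OF _ q(1)])
qed

section \<open>Adding a vertex of degree two\<close>

text \<open>The weights \<open>\<omega>'\<close> arise from \<open>\<omega>\<close> by turning the free variables \<open>y\<close> and \<open>z\<close> into edges from
  \<open>c\<close> and \<open>C\<close> to a new vertex \<open>v\<close>. The edges at \<open>C\<close> are \<open>b1\<close> and \<open>b2\<close>, which may coincide, and
  \<open>a1\<close> and \<open>a2\<close> are edges at \<open>c\<close> that have the same other ends.\<close>

locale new_vertex =
  fixes X :: "'e set" and \<omega> \<omega>' :: "'e \<Rightarrow> 'v::linorder \<Rightarrow>\<^sub>0 nat"
    and y z a1 a2 b1 b2 :: 'e and fy fz c C v :: 'v
  assumes X: "y \<in> X" "z \<in> X" "a1 \<in> X" "a2 \<in> X" "b1 \<in> X" "b2 \<in> X"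
    and old: "y \<notin> {z, a1, a2, b1, b2}" "z \<notin> {a1, a2, b1, b2}"
    and free: "\<omega> y = single fy 1" "\<omega> z = single fz 1"
    and fresh: "\<And>e. e \<noteq> y \<Longrightarrow> lookup (\<omega> e) fy = 0" "\<And>e. e \<noteq> z \<Longrightarrow> lookup (\<omega> e) fz = 0"
      "\<And>e. lookup (\<omega> e) v = 0"
    and same: "\<And>e. e \<noteq> y \<Longrightarrow> e \<noteq> z \<Longrightarrow> \<omega>' e = \<omega> e"
    and new: "\<omega>' y = single c 1 + single v 1"
      "\<omega>' z = single C 1 + single v 1"
    and distinct: "c \<noteq> C" "v \<noteq> c" "v \<noteq> C"
    and atC: "\<And>e. e \<in> X \<Longrightarrow> lookup (\<omega> e) C = (if e = b1 \<or> e = b2 then 1 else 0)"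
    and square: "\<omega> a1 + single C 1 = \<omega> b1 + single c 1"
      "\<omega> a2 + single C 1 = \<omega> b2 + single c 1"
begin

abbreviation "rest m \<equiv> part (\<lambda>e. e \<noteq> y \<and> e \<noteq> z) m"

lemma lookup_weight_split:
  "lookup (weight \<omega> m) u = lookup (weight \<omega> (rest m)) u
     + lookup m y * lookup (\<omega> y) u + lookup m z * lookup (\<omega> z) u" (is ?th1)
  "lookup (weight \<omega>' m) u = lookup (weight \<omega> (rest m)) u
     + lookup m y * lookup (\<omega>' y) u + lookup m z * lookup (\<omega>' z) u" (is ?th2)
proof -
  let ?A = "keys m - {y, z}"
  let ?B = "insert y (insert z ?A)"
  have yz: "y \<noteq> z" using old by simp
  have k: "finite ?B" "keys m \<subseteq> ?B" "finite ?A" "keys (rest m) \<subseteq> ?A"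
    by (auto simp: keys_part)
  have r: "lookup (weight \<omega> (rest m)) u = (\<Sum>e\<in>?A. lookup m e * lookup (\<omega> e) u)"
    unfolding lookup_weight[OF k(3,4)] by (intro sum.cong) (auto simp: lookup_part when_def)
  then have r': "lookup (weight \<omega> (rest m)) u = (\<Sum>e\<in>?A. lookup m e * lookup (\<omega>' e) u)"
    by (auto simp: same intro!: sum.cong)
  show ?th1 unfolding r lookup_weight[OF k(1,2)] using yz by simp
  show ?th2 unfolding r' lookup_weight[OF k(1,2)] using yz by simp
qed

lemma lookup_rest_fresh:
  "lookup (weight \<omega> (rest m)) fy = 0" "lookup (weight \<omega> (rest m)) fz = 0"
  "lookup (weight \<omega> (rest m)) v = 0"
  using fresh by (auto simp: lookup_weight[OF finite_keys order_refl] keys_part intro!: sum.neutral)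

lemma fresh_distinct: "fy \<noteq> fz" "C \<noteq> fy" "C \<noteq> fz" "v \<noteq> fy" "v \<noteq> fz"
proof -
  have "lookup (\<omega> y) fy = 1" "lookup (\<omega> z) fz = 1" using free by auto
  then show "fy \<noteq> fz" "v \<noteq> fy" "v \<noteq> fz" using fresh(1)[of z] fresh(3)[of y] fresh(3)[of z] old by auto
  show "C \<noteq> fy" "C \<noteq> fz" using atC[of b1] fresh(1,2)[of b1] old X by auto
qed

lemma lookup_weight_free:
  "lookup (weight \<omega> m) fy = lookup m y"
  "lookup (weight \<omega> m) fz = lookup m z"
  using lookup_weight_split(1)[of m fy] lookup_weight_split(1)[of m fz] fresh_distinct(1)
  by (auto simp: lookup_rest_fresh free lookup_single)

lemma weight_eqD: "weight \<omega> m = weight \<omega> m' \<Longrightarrow> weight \<omega>' m = weight \<omega>' m'"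
proof (rule poly_mapping_eqI)
  fix u assume eq: "weight \<omega> m = weight \<omega> m'"
  then have "lookup m y = lookup m' y" "lookup m z = lookup m' z"
    using lookup_weight_free by metis+
  then show "lookup (weight \<omega>' m) u = lookup (weight \<omega>' m') u"
    using lookup_weight_split(1)[of m u] lookup_weight_split(1)[of m' u] eq by (simp add: lookup_weight_split(2))
qed

definition q1 :: "('e, 'k::field) mpoly" where "q1 = var a1 * var z - var b1 * var y"
definition q2 :: "('e, 'k::field) mpoly" where "q2 = var a2 * var z - var b2 * var y"

lemma q_polys: "q1 \<in> polys X" "q2 \<in> polys X"
  using X by (auto simp: q1_def q2_def)

lemma q_homogeneous: "homogeneous 2 q1" "homogeneous 2 q2"
  unfolding q1_def q2_def by (intro homogeneous_diff homogeneous_var_mult)+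

lemma square': "\<omega>' a1 + \<omega>' z = \<omega>' b1 + \<omega>' y" "\<omega>' a2 + \<omega>' z = \<omega>' b2 + \<omega>' y"
proof -
  have "\<omega>' a1 = \<omega> a1" "\<omega>' b1 = \<omega> b1" "\<omega>' a2 = \<omega> a2" "\<omega>' b2 = \<omega> b2" using same old by auto
  then show "\<omega>' a1 + \<omega>' z = \<omega>' b1 + \<omega>' y" "\<omega>' a2 + \<omega>' z = \<omega>' b2 + \<omega>' y"
    using square by (simp_all add: new add.assoc[symmetric])
qed

text \<open>Replacing \<open>b\<^sub>i y\<close> by \<open>a\<^sub>i z\<close> lowers the exponent of \<open>y\<close>.\<close>

lemma normal_form:
  fixes I :: "('e, 'k::field) mpoly set"
  assumes I: "ideal I (poly_ring X)" and qI: "q1 \<in> I" "q2 \<in> I" and m: "keys m \<subseteq> X"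
  shows "\<exists>m'. keys m' \<subseteq> X \<and> weight \<omega>' m' = weight \<omega>' m \<and>
     single m 1 - single m' 1 \<in> I \<and>
     (lookup m' y = 0 \<or> lookup m' b1 = 0 \<and> lookup m' b2 = 0)"
  using m
proof (induction "lookup m y" arbitrary: m rule: less_induct)
  case less
  show ?case
  proof (cases "lookup m y = 0 \<or> lookup m b1 = 0 \<and> lookup m b2 = 0")
    case True
    then show ?thesis using less.prems poly_ideal_zero[OF I] by (intro exI[of _ m]) simp
  next
    case False
    then obtain a b where ab: "(a, b) \<in> {(a1, b1), (a2, b2)}" "lookup m b \<noteq> 0" and ny: "lookup m y \<noteq> 0" by auto
    have aX: "a \<in> X" "a \<noteq> y" "b \<noteq> y" "b \<noteq> z" using ab X old by auto
    have sq: "\<omega>' a + \<omega>' z = \<omega>' b + \<omega>' y" using ab square' by auto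
    have q: "var a * var z - var b * var y \<in> I" using ab qI by (auto simp: q1_def q2_def)
    define k where "k = m - single y 1 - single b 1"
    have "lookup (m - single y 1) b \<noteq> 0"
      using ab(2) aX by (simp add: lookup_minus lookup_single)
    from single_minus_cancel[OF this] single_minus_cancel[OF ny]
    have mk: "m = single y 1 + (single b 1 + k)"
      unfolding k_def by (simp only:)
    define m1 where "m1 = single z 1 + (single a 1 + k)"
    have "lookup m1 y < lookup m y"
      using aX old by (auto simp: m1_def mk lookup_add lookup_single when_def)
    moreover have m1X: "keys m1 \<subseteq> X"
      using less.prems aX X by (auto simp: m1_def mk keys_add_nat)
    ultimately obtain m' where m': "keys m' \<subseteq> X" "weight \<omega>' m' = weight \<omega>' m1"
      "single m1 1 - single m' 1 \<in> I"
      "lookup m' y = 0 \<or> lookup m' b1 = 0 \<and> lookup m' b2 = 0"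
      using less.hyps by blast
    have "weight \<omega>' m1 = weight \<omega>' m"
    proof -
      have "weight \<omega>' m1 = (\<omega>' a + \<omega>' z) + weight \<omega>' k"
        by (simp add: m1_def weight_add add_ac)
      also have "\<dots> = weight \<omega>' m"
        unfolding sq mk by (simp add: weight_add add_ac)
      finally show ?thesis .
    qed
    moreover have "single m 1 - single m1 1 \<in> I"
    proof -
      have "keys k \<subseteq> X" using less.prems by (auto simp: mk keys_add_nat)
      then have "single k (- 1) * (var a * var z - var b * var y) \<in> I"
        by (intro poly_ideal_mult[OF I q] polys_single)
      moreover have "single k (- 1) * (var a * var z - var b * var y)
          = (single m 1 - single m1 1 :: ('e, 'k) mpoly)"
        by (simp add: mk m1_def var_def right_diff_distrib mult_single single_uminus add_ac)
      ultimately show ?thesis by simp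
    qed
    then have "single m 1 - single m' 1 \<in> I"
      using poly_ideal_add[OF I _ m'(3), of "single m 1 - single m1 1"] by simp
    ultimately show ?thesis using m' by auto
  qed
qed

text \<open>Two normal forms with the same image have the same exponents of \<open>y\<close> and \<open>z\<close>. The sum of the two
  exponents is that of \<open>v\<close> in the image; and if one of the forms contains more of \<open>y\<close>, it contains
  neither \<open>b1\<close> nor \<open>b2\<close> and less of \<open>z\<close>, so that \<open>C\<close> has a smaller exponent in its image.\<close>

lemma toric_new_vertex:
  "toric X (weight \<omega>') = ideal_insert X q2 (ideal_insert X q1 (toric X (weight \<omega>) :: ('e, 'k::field) mpoly set))"
  (is "?K' = ?I")
proof
  let ?K = "toric X (weight \<omega>) :: ('e, 'k) mpoly set"
  have idK: "ideal ?K (poly_ring X)" "ideal ?K' (poly_ring X)" by (rule ideal_toric_weight)+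
  have idI: "ideal ?I (poly_ring X)"
    by (intro ideal_ideal_insert idK q_polys)
  have KI: "u + q1 * p1 + q2 * p2 \<in> ?I" if "u \<in> ?K" "p1 \<in> polys X" "p2 \<in> polys X" for u p1 p2
    using that by (intro ideal_insertI)
  have qI: "q1 \<in> ?I" "q2 \<in> ?I"
    using KI[OF poly_ideal_zero[OF idK(1)] polys_one polys_zero] KI[OF poly_ideal_zero[OF idK(1)] polys_zero polys_one] by simp_all
  have uI: "u \<in> ?I" if "u \<in> ?K" for u
    using KI[OF that polys_zero polys_zero] by simp
  show "?K' \<subseteq> ?I"
  proof (rule toric_subset_ideal[OF idI])
    fix m m' assume mm: "keys m \<subseteq> X" "keys m' \<subseteq> X" "weight \<omega>' m = weight \<omega>' m'"
    let ?nf = "\<lambda>m. lookup m y = 0 \<or> lookup m b1 = 0 \<and> lookup m b2 = 0"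
    let ?s = "\<lambda>m. single m 1 :: ('e, 'k) mpoly"
    obtain n where n: "keys n \<subseteq> X" "weight \<omega>' n = weight \<omega>' m" "?s m - ?s n \<in> ?I" "?nf n"
      using normal_form[OF idI qI mm(1)] by blast
    obtain n' where n': "keys n' \<subseteq> X" "weight \<omega>' n' = weight \<omega>' m'" "?s m' - ?s n' \<in> ?I" "?nf n'"
      using normal_form[OF idI qI mm(2)] by blast
    have eq: "weight \<omega>' n = weight \<omega>' n'" using n n' mm by simp
    have atv: "lookup (weight \<omega>' k) v = lookup k y + lookup k z" for k
      unfolding lookup_weight_split(2) lookup_rest_fresh new using distinct by (simp add: lookup_add lookup_single)
    have C: "lookup (weight \<omega>' k) C = lookup (weight \<omega> (rest k)) C + lookup k z" for k
      unfolding lookup_weight_split(2) new using distinct by (simp add: lookup_add lookup_single)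
    have C0: "lookup (weight \<omega> (rest k)) C = 0"
      if "keys k \<subseteq> X" "?nf k" "lookup k y \<noteq> 0" for k
      unfolding lookup_weight[OF finite_keys order_refl]
      using that by (intro sum.neutral) (auto simp: keys_part atC in_keys_iff lookup_part subset_iff)
    have "lookup n y = lookup n' y"
    proof (rule ccontr)
      assume ne: "lookup n y \<noteq> lookup n' y"
      have s: "lookup n y + lookup n z = lookup n' y + lookup n' z"
        using atv eq by metis
      have t: "lookup (weight \<omega> (rest n)) C + lookup n z
          = lookup (weight \<omega> (rest n')) C + lookup n' z"
        using C eq by metis
      show False
      proof (cases "lookup n y > lookup n' y")
        case True
        then show ?thesis using C0[OF n(1,4)] s t by linarith
      next
        case False
        then show ?thesis using C0[OF n'(1,4)] s t ne by linarith
      qed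
    qed
    moreover then have "lookup n z = lookup n' z" using atv eq by (metis add_left_cancel)
    ultimately have yz: "lookup n y = lookup n' y" "lookup n z = lookup n' z" by blast+
    have "weight \<omega> n = weight \<omega> n'"
    proof (rule poly_mapping_eqI)
      fix u
      have "lookup (weight \<omega> (rest n)) u = lookup (weight \<omega> (rest n')) u"
        using lookup_weight_split(2)[of n u] lookup_weight_split(2)[of n' u] eq yz by simp
      then show "lookup (weight \<omega> n) u = lookup (weight \<omega> n') u"
        unfolding lookup_weight_split(1)[of n u] lookup_weight_split(1)[of n' u] yz by simp
    qed
    then have "?s n - ?s n' \<in> ?K"
      using n n' by (auto simp: toric_def monomial_map_diff)
    then have "?s n - ?s n' \<in> ?I" by (rule uI)
    then have "(?s m - ?s n) + (?s n - ?s n') - (?s m' - ?s n') \<in> ?I"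
      by (rule poly_ideal_diff[OF idI poly_ideal_add[OF idI n(3)] n'(3)])
    then show "?s m - ?s m' \<in> ?I" by simp
  qed
  have KK': "?K \<subseteq> ?K'"
  proof (rule toric_subset_ideal[OF idK(2)])
    fix m m' assume mm: "keys m \<subseteq> X" "keys m' \<subseteq> X" "weight \<omega> m = weight \<omega> m'"
    show "single m 1 - single m' 1 \<in> ?K'"
      using mm(1,2) weight_eqD[OF mm(3)] by (auto simp: toric_def monomial_map_diff)
  qed
  have "monomial_map (weight \<omega>') q1 = (0 :: ('v, 'k) mpoly)" "monomial_map (weight \<omega>') q2 = (0 :: ('v, 'k) mpoly)"
    using square' by (simp_all add: q1_def q2_def monomial_map_diff monomial_map_weight_mult var_def mult_single weight_add)
  then have qK': "q1 \<in> ?K'" "q2 \<in> ?K'" using q_polys by (auto simp: toric_def)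
  show "?I \<subseteq> ?K'"
  proof
    fix x assume "x \<in> ?I"
    then obtain u p1 p2 where p: "u \<in> ?K" "p1 \<in> polys X" "p2 \<in> polys X" "x = u + q1 * p1 + q2 * p2"
      by (rule ideal_insert2E)
    then have "u + p1 * q1 + p2 * q2 \<in> ?K'"
      using KK' qK' poly_ideal_mult[OF idK(2)] by (intro poly_ideal_add[OF idK(2)]) auto
    then show "x \<in> ?K'" using p(4) by (simp add: mult.commute)
  qed
qed

text \<open>In the target, a domain, \<open>C q\<^sub>i = (c z - C y) b\<^sub>i\<close>, and both factors are nonzero.\<close>

lemma pair_iso:
  fixes p1 p2 :: "('e, 'k::field) mpoly"
  assumes p: "p1 \<in> polys X" "p2 \<in> polys X"
  shows "q1 * p1 + q2 * p2 \<in> toric X (weight \<omega>) \<longleftrightarrow> var b1 * p1 + var b2 * p2 \<in> toric X (weight \<omega>)"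
proof -
  let ?p = "monomial_map (weight \<omega>) :: ('e, 'k) mpoly \<Rightarrow> ('v, 'k) mpoly"
  let ?s = "\<lambda>w. single w 1 :: ('v, 'k) mpoly"
  let ?e = "\<lambda>x. single x 1 :: 'v \<Rightarrow>\<^sub>0 nat"
  have v: "?p (var x) = ?s (\<omega> x)" for x by (simp add: var_def)
  have sq: "?s (?e C) * ?s (\<omega> a1) = ?s (?e c) * ?s (\<omega> b1)" "?s (?e C) * ?s (\<omega> a2) = ?s (?e c) * ?s (\<omega> b2)"
    using square by (simp_all add: mult_single add.commute)
  let ?d = "?s (?e c) * ?s (?e fz) - ?s (?e C) * ?s (?e fy)"
  have nzC: "?s (?e C) \<noteq> 0" by (metis lookup_single_eq lookup_zero one_neq_zero)
  have nzd: "?d \<noteq> 0"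
  proof
    assume "?d = 0"
    then have "?s (?e c + ?e fz) = ?s (?e C + ?e fy)" by (simp add: mult_single)
    then have "?e c + ?e fz = ?e C + ?e fy"
      by (metis lookup_single_eq lookup_single_not_eq one_neq_zero)
    then have "lookup (?e c + ?e fz) fz = lookup (?e C + ?e fy) fz" by simp
    then show False using fresh_distinct by (simp add: lookup_add lookup_single)
  qed
  have "?s (?e C) * ?p (q1 * p1 + q2 * p2) =
      ((?s (?e C) * ?s (\<omega> a1)) * ?s (?e fz) - ?s (?e C) * ?s (\<omega> b1) * ?s (?e fy)) * ?p p1 +
      ((?s (?e C) * ?s (\<omega> a2)) * ?s (?e fz) - ?s (?e C) * ?s (\<omega> b2) * ?s (?e fy)) * ?p p2"
    by (simp only: q1_def q2_def monomial_map_add monomial_map_diff monomial_map_weight_mult v free) (simp only: algebra_simps)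
  also have "\<dots> = ?d * ?p (var b1 * p1 + var b2 * p2)"
    unfolding sq by (simp only: monomial_map_add monomial_map_weight_mult v) (simp only: algebra_simps)
  finally have "?p (q1 * p1 + q2 * p2) = 0 \<longleftrightarrow> ?p (var b1 * p1 + var b2 * p2) = 0"
    using nzC nzd by (metis mult_eq_0_iff)
  moreover have "q1 * p1 + q2 * p2 \<in> polys X" "var b1 * p1 + var b2 * p2 \<in> polys X"
    using p q_polys X by auto
  ultimately show ?thesis by (simp add: toric_def)
qed

end

section \<open>Ladders vertex by vertex\<close>

lemma ideal_insert_idem:
  assumes "ideal I (poly_ring X :: ('x, 'k::field) mpoly ring)"
  shows "ideal_insert X g (ideal_insert X g I) = ideal_insert X g I"
proof (intro equalityI subsetI)
  fix x assume "x \<in> ideal_insert X g (ideal_insert X g I)"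
  then obtain u p q where "u \<in> I" "p \<in> polys X" "q \<in> polys X" "x = u + g * p + g * q" by (rule ideal_insert2E)
  then show "x \<in> ideal_insert X g I"
    using ideal_insertI[of u I "p + q" X g] by (auto simp: algebra_simps)
next
  fix x assume "x \<in> ideal_insert X g I"
  from ideal_insertI[OF this polys_zero] show "x \<in> ideal_insert X g (ideal_insert X g I)" by simp
qed

lemma ideal_insert_absorb:
  fixes I :: "('x, 'k::field) mpoly set"
  assumes I: "ideal I (poly_ring X)" and b: "b1 \<in> polys X" "b2 \<in> polys X" and q: "q1 \<in> polys X" "q2 \<in> polys X"
    and mem: "q1 \<in> ideal_insert X b2 (ideal_insert X b1 I)" "q2 \<in> ideal_insert X b2 (ideal_insert X b1 I)"
  shows "ideal_insert X b2 (ideal_insert X b1 (ideal_insert X q2 (ideal_insert X q1 I))) = ideal_insert X b2 (ideal_insert X b1 I)"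
    (is "?L = ?R")
proof
  have R: "ideal ?R (poly_ring X)" by (intro ideal_ideal_insert I b)
  have IR: "u + b1 * p1 + b2 * p2 \<in> ?R" if "u \<in> I" "p1 \<in> polys X" "p2 \<in> polys X" for u p1 p2
    using that by (intro ideal_insertI)
  show "?L \<subseteq> ?R"
  proof
    fix x assume "x \<in> ?L"
    then obtain y p1 p2 where y: "y \<in> ideal_insert X q2 (ideal_insert X q1 I)" "p1 \<in> polys X" "p2 \<in> polys X"
      "x = y + b1 * p1 + b2 * p2" by (rule ideal_insert2E)
    obtain u r1 r2 where u: "u \<in> I" "r1 \<in> polys X" "r2 \<in> polys X" "y = u + q1 * r1 + q2 * r2"
      using y(1) by (rule ideal_insert2E)
    have "(u + b1 * p1 + b2 * p2) + (r1 * q1 + r2 * q2) \<in> ?R"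
      by (intro poly_ideal_add[OF R] IR u y poly_ideal_mult[OF R] mem)
    moreover have "(u + b1 * p1 + b2 * p2) + (r1 * q1 + r2 * q2) = x"
      unfolding y(4) u(4) by (simp add: algebra_simps)
    ultimately show "x \<in> ?R" by simp
  qed
  show "?R \<subseteq> ?L"
  proof
    fix x assume "x \<in> ?R"
    then obtain u p1 p2 where p: "u \<in> I" "p1 \<in> polys X" "p2 \<in> polys X" "x = u + b1 * p1 + b2 * p2"
      by (rule ideal_insert2E)
    then have "u + q1 * 0 + q2 * 0 + b1 * p1 + b2 * p2 \<in> ?L" by (intro ideal_insertI polys_zero)
    then show "x \<in> ?L" using p(4) by simp
  qed
qed

lemma weight_eq_0_iff:
  assumes "\<And>e. \<omega> e \<noteq> 0"
  shows "weight \<omega> m = 0 \<longleftrightarrow> m = 0"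
proof
  assume w: "weight \<omega> m = 0"
  show "m = 0"
  proof (rule poly_mapping_eqI)
    fix e
    obtain v where v: "lookup (\<omega> e) v \<noteq> 0"
      using assms[of e] by (metis lookup_zero poly_mapping_eqI)
    show "lookup m e = lookup 0 e"
    proof (rule ccontr)
      assume ne: "lookup m e \<noteq> lookup 0 e"
      then have e: "e \<in> keys m" by (simp add: in_keys_iff)
      have "lookup (weight \<omega> m) v = 0" using w by simp
      then have "lookup m e * lookup (\<omega> e) v = 0"
        using e by (simp add: lookup_weight[OF finite_keys order_refl])
      then show False using v ne by simp
    qed
  qed
qed simp

lemma single_nonzero: "single u (1::nat) \<noteq> 0"
proof
  assume "single u (1::nat) = 0"
  then have "lookup (single u (1::nat)) u = 0" by (simp only: lookup_zero)
  then show False by simp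
qed

text \<open>The vertices \<open>V 0, V 1, \<dots>\<close> are listed in the order in which they are added; only the first
  column is not among them and is \<open>w 2\<close>. From \<open>j = 2\<close> on, the vertex \<open>V j\<close> comes with the edges \<open>2 j\<close>
  to \<open>V (j - 1)\<close> and \<open>2 j - 1\<close> to \<open>w j\<close>. The row or column before \<open>V j\<close> is \<open>V (j - 2)\<close>, whose first
  two entries belong to \<open>w (j - 2)\<close> and \<open>V (j - 3)\<close> if \<open>j \<ge> 4\<close>. The vertices are encoded in a
  linearly ordered type, for which the polynomial ring is known to be a domain.\<close>

locale ladder_chain =
  fixes N :: nat and V w fr :: "nat \<Rightarrow> 'v::linorder" and E :: "nat \<Rightarrow> 'v \<Rightarrow>\<^sub>0 nat"
  assumes E0: "E 0 = single (V 0) 1 + single (w 2) 1"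
    and E_even: "\<And>j. 1 \<le> j \<Longrightarrow> j \<le> N + 1 \<Longrightarrow> E (2 * j) = single (V j) 1 + single (V (j - 1)) 1"
    and E_odd: "\<And>j. 2 \<le> j \<Longrightarrow> j \<le> N + 1 \<Longrightarrow> E (2 * j - 1) = single (V j) 1 + single (w j) 1"
    and w3: "3 \<le> N + 1 \<Longrightarrow> w 3 = V 0"
    and w_step: "\<And>j. 4 \<le> j \<Longrightarrow> j \<le> N + 1 \<Longrightarrow> w j \<in> {w (j - 2), V (j - 3)}"
    and inj: "inj V" "inj fr" and disj: "\<And>i. w 2 \<noteq> V i" "\<And>i j. fr i \<noteq> V j" "\<And>i. fr i \<noteq> w 2"
begin

definition X :: "nat set" where "X = insert 0 {2..2 * N + 2}"

text \<open>Level \<open>k\<close> is the ladder with index \<open>k - 1\<close>, and level \<open>0\<close> the single row with the edges \<open>0\<close> and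
  \<open>2\<close>. All levels are treated in the polynomial ring on all edges; those that are not yet present map
  to free variables.\<close>

definition level :: "nat \<Rightarrow> nat set" where "level k = insert 0 {2..2 * k + 2}"

definition \<omega> :: "nat \<Rightarrow> nat \<Rightarrow> 'v \<Rightarrow>\<^sub>0 nat" where
  "\<omega> k e = (if e \<in> level k then E e else single (fr e) 1)"

lemma w_cases:
  assumes "2 \<le> j" "j \<le> N + 1"
  shows "w j = w 2 \<or> (\<exists>i. i + 3 \<le> j \<and> w j = V i)"
  using assms
proof (induction j rule: less_induct)
  case (less j)
  consider "j = 2" | "j = 3" | "4 \<le> j" using less.prems by linarith
  then show ?case
  proof cases
    case 2
    then show ?thesis using w3 less.prems by auto
  next
    case 3
    then consider "w j = w (j - 2)" | "w j = V (j - 3)" using w_step[of j] less.prems by auto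
    then show ?thesis
    proof cases
      case 1
      have "w (j - 2) = w 2 \<or> (\<exists>i. i + 3 \<le> j - 2 \<and> w (j - 2) = V i)"
        using less.IH[of "j - 2"] 3 less.prems by simp
      then show ?thesis using 1 by (metis diff_le_self order_trans)
    next
      case 2
      then show ?thesis using 3 by (intro disjI2 exI[of _ "j - 3"]) simp
    qed
  qed simp
qed

lemma level_cases:
  assumes "e \<in> level k" "k \<le> N"
  obtains "e = 0" "E e = single (V 0) 1 + single (w 2) 1"
  | j where "e = 2 * j" "1 \<le> j" "j \<le> k + 1" "E e = single (V j) 1 + single (V (j - 1)) 1"
  | j where "e = 2 * j - 1" "2 \<le> j" "j \<le> k + 1" "E e = single (V j) 1 + single (w j) 1"
proof (cases "e = 0")
  case True
  then show ?thesis using E0 that(1) by simp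
next
  case False
  then have e: "2 \<le> e" "e \<le> 2 * k + 2" using assms(1) by (auto simp: level_def)
  show ?thesis
  proof (cases "even e")
    case True
    then obtain j where "e = 2 * j" by (elim evenE)
    then show ?thesis using that(2)[of j] e E_even[of j] assms(2) by simp
  next
    case False
    then obtain j where j: "e = 2 * j + 1" by (elim oddE)
    then show ?thesis using that(3)[of "j + 1"] e E_odd[of "j + 1"] assms(2) by simp
  qed
qed

text \<open>The new vertex \<open>V (k + 2)\<close> is joined to \<open>V (k + 1)\<close> and \<open>w (k + 2)\<close>. The older neighbours
  \<open>V k\<close> and, if \<open>k > 0\<close>, \<open>w (k + 1)\<close> of \<open>V (k + 1)\<close> are both joined to \<open>w (k + 2)\<close>. For
  \<open>w (k + 1)\<close> and \<open>k \<ge> 3\<close> the recursion for \<open>w\<close> reduces this to an edge at \<open>V (k - 1)\<close> or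
  \<open>V (k - 2)\<close>, or to the same claim two steps earlier.\<close>

lemma square_edge1:
  assumes "k < N"
  shows "\<exists>a. (a = 0 \<or> 2 \<le> a \<and> a \<le> 2 * k) \<and> E a = single (w (k + 2)) 1 + single (V k) 1"
proof -
  consider "k = 0" | "k = 1" | "2 \<le> k" by linarith
  then show ?thesis
  proof cases
    case 1
    then show ?thesis using E0 by (intro exI[of _ 0]) (simp add: add.commute numeral_2_eq_2)
  next
    case 2
    have "E 2 = single (V 1) 1 + single (V 0) 1" using E_even[of 1] by simp
    moreover have "w 3 = V 0" using w3 assms 2 by simp
    ultimately show ?thesis using 2 by (intro exI[of _ 2]) (simp add: add.commute numeral_eq_Suc)
  next
    case 3
    then have "w (k + 2) = w k \<or> w (k + 2) = V (k - 1)" using w_step[of "k + 2"] assms by simp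
    then show ?thesis
    proof
      assume "w (k + 2) = w k"
      then show ?thesis using E_odd[of k] assms 3 by (intro exI[of _ "2 * k - 1"]) (auto simp: add.commute)
    next
      assume "w (k + 2) = V (k - 1)"
      then show ?thesis using E_even[of k] assms 3 by (intro exI[of _ "2 * k"]) (auto simp: add.commute)
    qed
  qed
qed

lemma square_edge2:
  assumes "1 \<le> k" "k < N"
  shows "\<exists>a. (a = 0 \<or> 2 \<le> a \<and> a \<le> 2 * k) \<and> E a = single (w (k + 2)) 1 + single (w (k + 1)) 1"
  using assms
proof (induction k rule: less_induct)
  case (less k)
  have w3': "w 3 = V 0" using w3 less.prems by simp
  have E2: "E 2 = single (V 1) 1 + single (V 0) 1" using E_even[of 1] by simp
  consider "k = 1" | "k = 2" | "3 \<le> k" using less.prems by linarith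
  then show ?case
  proof cases
    case 1
    then show ?thesis using E0 w3' by (intro exI[of _ 0]) (simp add: eval_nat_numeral)
  next
    case 2
    then have "w 4 = w 2 \<or> w 4 = V 1" using w_step[of 4] less.prems by simp
    then show ?thesis
    proof
      assume "w 4 = w 2"
      then show ?thesis using E0 w3' 2 by (intro exI[of _ 0]) (simp add: add.commute numeral_eq_Suc)
    next
      assume "w 4 = V 1"
      then show ?thesis using E2 w3' 2 by (intro exI[of _ 2]) (simp add: numeral_eq_Suc)
    qed
  next
    case 3
    then have a: "w (k + 2) = w k \<or> w (k + 2) = V (k - 1)" using w_step[of "k + 2"] less.prems by simp
    have b: "w (k + 1) = w (k - 1) \<or> w (k + 1) = V (k - 2)" using w_step[of "k + 1"] less.prems 3 by simp
    show ?thesis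
    proof (cases "w (k + 2) = V (k - 1)")
      case True
      from b show ?thesis
      proof
        assume "w (k + 1) = w (k - 1)"
        then show ?thesis using True E_odd[of "k - 1"] less.prems 3 by (intro exI[of _ "2 * (k - 1) - 1"]) auto
      next
        assume "w (k + 1) = V (k - 2)"
        then show ?thesis using True E_even[of "k - 1"] less.prems 3
          by (intro exI[of _ "2 * (k - 1)"]) (auto simp: numeral_2_eq_2)
      qed
    next
      case False
      then have a: "w (k + 2) = w k" using a by simp
      from b show ?thesis
      proof
        assume "w (k + 1) = w (k - 1)"
        moreover have "k - 2 < k" "1 \<le> k - 2" "k - 2 < N" using less.prems 3 by auto
        from less.IH[OF this] obtain e where "e = 0 \<or> 2 \<le> e \<and> e \<le> 2 * (k - 2)"
          "E e = single (w (k - 2 + 2)) 1 + single (w (k - 2 + 1)) 1"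
          by blast
        moreover have "k - 2 + 2 = k" "k - 2 + 1 = k - 1" using 3 by auto
        ultimately show ?thesis using a by (intro exI[of _ e]) auto
      next
        assume "w (k + 1) = V (k - 2)"
        moreover have "k - 2 < N" using less.prems by auto
        from square_edge1[OF this] obtain e where "e = 0 \<or> 2 \<le> e \<and> e \<le> 2 * (k - 2)"
          "E e = single (w (k - 2 + 2)) 1 + single (V (k - 2)) 1"
          by blast
        moreover have "k - 2 + 2 = k" using 3 by auto
        ultimately show ?thesis using a by (intro exI[of _ e]) auto
      qed
    qed
  qed
qed

lemma V_eq_iff [simp]: "V i = V j \<longleftrightarrow> i = j" and fr_eq_iff [simp]: "fr i = fr j \<longleftrightarrow> i = j"
  using inj by (auto dest: injD)

lemma w_not_later: "2 \<le> j \<Longrightarrow> j \<le> N + 1 \<Longrightarrow> j \<le> i + 2 \<Longrightarrow> w j \<noteq> V i"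
  using w_cases[of j] disj(1) by auto

lemma fr_not_w: "2 \<le> j \<Longrightarrow> j \<le> N + 1 \<Longrightarrow> fr i \<noteq> w j"
  using w_cases[of j] disj(2,3) by metis

lemma new_vertex_chain:
  assumes k: "k < N"
  shows "\<exists>a1 a2. new_vertex X (\<omega> k) (\<omega> (Suc k)) (2 * k + 3) (2 * k + 4) a1 a2 (2 * k + 2) (if k = 0 then 2 else 2 * k + 1)
     (fr (2 * k + 3)) (fr (2 * k + 4)) (w (k + 2)) (V (k + 1)) (V (k + 2)) \<and> (k = 0 \<longrightarrow> a1 = a2)"
proof -
  let ?s = "\<lambda>v. single v (1::nat)"
  let ?b2 = "if k = 0 then 2 else 2 * k + 1"
  obtain a1 where a1: "a1 = 0 \<or> 2 \<le> a1 \<and> a1 \<le> 2 * k" "E a1 = ?s (w (k + 2)) + ?s (V k)"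
    using square_edge1[OF k] by blast
  have "\<exists>a2. (a2 = 0 \<or> 2 \<le> a2 \<and> a2 \<le> 2 * k) \<and> E a2 = ?s (w (k + 2)) + ?s (if k = 0 then V k else w (k + 1)) \<and> (k = 0 \<longrightarrow> a1 = a2)"
  proof (cases "k = 0")
    case True
    then show ?thesis using a1 by auto
  next
    case False
    then show ?thesis using square_edge2[of k] k by simp
  qed
  then obtain a2 where a2: "a2 = 0 \<or> 2 \<le> a2 \<and> a2 \<le> 2 * k"
    "E a2 = ?s (w (k + 2)) + ?s (if k = 0 then V k else w (k + 1))" "k = 0 \<longrightarrow> a1 = a2" by blast
  have b1: "E (2 * k + 2) = ?s (V (k + 1)) + ?s (V k)" using E_even[of "k + 1"] k by simp
  have b2: "E ?b2 = ?s (V (k + 1)) + ?s (if k = 0 then V k else w (k + 1))"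
    using E_odd[of "k + 1"] E_even[of 1] k by auto
  have y: "E (2 * k + 3) = ?s (V (k + 2)) + ?s (w (k + 2))"
    using E_odd[of "k + 2"] k by (simp add: numeral_eq_Suc)
  have z: "E (2 * k + 4) = ?s (V (k + 2)) + ?s (V (k + 1))"
    using E_even[of "k + 2"] k by (simp add: numeral_eq_Suc)
  have Ezero: "lookup (E e) u = 0"
    if "e \<in> level k" "\<And>j. j \<le> k + 1 \<Longrightarrow> u \<noteq> V j" "\<And>j. 2 \<le> j \<Longrightarrow> j \<le> k + 1 \<Longrightarrow> u \<noteq> w j" "u \<noteq> w 2" for e u
  proof (rule level_cases[OF that(1) less_imp_le[OF k]])
    assume "E e = single (V 0) 1 + single (w 2) 1"
    then show ?thesis using that(2)[of 0] that(4) by (simp add: lookup_add lookup_single when_def)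
  next
    fix j assume "1 \<le> j" "j \<le> k + 1" "E e = ?s (V j) + ?s (V (j - 1))"
    moreover then have "u \<noteq> V (j - 1)" by (intro that(2)) simp
    ultimately show ?thesis using that(2)[of j] by (simp add: lookup_add lookup_single when_def)
  next
    fix j assume "2 \<le> j" "j \<le> k + 1" "E e = ?s (V j) + ?s (w j)"
    then show ?thesis using that(2)[of j] that(3)[of j] by (simp add: lookup_add lookup_single when_def)
  qed
  have in_level: "a1 \<in> level k" "a2 \<in> level k" "2 * k + 2 \<in> level k" "?b2 \<in> level k"
    using a1 a2 by (auto simp: level_def)
  have \<omega>_lev: "\<omega> k e = E e" if "e \<in> level k" for e using that by (simp add: \<omega>_def)
  have "new_vertex X (\<omega> k) (\<omega> (Suc k)) (2 * k + 3) (2 * k + 4) a1 a2 (2 * k + 2) ?b2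
     (fr (2 * k + 3)) (fr (2 * k + 4)) (w (k + 2)) (V (k + 1)) (V (k + 2))"
  proof
    show "2 * k + 3 \<in> X" "2 * k + 4 \<in> X" "a1 \<in> X" "a2 \<in> X" "2 * k + 2 \<in> X" "?b2 \<in> X"
      using k a1 a2 by (auto simp: X_def)
    show "2 * k + 3 \<notin> {2 * k + 4, a1, a2, 2 * k + 2, ?b2}" "2 * k + 4 \<notin> {a1, a2, 2 * k + 2, ?b2}"
      using a1 a2 by auto
    show "\<omega> k (2 * k + 3) = ?s (fr (2 * k + 3))" "\<omega> k (2 * k + 4) = ?s (fr (2 * k + 4))"
      by (simp_all add: \<omega>_def level_def)
    have fresh: "lookup (\<omega> k e) (fr x) = 0" if "x \<notin> level k" "e \<noteq> x" for e x
    proof (cases "e \<in> level k")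
      case True
      then show ?thesis
        using disj k fr_not_w by (subst \<omega>_lev[OF True], intro Ezero) auto
    qed (use that in \<open>simp add: \<omega>_def lookup_single\<close>)
    show "lookup (\<omega> k e) (fr (2 * k + 3)) = 0" if "e \<noteq> 2 * k + 3" for e
      by (rule fresh) (use that in \<open>auto simp: level_def\<close>)
    show "lookup (\<omega> k e) (fr (2 * k + 4)) = 0" if "e \<noteq> 2 * k + 4" for e
      by (rule fresh) (use that in \<open>auto simp: level_def\<close>)
    show "lookup (\<omega> k e) (V (k + 2)) = 0" for e
    proof (cases "e \<in> level k")
      case True
      have "V (k + 2) \<noteq> w j" if "2 \<le> j" "j \<le> k + 1" for j using w_not_later[of j "k + 2"] that k by auto
      moreover have "V (k + 2) \<noteq> w 2" using disj(1) by metis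
      ultimately show ?thesis by (subst \<omega>_lev[OF True], intro Ezero True) auto
    next
      case False
      then show ?thesis using disj(2)[of e "k + 2"] by (simp add: \<omega>_def lookup_single when_def)
    qed
    show "\<omega> (Suc k) e = \<omega> k e" if "e \<noteq> 2 * k + 3" "e \<noteq> 2 * k + 4" for e
    proof -
      have "e \<in> level (Suc k) \<longleftrightarrow> e \<in> level k" using that by (auto simp: level_def)
      then show ?thesis by (simp add: \<omega>_def)
    qed
    show "\<omega> (Suc k) (2 * k + 3) = ?s (w (k + 2)) + ?s (V (k + 2))" "\<omega> (Suc k) (2 * k + 4) = ?s (V (k + 1)) + ?s (V (k + 2))"
      using y z by (simp_all add: \<omega>_def level_def add.commute)
    show "w (k + 2) \<noteq> V (k + 1)" "V (k + 2) \<noteq> w (k + 2)" "V (k + 2) \<noteq> V (k + 1)"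
      using w_not_later[of "k + 2" "k + 1"] w_not_later[of "k + 2" "k + 2"] k by auto
    show "lookup (\<omega> k e) (V (k + 1)) = (if e = 2 * k + 2 \<or> e = ?b2 then 1 else 0)" if "e \<in> X" for e
    proof (cases "e \<in> level k")
      case True
      show ?thesis
      proof (rule level_cases[OF True less_imp_le[OF k]])
        assume e: "e = 0" "E e = ?s (V 0) + ?s (w 2)"
        then show ?thesis using disj(1)[of "k + 1"] by (simp add: \<omega>_lev level_def lookup_add lookup_single when_def)
      next
        fix j assume j: "e = 2 * j" "1 \<le> j" "j \<le> k + 1" "E e = ?s (V j) + ?s (V (j - 1))"
        have "(e = 2 * k + 2 \<or> e = ?b2) \<longleftrightarrow> j = k + 1" using j(1-3) by presburger
        then show ?thesis unfolding \<omega>_lev[OF True] j(4) using j(2,3) by (auto simp: lookup_add lookup_single when_def)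
      next
        fix j assume j: "e = 2 * j - 1" "2 \<le> j" "j \<le> k + 1" "E e = ?s (V j) + ?s (w j)"
        then have "w j \<noteq> V (k + 1)" using w_not_later[of j "k + 1"] k by auto
        moreover have "(e = 2 * k + 2 \<or> e = ?b2) \<longleftrightarrow> j = k + 1" using j(1-3) by presburger
        ultimately show ?thesis unfolding \<omega>_lev[OF True] j(4) using j(2,3) by (auto simp: lookup_add lookup_single when_def)
      qed
    next
      case False
      then have "e \<noteq> 2 * k + 2" "e \<noteq> ?b2" using in_level by auto
      then show ?thesis using False disj(2)[of e "k + 1"] by (simp add: \<omega>_def lookup_single when_def)
    qed
    show "\<omega> k a1 + ?s (V (k + 1)) = \<omega> k (2 * k + 2) + ?s (w (k + 2))"
      "\<omega> k a2 + ?s (V (k + 1)) = \<omega> k ?b2 + ?s (w (k + 2))"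
      unfolding \<omega>_lev[OF in_level(1)] \<omega>_lev[OF in_level(2)] \<omega>_lev[OF in_level(3)] \<omega>_lev[OF in_level(4)] a1(2) a2(2) b1 b2
      by (simp_all only: add_ac)
  qed
  then show ?thesis using a2(3) by blast
qed

abbreviation K :: "nat \<Rightarrow> (nat, 'k::field) mpoly set" where
  "K k \<equiv> toric X (weight (\<omega> k))"

lemma K_0: "K 0 = ({0} :: (nat, 'k::field) mpoly set)"
proof
  have "ideal {0 :: (nat, 'k) mpoly} (poly_ring X)" by (rule poly_idealI) auto
  then show "(K 0 :: (nat, 'k) mpoly set) \<subseteq> {0}"
  proof (rule toric_subset_ideal)
    fix m m' :: "nat \<Rightarrow>\<^sub>0 nat" assume eq: "weight (\<omega> 0) m = weight (\<omega> 0) m'"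
    have l0: "level 0 = {0, 2}" by (auto simp: level_def)
    have E2: "E 2 = single (V 1) 1 + single (V 0) 1" using E_even[of 1] by simp
    \<comment> \<open>On level \<open>0\<close> each variable has a coordinate \<open>u\<close> of its own.\<close>
    have pick: "lookup (weight (\<omega> 0) n) u = lookup n e"
      if "lookup (\<omega> 0 e) u = 1" "\<And>e'. e' \<noteq> e \<Longrightarrow> lookup (\<omega> 0 e') u = 0" for n e u
    proof -
      let ?A = "insert e (keys n)"
      have "lookup (weight (\<omega> 0) n) u = (\<Sum>e'\<in>?A. lookup n e' * lookup (\<omega> 0 e') u)"
        by (rule lookup_weight) auto
      also have "\<dots> = (\<Sum>e'\<in>?A. if e' = e then lookup n e else 0)"
        by (rule sum.cong[OF refl]) (use that in simp)
      finally show ?thesis by simp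
    qed
    have "lookup m e = lookup m' e" for e
    proof -
      have wV: "w 2 \<noteq> V i" "V i \<noteq> w 2" "fr j \<noteq> V i" "V i \<noteq> fr j" "fr j \<noteq> w 2" "w 2 \<noteq> fr j" for i j
        using disj by metis+
      consider "e = 0" | "e = 2" | "e \<notin> level 0" using l0 by auto
      then have "\<exists>u. lookup (\<omega> 0 e) u = 1 \<and> (\<forall>e'. e' \<noteq> e \<longrightarrow> lookup (\<omega> 0 e') u = 0)"
      proof cases
        case 1
        then show ?thesis using wV by (intro exI[of _ "w 2"]) (auto simp: \<omega>_def l0 E0 E2 lookup_add lookup_single when_def)
      next
        case 2
        then show ?thesis using wV by (intro exI[of _ "V 1"]) (auto simp: \<omega>_def l0 E0 E2 lookup_add lookup_single when_def)
      next
        case 3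
        then show ?thesis using wV by (intro exI[of _ "fr e"]) (auto simp: \<omega>_def l0 E0 E2 lookup_add lookup_single when_def)
      qed
      then obtain u where "lookup (\<omega> 0 e) u = 1" "\<And>e'. e' \<noteq> e \<Longrightarrow> lookup (\<omega> 0 e') u = 0" by blast
      then show ?thesis using pick[of e u m] pick[of e u m'] eq by simp
    qed
    then have "m = m'" by (rule poly_mapping_eqI)
    then show "single m 1 - single m' 1 \<in> {0 :: (nat, 'k) mpoly}" by simp
  qed
qed (auto simp: toric_def)

text \<open>The type argument fixes the field, which occurs only in bound variables.\<close>

definition good_resolution :: "nat \<Rightarrow> 'k::field itself \<Rightarrow> bool" where
  "good_resolution k T \<longleftrightarrow> (\<exists>d (f :: nat \<Rightarrow> (nat, 'k) fvec \<Rightarrow> (nat, 'k) fvec). d 0 = [0] \<and> resolves X d f (cyc ` K k) \<and>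
     (\<forall>i. \<forall>j\<in>set (d i). j \<le> int i + int ((k + 1) div 2)) \<and> (\<forall>i>k. d i = []) \<and>
     int k + int ((k + 1) div 2) \<in> set (d k))"

lemma good_resolution_0: "good_resolution 0 T"
proof -
  define d :: "nat \<Rightarrow> int list" where "d i = (if i = 0 then [0] else [])" for i
  have "resolves X d (\<lambda>_ v. 0) (cyc ` K 0)"
    unfolding resolves_def K_0 by (auto simp: d_def gmap_zero)
  then show ?thesis
    unfolding good_resolution_def by (intro exI[of _ d] exI[of _ "\<lambda>_ v. 0"]) (auto simp: d_def)
qed

lemma good_resolution_1:
  fixes T :: "'k::field itself"
  assumes "1 \<le> N"
  shows "good_resolution 1 T"
proof -
  obtain a where "new_vertex X (\<omega> 0) (\<omega> (Suc 0)) 3 4 a a 2 2 (fr 3) (fr 4) (w 2) (V 1) (V 2)"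
    using new_vertex_chain[of 0] assms by (auto simp: numeral_2_eq_2)
  then interpret nv: new_vertex X "\<omega> 0" "\<omega> (Suc 0)" 3 4 a a 2 2 "fr 3" "fr 4" "w 2" "V 1" "V 2" .
  have q: "nv.q2 = nv.q1" by (simp add: nv.q1_def nv.q2_def)
  have K1: "K (Suc 0) = ideal_insert X nv.q1 (K 0 :: (nat, 'k) mpoly set)"
    unfolding nv.toric_new_vertex q by (rule ideal_insert_idem[OF ideal_toric_weight])
  obtain d and f :: "nat \<Rightarrow> (nat, 'k) fvec \<Rightarrow> (nat, 'k) fvec" where d: "d 0 = [0]" "resolves X d f (cyc ` K 0)" "\<And>i. i > 0 \<Longrightarrow> d i = []"
    using good_resolution_0[of T] unfolding good_resolution_def by blast
  have nzd: "nv.q1 * p \<in> K 0 \<longleftrightarrow> p \<in> (K 0 :: (nat, 'k) mpoly set)" if p: "p \<in> polys X" for p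
    using nv.pair_iso[OF p polys_zero] toric_var_cancel[OF p nv.X(5)] by simp
  define D where "D i = d i @ (case i of 0 \<Rightarrow> [] | Suc k \<Rightarrow> map ((+) 2) (d k))" for i
  obtain h where h: "resolves X D h (cyc ` (K 1 :: (nat, 'k) mpoly set))"
    using cone_nonzerodivisor[OF d(2,1) nv.q_polys(1) nv.q_homogeneous(1) nzd] K1 unfolding D_def by auto
  have D: "D i = (if i = 0 then [0] else if i = 1 then [2] else [])" for i
    using d(1,3) by (cases i) (auto simp: D_def)
  show ?thesis
    unfolding good_resolution_def
    by (intro exI[of _ D] exI[of _ h] conjI h) (simp_all add: D)
qed

text \<open>The edges \<open>2 k + 4\<close> and \<open>2 k + 3\<close> play the parts of \<open>b1\<close> and \<open>b2\<close> for the vertex added on level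
  \<open>k + 2\<close>. On level \<open>k\<close> they are free variables, hence a regular sequence. Together with the ideal of
  level \<open>k\<close> they generate the same ideal as with that of level \<open>k + 1\<close>, for the quadrics that are new
  on level \<open>k + 1\<close> are linear combinations of them.\<close>

lemma good_resolution_step:
  fixes T :: "'k::field itself"
  assumes k: "k + 2 \<le> N" and P0: "good_resolution k T" and P1: "good_resolution (k + 1) T"
  shows "good_resolution (k + 2) T"
proof -
  let ?y = "2 * k + 3" and ?z = "2 * k + 4"
  let ?b2 = "if k = 0 then 2 else 2 * k + 1"
  obtain a1 a2 where "new_vertex X (\<omega> k) (\<omega> (Suc k)) ?y ?z a1 a2 (2 * k + 2) ?b2
     (fr ?y) (fr ?z) (w (k + 2)) (V (k + 1)) (V (k + 2))"
    using new_vertex_chain[of k] k by auto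
  then interpret lo: new_vertex X "\<omega> k" "\<omega> (Suc k)" ?y ?z a1 a2 "2 * k + 2" ?b2 "fr ?y" "fr ?z" "w (k + 2)" "V (k + 1)" "V (k + 2)" .
  have eqs: "2 * Suc k + 3 = 2 * k + 5" "2 * Suc k + 4 = 2 * k + 6" "2 * Suc k + 2 = ?z" "2 * Suc k + 1 = ?y" by simp_all
  obtain a1' a2' where "new_vertex X (\<omega> (Suc k)) (\<omega> (Suc (Suc k))) (2 * k + 5) (2 * k + 6) a1' a2' ?z ?y
     (fr (2 * k + 5)) (fr (2 * k + 6)) (w (k + 3)) (V (k + 2)) (V (k + 3))"
    using new_vertex_chain[of "Suc k"] k unfolding eqs by (auto simp: numeral_eq_Suc)
  then interpret hi: new_vertex X "\<omega> (Suc k)" "\<omega> (Suc (Suc k))" "2 * k + 5" "2 * k + 6" a1' a2' ?z ?y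
     "fr (2 * k + 5)" "fr (2 * k + 6)" "w (k + 3)" "V (k + 2)" "V (k + 3)" .
  let ?K0 = "K k :: (nat, 'k) mpoly set" and ?K1 = "K (Suc k) :: (nat, 'k) mpoly set"
  let ?bz = "var ?z :: (nat, 'k) mpoly" and ?bv = "var ?y :: (nat, 'k) mpoly"
  have bX: "?bz \<in> polys X" "?bv \<in> polys X" using lo.X by auto
  obtain d f where d: "d 0 = [0]" "resolves X d f (cyc ` ?K0)" "\<And>i j. j \<in> set (d i) \<Longrightarrow> j \<le> int i + int ((k + 1) div 2)"
    "\<And>i. i > k \<Longrightarrow> d i = []" "int k + int ((k + 1) div 2) \<in> set (d k)"
    using P0 unfolding good_resolution_def by blast
  obtain e g where e: "e 0 = [0]" "resolves X e g (cyc ` ?K1)" "\<And>i j. j \<in> set (e i) \<Longrightarrow> j \<le> int i + int ((k + 2) div 2)"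
    "\<And>i. i > k + 1 \<Longrightarrow> e i = []"
    using P1 unfolding good_resolution_def by auto
  define d1 where "d1 i = d i @ (case i of 0 \<Rightarrow> [] | Suc k \<Rightarrow> map ((+) 1) (d k))" for i
  define d2 where "d2 i = d1 i @ (case i of 0 \<Rightarrow> [] | Suc k \<Rightarrow> map ((+) 1) (d1 k))" for i
  obtain f1 where f1: "resolves X d1 f1 (cyc ` ideal_insert X ?bz ?K0)"
    using cone_nonzerodivisor[OF d(2,1) bX(1) homogeneous_var toric_var_cancel] lo.X(2) unfolding d1_def by blast
  have d10: "d1 0 = [0]" by (simp add: d1_def d(1))
  have "?bv * p \<in> ideal_insert X ?bz ?K0 \<longleftrightarrow> p \<in> ideal_insert X ?bz ?K0" if "p \<in> polys X" for p
    using lo.old(1) by (intro toric_free_var_cancel that lo.X) (metis lo.lookup_weight_free(2), simp)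
  then obtain f2 where f2: "resolves X d2 f2 (cyc ` ideal_insert X ?bv (ideal_insert X ?bz ?K0))"
    using cone_nonzerodivisor[OF f1 d10 bX(2) homogeneous_var] unfolding d2_def by blast
  have d20: "d2 0 = [0]" by (simp add: d2_def d10)
  have mem: "p * ?bz - q * ?bv \<in> ideal_insert X ?bv (ideal_insert X ?bz ?K0)" if "p \<in> polys X" "q \<in> polys X" for p q
  proof -
    have "0 + ?bz * p + ?bv * (- q) \<in> ideal_insert X ?bv (ideal_insert X ?bz ?K0)"
      using that by (intro ideal_insertI poly_ideal_zero[OF ideal_toric_weight] polys_uminus)
    then show ?thesis by (simp add: mult.commute)
  qed
  have J: "ideal_insert X ?bv (ideal_insert X ?bz ?K0) = ideal_insert X ?bv (ideal_insert X ?bz ?K1)"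
    unfolding lo.toric_new_vertex
    by (intro ideal_insert_absorb[symmetric] ideal_toric_weight bX lo.q_polys)
      (unfold lo.q1_def lo.q2_def, (intro mem polys_var lo.X)+)
  define D where "D i = e i @ (case i of 0 \<Rightarrow> [] | Suc k \<Rightarrow>
            map ((+) 1) (d2 (Suc k) @ (case k of 0 \<Rightarrow> [] | Suc k' \<Rightarrow> e (Suc k'))))" for i
  have "\<exists>h. resolves X D h (cyc ` ideal_insert X hi.q2 (ideal_insert X hi.q1 ?K1))"
    unfolding D_def
    by (rule cone_isomorphic_pair[OF e(2,1) f2 d20 ideal_toric_weight J bX homogeneous_var homogeneous_var
          hi.q_polys hi.q_homogeneous hi.pair_iso])
  then obtain h where "resolves X D h (cyc ` ideal_insert X hi.q2 (ideal_insert X hi.q1 ?K1))" by blast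
  then have h: "resolves X D h (cyc ` (K (k + 2) :: (nat, 'k) mpoly set))"
    by (simp add: hi.toric_new_vertex)
  have m: "int ((k + 3) div 2) = int ((k + 1) div 2) + 1" "int ((k + 2) div 2) \<le> int ((k + 3) div 2)" by auto
  have b1: "j \<le> int i + int ((k + 1) div 2)" if "j \<in> set (d1 i)" for i j
    using that by (cases i) (auto simp: d1_def dest!: d(3))
  have b2: "j \<le> int i + int ((k + 1) div 2)" if "j \<in> set (d2 i)" for i j
    using that by (cases i) (auto simp: d2_def dest!: b1)
  have "j \<le> int i + int ((k + 3) div 2)" if jD: "j \<in> set (D i)" for i j
  proof (cases i)
    case 0
    then show ?thesis using jD m by (auto simp: D_def dest!: e(3))
  next
    case (Suc i')
    then consider "j \<in> set (e i)" | j' where "j' \<in> set (d2 i)" "j = 1 + j'" | j' i'' where "i' = Suc i''" "j' \<in> set (e i')" "j = 1 + j'"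
      using jD by (cases i') (auto simp: D_def)
    then show ?thesis
    proof cases
      case 1
      then show ?thesis using e(3)[of j i] m by linarith
    next
      case 2
      then show ?thesis using b2[of j' i] m by linarith
    next
      case 3
      then show ?thesis using e(3)[of j' i'] m Suc by linarith
    qed
  qed
  moreover have "D i = []" if il: "i > k + 2" for i
  proof -
    have "i = Suc (Suc (Suc (i - 3)))" "i - 3 \<ge> k" using il by auto
    then obtain i' where i': "i = Suc (Suc (Suc i'))" "i' \<ge> k" by blast
    then show ?thesis by (simp add: D_def d2_def d1_def d(4) e(4))
  qed
  moreover have "int (k + 2) + int ((k + 3) div 2) \<in> set (D (k + 2))"
  proof -
    have "1 + (int k + int ((k + 1) div 2)) \<in> set (d1 (Suc k))" using d(5) by (auto simp: d1_def)
    then have "1 + (1 + (int k + int ((k + 1) div 2))) \<in> set (d2 (Suc (Suc k)))" by (auto simp: d2_def)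
    then have "1 + (1 + (1 + (int k + int ((k + 1) div 2)))) \<in> set (D (Suc (Suc k)))" by (auto simp: D_def)
    then show ?thesis by (simp add: m(1) add.commute add.left_commute)
  qed
  moreover have "D 0 = [0]" by (simp add: D_def e(1))
  moreover have "k + 2 + 1 = k + 3" by simp
  ultimately show ?thesis
    unfolding good_resolution_def using h by metis
qed

lemma good_resolution_all:
  "k \<le> N \<Longrightarrow> good_resolution k T"
proof (induction k rule: less_induct)
  case (less k)
  consider "k = 0" | "k = 1" | k' where "k = k' + 2"
    by (metis add_2_eq_Suc' not0_implies_Suc One_nat_def)
  then show ?case
  proof cases
    case 3
    then show ?thesis
      using good_resolution_step[of k' T] less.IH[of k'] less.IH[of "k' + 1"] less.prems by simp
  qed (use good_resolution_0 good_resolution_1 less.prems in auto)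
qed

theorem regularity_chain:
  "regularity X (quotient_module X (K N :: (nat, 'k::field) mpoly set)) = ereal (real ((N + 1) div 2))"
proof -
  obtain d and f :: "nat \<Rightarrow> (nat, 'k) fvec \<Rightarrow> (nat, 'k) fvec" where d: "d 0 = [0]" "resolves X d f (cyc ` K N)"
    "\<And>i j. j \<in> set (d i) \<Longrightarrow> j \<le> int i + int ((N + 1) div 2)"
    "\<And>i. i > N \<Longrightarrow> d i = []" "int N + int ((N + 1) div 2) \<in> set (d N)"
    using good_resolution_all[OF order_refl, of "TYPE('k)"] unfolding good_resolution_def by blast
  have nz: "\<omega> N e \<noteq> 0" for e
  proof (cases "e \<in> level N")
    case True
    have ne: "single u 1 + single v 1 \<noteq> (0 :: 'v \<Rightarrow>\<^sub>0 nat)" for u v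
    proof
      assume "single u 1 + single v 1 = (0 :: 'v \<Rightarrow>\<^sub>0 nat)"
      then have "lookup (single u 1 + single v (1::nat)) u = 0" by simp
      then show False by (simp add: lookup_add)
    qed
    show ?thesis
      by (rule level_cases[OF True order_refl]) (use True ne in \<open>simp_all add: \<omega>_def\<close>)
  next
    case False
    then show ?thesis using single_nonzero[of "fr e"] by (simp add: \<omega>_def)
  qed
  have "lookup p 0 = 0" if "p \<in> (K N :: (nat, 'k) mpoly set)" for p
    by (rule toric_constant_term[OF that]) (simp add: weight_eq_0_iff[OF nz])
  then show ?thesis
    using d by (intro regularity_from_resolution[OF ideal_toric_weight d(2,1)]) auto
qed

end

section \<open>Toric rings of graphs\<close>

lemma prod_single_one: "(\<Prod>a\<in>A. single (g a) 1) = (single (sum g A) 1 :: 'm::comm_monoid_add \<Rightarrow>\<^sub>0 'k::comm_semiring_1)"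
  by (induction A rule: infinite_finite_induct) (simp_all add: mult_single)

lemma single_one_power:
  fixes w :: "'v \<Rightarrow>\<^sub>0 nat"
  shows "single w (1 :: 'k::comm_semiring_1) ^ n = single (Poly_Mapping.map ((*) n) w) 1"
proof (induction n)
  case 0
  have "Poly_Mapping.map ((*) 0) w = 0" by (rule poly_mapping_eqI) (simp add: lookup_map_times)
  then show ?case by (simp only: power_0 single_one)
next
  case (Suc n)
  have "w + Poly_Mapping.map ((*) n) w = Poly_Mapping.map ((*) (Suc n)) w"
    by (rule poly_mapping_eqI) (simp add: lookup_map_times lookup_add)
  then show ?case by (simp only: power_Suc Suc mult_single mult_1_left)
qed

definition graph_weight :: "('v, 'e) graph \<Rightarrow> 'e \<Rightarrow> 'v \<Rightarrow>\<^sub>0 nat" where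
  "graph_weight G e = (\<Sum>v\<in>ends G e. single v 1)"

lemma edge_map_eq_monomial_map:
  fixes G :: "('v, 'e) graph" and p :: "('e, 'k::field) mpoly"
  shows "edge_map G p = monomial_map (weight (graph_weight G)) p"
proof -
  have "(\<Prod>v\<in>ends G e. var v) = (single (graph_weight G e) 1 :: ('v, 'k) mpoly)" for e
    unfolding var_def graph_weight_def by (rule prod_single_one)
  then have "(\<Prod>e\<in>keys m. (\<Prod>v\<in>ends G e. var v) ^ lookup m e)
      = (single (weight (graph_weight G) m) 1 :: ('v, 'k) mpoly)" for m
    by (simp add: single_one_power prod_single_one weight_def del: single_one)
  then show ?thesis
    by (simp add: edge_map_def poly_subst_def monomial_map_def mult_single)
qed

lemma toric_ideal_eq_toric: "toric_ideal G = toric (edges G) (weight (graph_weight G))"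
  unfolding toric_ideal_def a_kernel_def' toric_def edge_map_eq_monomial_map by simp

lemma toric_ring_eq_quotient: "toric_ring G = quotient_module (edges G) (toric_ideal G)"
  unfolding toric_ring_def quotient_module_def Let_def ..

lemma toric_relabel:
  fixes \<omega> :: "'e \<Rightarrow> 'v \<Rightarrow>\<^sub>0 nat" and \<omega>' :: "'e \<Rightarrow> 'u \<Rightarrow>\<^sub>0 nat" and c :: "'v \<Rightarrow> 'u"
  assumes c: "\<And>e v. e \<in> X \<Longrightarrow> lookup (\<omega>' e) (c v) = lookup (\<omega> e) v"
    "\<And>e u. e \<in> X \<Longrightarrow> u \<notin> range c \<Longrightarrow> lookup (\<omega>' e) u = 0"
  shows "toric X (weight \<omega>') = (toric X (weight \<omega>) :: ('e, 'k::field) mpoly set)"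
proof -
  have "weight \<omega>' m = weight \<omega>' m' \<longleftrightarrow> weight \<omega> m = weight \<omega> m'"
    if m: "keys m \<subseteq> X" "keys m' \<subseteq> X" for m m'
  proof -
    have eq: "lookup (weight \<omega>' n) (c v) = lookup (weight \<omega> n) v"
      "u \<notin> range c \<Longrightarrow> lookup (weight \<omega>' n) u = 0" if "keys n \<subseteq> X" for n u v
      using that c unfolding lookup_weight[OF finite_keys order_refl] by (auto intro!: sum.cong sum.neutral)
    show ?thesis
    proof
      assume "weight \<omega>' m = weight \<omega>' m'"
      then show "weight \<omega> m = weight \<omega> m'"
        using eq(1)[OF m(1)] eq(1)[OF m(2)] by (intro poly_mapping_eqI) metis
    next
      assume w: "weight \<omega> m = weight \<omega> m'"
      show "weight \<omega>' m = weight \<omega>' m'"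
      proof (rule poly_mapping_eqI)
        fix u show "lookup (weight \<omega>' m) u = lookup (weight \<omega>' m') u"
          using eq[OF m(1)] eq[OF m(2)] w by (cases "u \<in> range c") auto
      qed
    qed
  qed
  note iff = this
  have "single m 1 - single m' 1 \<in> (toric X (weight \<omega>) :: ('e, 'k) mpoly set)"
    if "keys m \<subseteq> X" "keys m' \<subseteq> X" "weight \<omega>' m = weight \<omega>' m'" for m m'
    using that iff[OF that(1,2)] by (auto simp: toric_def monomial_map_diff)
  moreover have "single m 1 - single m' 1 \<in> (toric X (weight \<omega>') :: ('e, 'k) mpoly set)"
    if "keys m \<subseteq> X" "keys m' \<subseteq> X" "weight \<omega> m = weight \<omega> m'" for m m'
    using that iff[OF that(1,2)] by (auto simp: toric_def monomial_map_diff)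
  ultimately show ?thesis
    by (intro equalityI toric_subset_ideal ideal_toric_weight)
qed

section \<open>The graphs of ladder-like structures\<close>

text \<open>The vertices in the order in which they are added, starting from the first row and the second
  column.\<close>

definition nth_vertex :: "nat \<Rightarrow> vertex" where
  "nth_vertex j = (if even j then Row (j div 2 + 1) else Col ((j + 1) div 2 + 1))"

definition entry_ends :: "array \<Rightarrow> nat \<Rightarrow> vertex set" where
  "entry_ends L x = (\<Union>(r, c)\<in>{p. L p = Some x}. {Row r, Col c})"

lemma entry_ends_upd2:
  assumes "p \<noteq> q" "L p = None" "L q = None" "x \<noteq> y" "x \<notin> ran L" "y \<notin> ran L"
  shows "entry_ends (L(p \<mapsto> x, q \<mapsto> y)) x = {Row (fst p), Col (snd p)}"
    and "entry_ends (L(p \<mapsto> x, q \<mapsto> y)) y = {Row (fst q), Col (snd q)}"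
    and "z \<noteq> x \<Longrightarrow> z \<noteq> y \<Longrightarrow> entry_ends (L(p \<mapsto> x, q \<mapsto> y)) z = entry_ends L z"
proof -
  have "{s. (L(p \<mapsto> x, q \<mapsto> y)) s = Some x} = {p}" "{s. (L(p \<mapsto> x, q \<mapsto> y)) s = Some y} = {q}"
    using assms by (auto simp: ranI)
  then show "entry_ends (L(p \<mapsto> x, q \<mapsto> y)) x = {Row (fst p), Col (snd p)}"
    "entry_ends (L(p \<mapsto> x, q \<mapsto> y)) y = {Row (fst q), Col (snd q)}"
    by (simp_all add: entry_ends_def split: prod.splits)
  assume "z \<noteq> x" "z \<noteq> y"
  then have "{s. (L(p \<mapsto> x, q \<mapsto> y)) s = Some z} = {s. L s = Some z}"
    using assms by auto
  then show "entry_ends (L(p \<mapsto> x, q \<mapsto> y)) z = entry_ends L z"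
    by (simp add: entry_ends_def)
qed

definition ladder_shape :: "nat \<Rightarrow> array \<Rightarrow> (nat \<Rightarrow> vertex) \<Rightarrow> bool" where
  "ladder_shape n L w \<longleftrightarrow> entry_ends L 0 = {nth_vertex 0, w 2} \<and>
     (\<forall>j\<in>{1..n + 2}. entry_ends L (2 * j) = {nth_vertex j, nth_vertex (j - 1)}) \<and>
     (\<forall>j\<in>{2..n + 2}. entry_ends L (2 * j - 1) = {nth_vertex j, w j}) \<and>
     w 2 = Col 1 \<and> (1 \<le> n \<longrightarrow> w 3 = nth_vertex 0) \<and>
     (\<forall>j\<in>{4..n + 2}. w j \<in> {w (j - 2), nth_vertex (j - 3)})"

text \<open>The entries of the last row and the last column, from which the next step of the recursion
  chooses, in terms of \<open>w\<close>.\<close>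

definition last_lines :: "nat \<Rightarrow> array \<Rightarrow> (nat \<Rightarrow> vertex) \<Rightarrow> bool" where
  "last_lines n L w \<longleftrightarrow>
    (if even n
     then (\<exists>c<ladder_cols n. row_entries L (ladder_rows n) = {c, ladder_cols n} \<and> Col c = w (n + 2)) \<and>
          (\<exists>r<ladder_rows n - 1. col_entries L (ladder_cols n) = {r, ladder_rows n - 1, ladder_rows n} \<and> Row r = w (n + 1))
     else (\<exists>r<ladder_rows n. col_entries L (ladder_cols n) = {r, ladder_rows n} \<and> Row r = w (n + 2)) \<and>
          (\<exists>c<ladder_cols n - 1. row_entries L (ladder_rows n) = {c, ladder_cols n - 1, ladder_cols n} \<and> Col c = w (n + 1)))"

lemma ladder_shape_extend:
  assumes L: "ladder_shape m L w" and m: "1 \<le> m"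
    and u: "u \<in> {w (m + 1), nth_vertex m}"
    and new: "entry_ends L' (2 * m + 6) = {nth_vertex (m + 3), nth_vertex (m + 2)}"
      "entry_ends L' (2 * m + 5) = {nth_vertex (m + 3), u}"
    and old: "\<And>x. x \<noteq> 2 * m + 6 \<Longrightarrow> x \<noteq> 2 * m + 5 \<Longrightarrow> entry_ends L' x = entry_ends L x"
  shows "ladder_shape (Suc m) L' (w(m + 3 := u))"
proof -
  let ?w = "w(m + 3 := u)"
  have 1: "entry_ends L' (2 * j) = {nth_vertex j, nth_vertex (j - 1)}" if "j \<in> {1..Suc m + 2}" for j
  proof (cases "j = m + 3")
    case True
    then show ?thesis using new(1) by (simp add: algebra_simps)
  next
    case False
    then have "entry_ends L' (2 * j) = entry_ends L (2 * j)" by (intro old) presburger+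
    then show ?thesis using L that False by (simp add: ladder_shape_def)
  qed
  have 2: "entry_ends L' (2 * j - 1) = {nth_vertex j, ?w j}" if "j \<in> {2..Suc m + 2}" for j
  proof (cases "j = m + 3")
    case True
    then have "2 * j - 1 = 2 * m + 5" by simp
    show ?thesis unfolding \<open>2 * j - 1 = 2 * m + 5\<close> using new(2) True by simp
  next
    case False
    then have "2 * j - 1 \<noteq> 2 * m + 6 \<and> 2 * j - 1 \<noteq> 2 * m + 5" using that by presburger
    then have "entry_ends L' (2 * j - 1) = entry_ends L (2 * j - 1)" by (intro old) auto
    then show ?thesis using L that False by (simp add: ladder_shape_def)
  qed
  have 3: "?w j \<in> {?w (j - 2), nth_vertex (j - 3)}" if "j \<in> {4..Suc m + 2}" for j
  proof (cases "j = m + 3")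
    case True
    then show ?thesis using u by simp
  next
    case False
    then show ?thesis using L that by (auto simp: ladder_shape_def)
  qed
  have "entry_ends L' 0 = entry_ends L 0" by (rule old) auto
  then show ?thesis
    using L m 1 2 3 unfolding ladder_shape_def by auto
qed

lemma ladder_has_shape:
  "\<exists>w. ladder_shape n (ladder n t) w \<and> (1 \<le> n \<longrightarrow> last_lines n (ladder n t) w)"
proof (induction n t rule: ladder.induct)
  case (1 t)
  have s: "{1..0 + 2} = {1, 2::nat}" "{2..0 + 2} = {2::nat}" "{4..0 + 2} = ({} :: nat set)" by auto
  have "{p. ladder 0 t p = Some 0} = {(1, 1)}" "{p. ladder 0 t p = Some 2} = {(1, 2)}"
    "{p. ladder 0 t p = Some 3} = {(2, 1)}" "{p. ladder 0 t p = Some 4} = {(2, 2)}"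
    by (auto split: if_splits)
  then have "ladder_shape 0 (ladder 0 t) (\<lambda>_. Col 1)"
    unfolding ladder_shape_def s by (auto simp: entry_ends_def nth_vertex_def simp del: ladder.simps)
  then show ?case by (intro exI[of _ "\<lambda>_. Col 1"]) (simp del: ladder.simps)
next
  case (2 t)
  have s: "{1..Suc 0 + 2} = {1, 2, 3::nat}" "{2..Suc 0 + 2} = {2, 3::nat}" "{4..Suc 0 + 2} = ({} :: nat set)" by auto
  let ?w = "(\<lambda>_. Col 1)(3 := Row 1)"
  have "{p. ladder (Suc 0) t p = Some 0} = {(1, 1)}" "{p. ladder (Suc 0) t p = Some 2} = {(1, 2)}"
    "{p. ladder (Suc 0) t p = Some 3} = {(2, 1)}" "{p. ladder (Suc 0) t p = Some 4} = {(2, 2)}"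
    "{p. ladder (Suc 0) t p = Some 5} = {(1, 3)}" "{p. ladder (Suc 0) t p = Some 6} = {(2, 3)}"
    by (auto split: if_splits)
  then have "ladder_shape (Suc 0) (ladder (Suc 0) t) ?w"
    unfolding ladder_shape_def s by (auto simp: entry_ends_def nth_vertex_def simp del: ladder.simps)
  moreover have "last_lines (Suc 0) (ladder (Suc 0) t) ?w"
  proof -
    have "ladder_rows (Suc 0) = 2" "ladder_cols (Suc 0) = 3"
      by (simp_all add: ladder_rows_def ladder_cols_def)
    moreover have "col_entries (ladder (Suc 0) t) 3 = {1, 2}" "row_entries (ladder (Suc 0) t) 2 = {1, 2, 3}"
      by (auto simp: col_entries_def row_entries_def)
    ultimately show ?thesis
      by (auto simp: last_lines_def simp del: ladder.simps)
  qed
  ultimately show ?case by blast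
next
  case (3 m t)
  define n L where "n = Suc (Suc m)" and "L = ladder (Suc m) (butlast t)"
  define R C where "R = ladder_rows n" and "C = ladder_cols n"
  have ran: "ran L = insert 0 {2..2 * Suc m + 4}" and dom0: "dom L \<subseteq> {1..ladder_rows (Suc m)} \<times> {1..ladder_cols (Suc m)}"
    using ladder_invariant[of "Suc m" "butlast t"] unfolding L_def by blast+
  have fresh: "2 * n + 4 \<notin> ran L" "2 * n + 3 \<notin> ran L" unfolding ran n_def by auto
  have nn: "2 * Suc m + 6 = 2 * n + 4" "2 * Suc m + 5 = 2 * n + 3" "Suc m + 3 = n + 2" "Suc m + 2 = n + 1" "Suc m + 1 = n"
    by (simp_all add: n_def)
  show ?case
  proof (cases "even n")
    case True
    then have odd: "odd (Suc m)" by (simp add: n_def)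
    have R: "ladder_rows (Suc m) = R - 1" "R \<ge> 3" and C: "ladder_cols (Suc m) = C"
      using True unfolding n_def R_def C_def ladder_rows_def ladder_cols_def by presburger+
    obtain w where w: "ladder_shape (Suc m) L w" "last_lines (Suc m) L w"
      using 3 True unfolding L_def by auto
    obtain r where r: "r < R - 1" "col_entries L C = {r, R - 1}" "Row r = w (n + 1)"
      using w(2) odd unfolding last_lines_def R C nn by auto
    obtain c where c: "c < C - 1" "row_entries L (R - 1) = {c, C - 1, C}" "Col c = w n"
      using w(2) odd unfolding last_lines_def R C nn by auto
    define e where "e = choose_entry (t ! n) (row_entries L (R - 1))"
    have e: "e \<in> {c, C - 1}"
      unfolding e_def c(2) using c(1) by (intro choose_entry_mem) auto
    then have eC: "e < C" using c(1) by auto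
    have L': "ladder n t = L((R, C) \<mapsto> 2 * n + 4, (R, e) \<mapsto> 2 * n + 3)"
      using True by (simp add: n_def L_def R_def C_def e_def Let_def)
    have new: "L (R, x) = None" for x using dom0 R C by (force simp: domIff)
    note ends = entry_ends_upd2[of "(R, C)" "(R, e)" L "2 * n + 4" "2 * n + 3", folded L']
    have V: "nth_vertex (n + 2) = Row R" "nth_vertex (n + 1) = Col C" "nth_vertex (Suc m) = Col (C - 1)"
      using True by (auto simp: nth_vertex_def R_def C_def ladder_rows_def ladder_cols_def n_def)
    have "ladder_shape (Suc (Suc m)) (ladder n t) (w(Suc m + 3 := Col e))"
    proof (rule ladder_shape_extend[OF w(1)])
      show "Col e \<in> {w (Suc m + 1), nth_vertex (Suc m)}"
        using e c(3) unfolding nn V by auto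
      show "entry_ends (ladder n t) (2 * Suc m + 6) = {nth_vertex (Suc m + 3), nth_vertex (Suc m + 2)}"
        "entry_ends (ladder n t) (2 * Suc m + 5) = {nth_vertex (Suc m + 3), Col e}"
        unfolding nn V using ends(1,2) eC new fresh by auto
      show "entry_ends (ladder n t) x = entry_ends L x" if "x \<noteq> 2 * Suc m + 6" "x \<noteq> 2 * Suc m + 5" for x
        using ends(3)[of x] that eC new fresh unfolding nn by auto
    qed simp
    moreover have "last_lines n (ladder n t) (w(n + 2 := Col e))"
    proof -
      have "row_entries (ladder n t) R = {e, C}"
        unfolding L' by (auto simp: row_entries_def new)
      moreover have "col_entries (ladder n t) C = {r, R - 1, R}"
        using r eC unfolding L' by (auto simp: col_entries_def)
      ultimately show ?thesis
        using True eC r unfolding last_lines_def R_def[symmetric] C_def[symmetric] by auto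
    qed
    ultimately show ?thesis unfolding nn n_def[symmetric] by blast
  next
    case False
    then have ev: "even (Suc m)" by (simp add: n_def)
    have C: "ladder_cols (Suc m) = C - 1" "C \<ge> 3" and R: "ladder_rows (Suc m) = R"
      using ev unfolding n_def R_def C_def ladder_rows_def ladder_cols_def by presburger+
    obtain w where w: "ladder_shape (Suc m) L w" "last_lines (Suc m) L w"
      using 3 False unfolding L_def by auto
    obtain c where c: "c < C - 1" "row_entries L R = {c, C - 1}" "Col c = w (n + 1)"
      using w(2) ev unfolding last_lines_def R C nn by auto
    obtain r where r: "r < R - 1" "col_entries L (C - 1) = {r, R - 1, R}" "Row r = w n"
      using w(2) ev unfolding last_lines_def R C nn by auto
    define e where "e = choose_entry (t ! n) (col_entries L (C - 1))"
    have e: "e \<in> {r, R - 1}"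
      unfolding e_def r(2) using r(1) by (intro choose_entry_mem) auto
    then have eR: "e < R" using r(1) by auto
    have L': "ladder n t = L((R, C) \<mapsto> 2 * n + 4, (e, C) \<mapsto> 2 * n + 3)"
      using False by (simp add: n_def L_def R_def C_def e_def Let_def)
    have new: "L (x, C) = None" for x using dom0 R C by (force simp: domIff)
    note ends = entry_ends_upd2[of "(R, C)" "(e, C)" L "2 * n + 4" "2 * n + 3", folded L']
    have V: "nth_vertex (n + 2) = Col C" "nth_vertex (n + 1) = Row R" "nth_vertex (Suc m) = Row (R - 1)"
      using False by (auto simp: nth_vertex_def R_def C_def ladder_rows_def ladder_cols_def n_def)
    have "ladder_shape (Suc (Suc m)) (ladder n t) (w(Suc m + 3 := Row e))"
    proof (rule ladder_shape_extend[OF w(1)])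
      show "Row e \<in> {w (Suc m + 1), nth_vertex (Suc m)}"
        using e r(3) unfolding nn V by auto
      show "entry_ends (ladder n t) (2 * Suc m + 6) = {nth_vertex (Suc m + 3), nth_vertex (Suc m + 2)}"
        "entry_ends (ladder n t) (2 * Suc m + 5) = {nth_vertex (Suc m + 3), Row e}"
        unfolding nn V using ends(1,2) eR new fresh by auto
      show "entry_ends (ladder n t) x = entry_ends L x" if "x \<noteq> 2 * Suc m + 6" "x \<noteq> 2 * Suc m + 5" for x
        using ends(3)[of x] that eR new fresh unfolding nn by auto
    qed simp
    moreover have "last_lines n (ladder n t) (w(n + 2 := Row e))"
    proof -
      have "col_entries (ladder n t) C = {e, R}"
        unfolding L' by (auto simp: col_entries_def new)
      moreover have "row_entries (ladder n t) R = {c, C - 1, C}"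
        using c eR unfolding L' by (auto simp: row_entries_def)
      ultimately show ?thesis
        using False eR c unfolding last_lines_def R_def[symmetric] C_def[symmetric] by auto
    qed
    ultimately show ?thesis unfolding nn n_def[symmetric] by blast
  qed
qed

text \<open>The values \<open>3 i + 2\<close> are left for the free variables.\<close>

definition code :: "vertex \<Rightarrow> nat" where
  "code v = (case v of Row i \<Rightarrow> 3 * i | Col i \<Rightarrow> 3 * i + 1)"

lemma code_eq_iff [simp]: "code u = code v \<longleftrightarrow> u = v"
  unfolding code_def by (cases u; cases v; simp; presburger)

lemma code_not_free [simp]: "Suc (Suc (3 * i)) \<noteq> code v" "code v \<noteq> Suc (Suc (3 * i))"
  unfolding code_def by (cases v; simp; presburger)+

lemma nth_vertex_eq_iff [simp]: "nth_vertex i = nth_vertex j \<longleftrightarrow> i = j"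
  unfolding nth_vertex_def by (cases "even i"; cases "even j"; simp; presburger)

lemma nth_vertex_not_first_col: "Col 1 \<noteq> nth_vertex j"
  unfolding nth_vertex_def by (auto elim!: oddE)

theorem corollary1p5:
  fixes n :: nat and t :: "bit list"
  assumes "length t = n + 1"
  shows "regularity (edges (graph_of_ladder n t))
           (toric_ring (graph_of_ladder n t)
             :: ((nat, 'k::field) mpoly, (nat, 'k) mpoly set) graded_module)
         = ereal (real (n div 2 + 1))"
proof -
  let ?G = "graph_of_ladder n t"
  have ends: "ends ?G x = entry_ends (ladder n t) x" for x
    by (simp add: graph_of_ladder_def entry_ends_def)
  obtain w where w: "ladder_shape n (ladder n t) w" using ladder_has_shape by blast
  define E where "E x = (\<Sum>v\<in>ends ?G x. single (code v) (1::nat))" for x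
  have w2: "w 2 = Col 1" using w by (simp add: ladder_shape_def)
  have pair: "(\<Sum>v\<in>{a, b}. single (code v) (1::nat)) = single (code a) 1 + single (code b) 1"
    if "a \<noteq> b" for a b using that by simp
  have wj: "w j = Col 1 \<or> (\<exists>i<j. w j = nth_vertex i)" if "2 \<le> j" "j \<le> n + 2" for j
    using that
  proof (induction j rule: less_induct)
    case (less j)
    consider "j = 2" | "j = 3" | "4 \<le> j" using less.prems by linarith
    then show ?case
    proof cases
      case 3
      then have "w j = w (j - 2) \<or> w j = nth_vertex (j - 3)" using w less.prems by (simp add: ladder_shape_def)
      moreover have "w (j - 2) = Col 1 \<or> (\<exists>i<j - 2. w (j - 2) = nth_vertex i)"
        using less.IH[of "j - 2"] less.prems 3 by simp
      ultimately show ?thesis using 3 by (metis diff_less less_trans zero_less_numeral less_le_trans diff_le_self)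
    qed (use w less.prems in \<open>auto simp: ladder_shape_def\<close>)
  qed
  interpret ladder_chain "n + 1" "\<lambda>j. code (nth_vertex j)" "\<lambda>j. code (w j)" "\<lambda>i. 3 * i + 2" E
  proof
    show "E 0 = single (code (nth_vertex 0)) 1 + single (code (w 2)) 1"
      using w nth_vertex_not_first_col[of 0] pair[of "nth_vertex 0" "Col 1"]
      by (simp add: E_def ends ladder_shape_def)
    show "E (2 * j) = single (code (nth_vertex j)) 1 + single (code (nth_vertex (j - 1))) 1"
      if "1 \<le> j" "j \<le> n + 1 + 1" for j
      using w that pair[of "nth_vertex j" "nth_vertex (j - 1)"] by (simp add: E_def ends ladder_shape_def)
    show "E (2 * j - 1) = single (code (nth_vertex j)) 1 + single (code (w j)) 1"
      if "2 \<le> j" "j \<le> n + 1 + 1" for j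
    proof -
      have "nth_vertex j \<noteq> w j" using wj[of j] nth_vertex_not_first_col[of j] that by auto
      then show ?thesis using w that pair[of "nth_vertex j" "w j"] by (simp add: E_def ends ladder_shape_def)
    qed
    show "code (w 3) = code (nth_vertex 0)" if "3 \<le> n + 1 + 1"
      using w that by (simp add: ladder_shape_def)
    show "code (w j) \<in> {code (w (j - 2)), code (nth_vertex (j - 3))}" if "4 \<le> j" "j \<le> n + 1 + 1" for j
      using w that by (auto simp: ladder_shape_def)
  qed (use w2 nth_vertex_not_first_col in \<open>auto simp: inj_def\<close>)
  have "2 * (n + 1) + 2 = 2 * n + 4" by simp
  then have X: "X = edges ?G" unfolding X_def edges_graph_of_ladder by (simp only:)
  have "toric X (weight (\<omega> (n + 1))) = (toric X (weight (graph_weight ?G)) :: (nat, 'k) mpoly set)"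
  proof (rule toric_relabel[where c = code])
    fix e assume "e \<in> X"
    then have "\<omega> (n + 1) e = E e" unfolding \<omega>_def level_def X_def by (rule if_P)
    then show "lookup (\<omega> (n + 1) e) (code v) = lookup (graph_weight ?G e) v" for v
      by (simp add: E_def graph_weight_def lookup_sum lookup_single)
    show "lookup (\<omega> (n + 1) e) u = 0" if "u \<notin> range code" for u
      using that \<open>\<omega> (n + 1) e = E e\<close> by (auto simp: E_def lookup_sum lookup_single when_def intro!: sum.neutral)
  qed
  then show ?thesis
    using regularity_chain[where 'k = 'k] unfolding toric_ring_eq_quotient toric_ideal_eq_toric X by simp
qed

end
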